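(* Let $(E,e)$ be an order-unit Banach space. Suppose that $E$ has a Banach predual $E_*$. Then the following conditions are equivalent. (i) The state space $S(E)$ (with the weak$*$ topology of $E^*$) is a Bauer simplex. (ii) $E^*$ (ordered by the dual cone) is a lattice. (iii) Any pair of $2$-outcome measurements $(a_j)_{j=1}^2$ and $(b_k)_{k=1}^2$ on $(E,e)$ are compatible.
   Context: All linear spaces are over $\mathbb{R}$. An order-unit Banach space is a pair $(E,e)$ where $E$ is an Archimedean ordered linear space with positive cone $E_+$ and $e\in E$ is an order unit (for every $a\in E$ there is $\lambda>0$ with $-\lambda e\le a\le\lambda e$) such that the order-unit norm $\|a\|=\inf\{\lambda>0 : -\lambda e\le a\le \lambda e\}$ is complete. Archimedean means: if $na\le e$ for all $n\in\mathbb{N}$ then $a\le 0$. A Banach space $E$ is said to have a Banach predual $E_*$ if $E_*$ is a Banach space whose Banach dual $(E_* )^*$ is isometrically isomorphic to $E$. The Banach dual $E^*$ is ordered by the dual positive cone $E^*_+=\{\phi\in E^* : \phi(a)\ge 0\ \forall a\in E_+\}$, and $S(E)=\{\phi\in E^*_+ : \|\phi\|=\phi(e)=1\}$ is the set of states on $E$, a weakly$*$ compact convex subset of $E^*$. A compact convex subset $K$ of a locally convex Hausdorff space is called a Bauer simplex if the set $\partial_{\mathrm e}K$ of extremal points of $K$ is compact and any point of $K$ is the barycenter of a unique boundary measure. Here a boundary measure representing a point is a Radon probability measure on $K$ that is maximal in the Choquet order ($\mu\prec\nu$ iff $\int f\,d\mu\le\int f\,d\nu$ for all continuous convex $f:K\to\mathbb{R}$),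 and $x\in K$ is the barycenter of $\mu$ if $f(x)=\int f\,d\mu$ for all continuous real affine functionals $f$ on $K$. An $m$-outcome measurement on $(E,e)$ is a finite sequence $(a_j)_{j=1}^m\in E^m$ with $a_j\ge 0$ for all $j$ and $\sum_{j=1}^m a_j=e$. Two measurements $(a_j)_{j=1}^m$ and $(b_k)_{k=1}^n$ on $(E,e)$ are called compatible if there exists a family $(c_{j,k})_{1\le j\le m,\,1\le k\le n}$ in $E$ such that $c_{j,k}\ge 0$, $a_j=\sum_{k'=1}^n c_{j,k'}$ and $b_k=\sum_{j'=1}^m c_{j',k}$ for all $1\le j\le m$, $1\le k\le n$. *)

theory Defs
  imports "HOL-Analysis.Analysis" "HOL-Probability.Probability_Measure"
begin

definition order_unit :: "'a::ordered_real_vector \<Rightarrow> bool" where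
  "order_unit e \<longleftrightarrow> (\<forall>a. \<exists>r>0. - (r *\<^sub>R e) \<le> a \<and> a \<le> r *\<^sub>R e)"

text \<open>
  The carrier of an order-unit Banach space is a type that is both a Banach space and an
  ordered real vector space, so completeness of the norm is part of the sort; the last
  conjunct says that this norm is the order-unit norm.
\<close>

definition order_unit_banach_space :: "'a::{banach, ordered_real_vector} \<Rightarrow> bool" where
  "order_unit_banach_space e \<longleftrightarrow>
     order_unit e \<and>
     (\<forall>a. (\<forall>n::nat. real n *\<^sub>R a \<le> e) \<longrightarrow> a \<le> 0) \<and>
     (\<forall>a. norm a = Inf {r. r > 0 \<and> - (r *\<^sub>R e) \<le> a \<and> a \<le> r *\<^sub>R e})"

definition isometric_isomorphism :: "('a::real_normed_vector \<Rightarrow> 'b::real_normed_vector) \<Rightarrow> bool" where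
  "isometric_isomorphism T \<longleftrightarrow> linear T \<and> bij T \<and> (\<forall>x. norm (T x) = norm x)"


definition dual_cone :: "('a::{real_normed_vector, ordered_real_vector} \<Rightarrow>\<^sub>L real) set" where
  "dual_cone = {\<phi>. \<forall>a\<ge>0. 0 \<le> blinfun_apply \<phi> a}"

definition dual_le ::
  "('a::{real_normed_vector, ordered_real_vector} \<Rightarrow>\<^sub>L real) \<Rightarrow> ('a \<Rightarrow>\<^sub>L real) \<Rightarrow> bool" where
  "dual_le \<phi> \<psi> \<longleftrightarrow> \<psi> - \<phi> \<in> dual_cone"

definition is_lattice_order :: "('a \<Rightarrow> 'a \<Rightarrow> bool) \<Rightarrow> bool" where
  "is_lattice_order le \<longleftrightarrow>
     (\<exists>inf sup. class.lattice inf le (\<lambda>x y. le x y \<and> \<not> le y x) sup)"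

definition state_space ::
  "'a::{real_normed_vector, ordered_real_vector} \<Rightarrow> ('a \<Rightarrow>\<^sub>L real) set" where
  "state_space e = {\<phi> \<in> dual_cone. norm \<phi> = 1 \<and> blinfun_apply \<phi> e = 1}"

text \<open>
  For real-valued functionals, the strong operator topology (pointwise convergence on the
  domain) is the weak* topology.
\<close>

abbreviation weak_star_topology :: "('a::real_normed_vector \<Rightarrow>\<^sub>L real) topology" where
  "weak_star_topology \<equiv> strong_operator_topology"


text \<open>
  Below, \<open>X\<close> is the topology of the ambient space (locally convex Hausdorff in all uses)
  and \<open>K\<close> a compact convex subset of it. Functions on \<open>K\<close> are total functions of which only
  the values on \<open>K\<close> matter, and measures on \<open>K\<close> live on the Borel sets of the subspace \<open>K\<close>.
\<close>

definition borel_of_topology :: "'a topology \<Rightarrow> 'a measure" where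
  "borel_of_topology X = sigma (topspace X) {U. openin X U}"

definition radon_prob_measure :: "'a topology \<Rightarrow> 'a measure \<Rightarrow> bool" where
  "radon_prob_measure X \<mu> \<longleftrightarrow>
     prob_space \<mu> \<and>
     sets \<mu> = sets (borel_of_topology X) \<and>
     (\<forall>B\<in>sets \<mu>. emeasure \<mu> B = (SUP C\<in>{C. compactin X C \<and> C \<subseteq> B}. emeasure \<mu> C))"

definition choquet_le ::
  "'a::real_vector topology \<Rightarrow> 'a set \<Rightarrow> 'a measure \<Rightarrow> 'a measure \<Rightarrow> bool" where
  "choquet_le X K \<mu> \<nu> \<longleftrightarrow>
     (\<forall>f. continuous_map (subtopology X K) euclideanreal f \<and> convex_on K f \<longrightarrow>
          integral\<^sup>L \<mu> f \<le> integral\<^sup>L \<nu> f)"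

definition boundary_measure :: "'a::real_vector topology \<Rightarrow> 'a set \<Rightarrow> 'a measure \<Rightarrow> bool" where
  "boundary_measure X K \<mu> \<longleftrightarrow>
     radon_prob_measure (subtopology X K) \<mu> \<and>
     (\<forall>\<nu>. radon_prob_measure (subtopology X K) \<nu> \<and> choquet_le X K \<mu> \<nu> \<longrightarrow> \<nu> = \<mu>)"

definition affine_functional_on :: "'a::real_vector set \<Rightarrow> ('a \<Rightarrow> real) \<Rightarrow> bool" where
  "affine_functional_on K f \<longleftrightarrow>
     (\<forall>x\<in>K. \<forall>y\<in>K. \<forall>t\<in>{0..1}. f ((1 - t) *\<^sub>R x + t *\<^sub>R y) = (1 - t) * f x + t * f y)"

definition barycenter ::
  "'a::real_vector topology \<Rightarrow> 'a set \<Rightarrow> 'a measure \<Rightarrow> 'a \<Rightarrow> bool" where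
  "barycenter X K \<mu> x \<longleftrightarrow>
     x \<in> K \<and>
     (\<forall>f. continuous_map (subtopology X K) euclideanreal f \<and> affine_functional_on K f \<longrightarrow>
          f x = integral\<^sup>L \<mu> f)"

definition bauer_simplex :: "'a::real_vector topology \<Rightarrow> 'a set \<Rightarrow> bool" where
  "bauer_simplex X K \<longleftrightarrow>
     compactin X K \<and> convex K \<and>
     compactin X {x. x extreme_point_of K} \<and>
     (\<forall>x\<in>K. \<exists>!\<mu>. boundary_measure X K \<mu> \<and> barycenter X K \<mu> x)"


definition measurement :: "'a::ordered_real_vector \<Rightarrow> nat \<Rightarrow> (nat \<Rightarrow> 'a) \<Rightarrow> bool" where
  "measurement e m a \<longleftrightarrow> (\<forall>j\<in>{1..m}. 0 \<le> a j) \<and> (\<Sum>j=1..m. a j) = e"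

definition compatible ::
  "nat \<Rightarrow> nat \<Rightarrow> (nat \<Rightarrow> 'a::ordered_real_vector) \<Rightarrow> (nat \<Rightarrow> 'a) \<Rightarrow> bool" where
  "compatible m n a b \<longleftrightarrow>
     (\<exists>c :: nat \<Rightarrow> nat \<Rightarrow> 'a. \<forall>j\<in>{1..m}. \<forall>k\<in>{1..n}.
        0 \<le> c j k \<and> a j = (\<Sum>k'=1..n. c j k') \<and> b k = (\<Sum>j'=1..m. c j' k))"

end

theory Submission
  imports Defs "HOL-Library.Function_Algebras"
begin

text \<open>
  Write \<open>E\<close> for the space, \<open>K\<close> for its state space and \<open>X\<close> for the extreme points of \<open>K\<close>.
  Each of the three conditions is equivalent to \<open>E\<close> itself being a vector lattice.

  If \<open>E\<close> is a lattice, so is its dual (Riesz-Kantorovich), and two effects \<open>a, b\<close> have the joint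
  measurement built from \<open>inf a b\<close>. Conversely, let \<open>N\<close> be a sublattice of the dual containing the
  predual. The functional \<open>f \<mapsto> sup {g a | g. 0 \<le> g \<le> f}\<close> on \<open>N\<close> restricts to the predual, hence is
  an element of \<open>E\<close>, and it is the positive part of \<open>a\<close>. For a dual lattice take \<open>N\<close> to be the whole
  dual. Under compatibility take the functionals that are continuous on the weak* compact set of
  effects: such an \<open>f\<close> attains its maximum at an extreme effect \<open>p\<close>, compatibility with \<open>p\<close> yields a
  positive projection \<open>Q\<close> of \<open>E\<close> onto the span of \<open>[0, p]\<close>, and \<open>f \<circ> Q\<close> is the positive part of \<open>f\<close>.

  If \<open>E\<close> is a lattice, \<open>X\<close> consists of the lattice homomorphisms and is therefore closed, and \<open>E\<close> is
  uniformly dense in the continuous functions on \<open>X\<close>; this makes representing measures on \<open>X\<close>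
  unique. Conversely, for a Bauer simplex, uniqueness of representing measures and Hahn-Banach
  force \<open>E\<close> to be dense in the continuous functions on \<open>X\<close>, so that \<open>max a 0\<close> belongs to \<open>E\<close>.
\<close>

section \<open>The Hahn-Banach theorem\<close>

text \<open>A supremum over an order interval of a dual is a priori only a functional on
  \<open>N\<close>, not an element of \<open>E\<close>. Two facts bring it back: a bounded
  functional on the predual is an element of \<open>E\<close>, and in an order-unit space positivity
  is a norm inequality, which the predual can test. The price is a decomposition of predual
  functionals into positive ones inside \<open>N\<close> with total mass at most the norm. For the
  whole dual Hahn-Banach supplies it; under compatibility the extreme effect \<open>p\<close> does,
  because \<open>2 p - e\<close> has norm at most 1, and \<open>N\<close> is chosen so as to be
  stable under \<open>f \<mapsto> f \<circ> Q\<close>.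

  On the measure side, concentration on \<open>X\<close> is expressed by an inequality for integrals
  of functions on \<open>K\<close>, so that Hahn-Banach functionals and boundary measures are
  compared without changing the underlying space. Maximality of such measures in the Choquet order
  rests on one property of an extreme point: every positive functional below it is a multiple of
  it.\<close>

instantiation "fun" :: (type, real_vector) real_vector
begin

definition scaleR_fun :: "real \<Rightarrow> ('a \<Rightarrow> 'b) \<Rightarrow> 'a \<Rightarrow> 'b" where
  "scaleR_fun r f = (\<lambda>x. r *\<^sub>R f x)"

instance
  by standard (auto simp: scaleR_fun_def fun_eq_iff algebra_simps)

end

lemma scaleR_fun_apply [simp]: "(r *\<^sub>R f) x = r *\<^sub>R f x"
  by (simp add: scaleR_fun_def)

text \<open>Relative to a carrier \<open>S\<close>, so that the continuous functions on the state
  space can be handled as a subspace of the space of all functions, which the instance above makes a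
  real vector space.\<close>

definition sublinear_on :: "'v::real_vector set \<Rightarrow> ('v \<Rightarrow> real) \<Rightarrow> bool" where
  "sublinear_on S p \<longleftrightarrow>
     (\<forall>x\<in>S. \<forall>y\<in>S. p (x + y) \<le> p x + p y) \<and> (\<forall>x\<in>S. \<forall>r>0. p (r *\<^sub>R x) = r * p x)"

definition linear_functional_on :: "'v::real_vector set \<Rightarrow> ('v \<Rightarrow> real) \<Rightarrow> bool" where
  "linear_functional_on S F \<longleftrightarrow>
     (\<forall>x\<in>S. \<forall>y\<in>S. F (x + y) = F x + F y) \<and> (\<forall>x\<in>S. \<forall>r. F (r *\<^sub>R x) = r * F x)"

text \<open>The inequality for \<open>r\<close> and the one for \<open>inverse r\<close> together
  give equality, so positive homogeneity is checked in one direction only.\<close>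

lemma sublinear_onI:
  assumes "\<And>x y. x \<in> S \<Longrightarrow> y \<in> S \<Longrightarrow> p (x + y) \<le> p x + p y"
    and "\<And>x r. x \<in> S \<Longrightarrow> r > 0 \<Longrightarrow> p (r *\<^sub>R x) \<le> r * p x"
    and "subspace S"
  shows "sublinear_on S p"
  unfolding sublinear_on_def
proof (intro conjI ballI allI impI)
  fix x r assume x: "x \<in> S" and r: "(r::real) > 0"
  have "p (inverse r *\<^sub>R (r *\<^sub>R x)) \<le> inverse r * p (r *\<^sub>R x)"
    using x r assms(3) by (intro assms(2)) (auto simp: subspace_scale)
  then have "p x \<le> p (r *\<^sub>R x) / r"
    using r by (simp add: field_simps)
  then have "r * p x \<le> p (r *\<^sub>R x)"
    using r by (simp add: field_simps)
  then show "p (r *\<^sub>R x) = r * p x" using assms(2)[OF x r] by simp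
qed (use assms in auto)

lemma sublinear_on_add: "sublinear_on S p \<Longrightarrow> x \<in> S \<Longrightarrow> y \<in> S \<Longrightarrow> p (x + y) \<le> p x + p y"
  by (simp add: sublinear_on_def)

lemma sublinear_on_scale: "sublinear_on S p \<Longrightarrow> x \<in> S \<Longrightarrow> r > 0 \<Longrightarrow> p (r *\<^sub>R x) = r * p x"
  by (simp add: sublinear_on_def)

lemma sublinear_on_zero: "sublinear_on S p \<Longrightarrow> subspace S \<Longrightarrow> p 0 = 0"
  using sublinear_on_scale[of S p 0 2] by (simp add: subspace_0)

lemma sublinear_on_neg:
  assumes "sublinear_on S p" "subspace S" "x \<in> S" shows "- p (- x) \<le> p x"
  using sublinear_on_add[OF assms(1,3), of "- x"] sublinear_on_zero[OF assms(1,2)] assms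
  by (simp add: subspace_neg)

text \<open>Pushing \<open>p\<close> down along the ray through \<open>y\<close>; a minimal sublinear functional admits no
  proper push, which makes it additive.\<close>

definition push_down :: "'v::real_vector \<Rightarrow> ('v \<Rightarrow> real) \<Rightarrow> 'v \<Rightarrow> real" where
  "push_down y p x = (INF t\<in>{0..}. p (x + t *\<^sub>R y) - t * p y)"

lemma
  assumes p: "sublinear_on S p" and S: "subspace S" and y: "y \<in> S"
  shows sublinear_push_down: "sublinear_on S (push_down y p)"
    and push_down_le: "x \<in> S \<Longrightarrow> t \<ge> 0 \<Longrightarrow> push_down y p x \<le> p (x + t *\<^sub>R y) - t * p y"
proof -
  \<comment> \<open>A bound that does not involve \<open>t\<close>: it makes the infimum in
    \<open>push_down\<close> one over a set bounded below.\<close>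
  have lower: "- p (- x) \<le> p (x + t *\<^sub>R y) - t * p y" if "x \<in> S" "t \<ge> 0" for x t
  proof (cases "t = 0")
    case True
    then show ?thesis using sublinear_on_neg[OF p S] that by simp
  next
    case False
    have "p (t *\<^sub>R y) \<le> p (x + t *\<^sub>R y) + p (- x)"
      using sublinear_on_add[OF p, of "x + t *\<^sub>R y" "- x"] that S y
      by (simp add: subspace_add subspace_scale subspace_neg)
    then show ?thesis using sublinear_on_scale[OF p y, of t] that False by simp
  qed
  have bdd: "bdd_below ((\<lambda>t. p (x + t *\<^sub>R y) - t * p y) ` {0..})" if "x \<in> S" for x
    using lower[OF that] by (intro bdd_belowI2[of _ "- p (- x)"]) auto
  show le: "push_down y p x \<le> p (x + t *\<^sub>R y) - t * p y" if "x \<in> S" "t \<ge> 0" for x t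
    unfolding push_down_def using that by (intro cINF_lower[OF bdd]) auto
  show "sublinear_on S (push_down y p)"
  proof (rule sublinear_onI[OF _ _ S])
    fix x x' assume x: "x \<in> S" and x': "x' \<in> S"
    have xx: "x + x' \<in> S" using x x' S by (simp add: subspace_add)
    have "push_down y p (x + x') - (p (x' + s *\<^sub>R y) - s * p y) \<le> p (x + t *\<^sub>R y) - t * p y"
      if "t \<ge> 0" "s \<ge> 0" for t s
    proof -
      have "p ((x + t *\<^sub>R y) + (x' + s *\<^sub>R y)) \<le> p (x + t *\<^sub>R y) + p (x' + s *\<^sub>R y)"
        using x x' y S by (intro sublinear_on_add[OF p]) (auto simp: subspace_add subspace_scale)
      moreover have "(x + t *\<^sub>R y) + (x' + s *\<^sub>R y) = (x + x') + (t + s) *\<^sub>R y"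
        by (simp add: algebra_simps)
      ultimately show ?thesis using le[OF xx, of "t + s"] that by (simp add: algebra_simps)
    qed
    then have "push_down y p (x + x') - (p (x' + s *\<^sub>R y) - s * p y) \<le> push_down y p x"
      if "s \<ge> 0" for s
      unfolding push_down_def[of y p x] using that by (intro cINF_greatest) auto
    then have "push_down y p (x + x') - push_down y p x \<le> p (x' + s *\<^sub>R y) - s * p y"
      if "s \<ge> 0" for s
      using that by (simp add: algebra_simps)
    then have "push_down y p (x + x') - push_down y p x \<le> push_down y p x'"
      unfolding push_down_def[of y p x'] by (intro cINF_greatest) auto
    then show "push_down y p (x + x') \<le> push_down y p x + push_down y p x'" by simp
  next
    fix x and r :: real assume x: "x \<in> S" and r: "r > 0"
    have rx: "r *\<^sub>R x \<in> S" using x S by (simp add: subspace_scale)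
    have "push_down y p (r *\<^sub>R x) / r \<le> p (x + t *\<^sub>R y) - t * p y" if t: "t \<ge> 0" for t
    proof -
      have "push_down y p (r *\<^sub>R x) \<le> p (r *\<^sub>R x + (r * t) *\<^sub>R y) - r * t * p y"
        using le[OF rx, of "r * t"] r t by simp
      also have "r *\<^sub>R x + (r * t) *\<^sub>R y = r *\<^sub>R (x + t *\<^sub>R y)"
        by (simp add: algebra_simps)
      also have "p \<dots> = r * p (x + t *\<^sub>R y)"
        using x y S r by (intro sublinear_on_scale[OF p]) (auto simp: subspace_add subspace_scale)
      finally show ?thesis using r by (simp add: field_simps)
    qed
    then have "push_down y p (r *\<^sub>R x) / r \<le> push_down y p x"
      unfolding push_down_def[of y p x] by (intro cINF_greatest) auto
    then show "push_down y p (r *\<^sub>R x) \<le> r * push_down y p x" using r by (simp add: field_simps)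
  qed
qed

text \<open>Zorn's lemma for the reversed pointwise order. The candidates are normalised to vanish
  off \<open>S\<close>, which turns antisymmetry on \<open>S\<close> into an equality of functions;
  the lower bound \<open>- p (- x)\<close> is common to a whole chain, so its pointwise infimum
  exists.\<close>

lemma minimal_sublinear:
  assumes p: "sublinear_on S p" and S: "subspace S"
  obtains q where "sublinear_on S q" "\<And>x. x \<in> S \<Longrightarrow> q x \<le> p x"
    "\<And>q' x. sublinear_on S q' \<Longrightarrow> (\<And>x. x \<in> S \<Longrightarrow> q' x \<le> q x) \<Longrightarrow> x \<in> S \<Longrightarrow> q' x = q x"
proof -
  define A where "A = {q. sublinear_on S q \<and> (\<forall>x\<in>S. q x \<le> p x) \<and> (\<forall>x. x \<notin> S \<longrightarrow> q x = 0)}"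
  define P where "P = (\<lambda>q q'. \<forall>x\<in>S. (q' x :: real) \<le> q x)"
  have eqI: "q = q'" if "q \<in> A" "q' \<in> A" "P q q'" "P q' q" for q q'
  proof
    fix x show "q x = q' x"
      using that by (cases "x \<in> S") (auto simp: A_def P_def intro: antisym)
  qed
  have po: "partial_order_on A (relation_of P A)"
    unfolding partial_order_on_def preorder_on_def
  proof (intro conjI)
    show "refl_on A (relation_of P A)"
      by (auto simp: refl_on_def relation_of_def P_def)
    show "relation_of P A \<subseteq> A \<times> A" by (auto simp: relation_of_def)
    show "trans (relation_of P A)"
      unfolding trans_def relation_of_def P_def by (auto intro: order_trans)
    show "antisym (relation_of P A)"
      unfolding antisym_def relation_of_def by (auto intro: eqI)
  qed
  define p0 where "p0 = (\<lambda>x. if x \<in> S then p x else 0)"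
  have p0: "p0 \<in> A"
    using p S by (auto simp: A_def p0_def sublinear_on_def subspace_add subspace_scale)
  have ch: "\<exists>u\<in>A. \<forall>a\<in>C. P a u" if C: "C \<in> Chains (relation_of P A)" for C
  proof (cases "C = {}")
    case True
    then show ?thesis using p0 by auto
  next
    case False
    have CA: "q \<in> A" if "q \<in> C" for q
      using C that unfolding Chains_def relation_of_def by auto
    have tot: "P q q' \<or> P q' q" if "q \<in> C" "q' \<in> C" for q q'
      using C that unfolding Chains_def relation_of_def by auto
    have sq: "sublinear_on S q" if "q \<in> C" for q using CA[OF that] by (simp add: A_def)
    have bdd: "bdd_below ((\<lambda>q. q x) ` C)" if "x \<in> S" for x
    proof (rule bdd_belowI2)
      fix q assume "q \<in> C"
      then have "- q (- x) \<le> q x" "q (- x) \<le> p (- x)"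
        using sublinear_on_neg[OF sq S that] CA[of q] S that by (auto simp: A_def subspace_neg)
      then show "- p (- x) \<le> q x" by simp
    qed
    define u where "u = (\<lambda>x. if x \<in> S then INF q\<in>C. q x else 0)"
    have ule: "u x \<le> q x" if "x \<in> S" "q \<in> C" for x q
      unfolding u_def using that by (auto intro: cINF_lower bdd)
    have usub: "sublinear_on S u"
    proof (rule sublinear_onI[OF _ _ S])
      fix x y assume x: "x \<in> S" and y: "y \<in> S"
      have xy: "x + y \<in> S" using x y S by (simp add: subspace_add)
      \<comment> \<open>Two members of a chain are comparable; the smaller one bounds both
        summands.\<close>
      have *: "u (x + y) \<le> q x + q' y" if q: "q \<in> C" and q': "q' \<in> C" for q q'
      proof (cases "P q q'")
        case True
        have "u (x + y) \<le> q' (x + y)" using ule xy q' by simp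
        also have "\<dots> \<le> q' x + q' y" using sublinear_on_add[OF sq[OF q'] x y] .
        also have "\<dots> \<le> q x + q' y" using True x by (simp add: P_def)
        finally show ?thesis .
      next
        case False
        then have "P q' q" using tot q q' by blast
        have "u (x + y) \<le> q (x + y)" using ule xy q by simp
        also have "\<dots> \<le> q x + q y" using sublinear_on_add[OF sq[OF q] x y] .
        also have "\<dots> \<le> q x + q' y" using \<open>P q' q\<close> y by (simp add: P_def)
        finally show ?thesis .
      qed
      have "u (x + y) - q' y \<le> u x" if "q' \<in> C" for q'
      proof -
        have "u (x + y) - q' y \<le> (INF q\<in>C. q x)"
          using *[OF _ that] False by (intro cINF_greatest) (auto simp: algebra_simps)
        then show ?thesis using x by (simp only: u_def if_True)
      qed
      then have "u (x + y) - u x \<le> q' y" if "q' \<in> C" for q'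
        using that by (simp add: algebra_simps)
      then have "u (x + y) - u x \<le> (INF q\<in>C. q y)"
        using False by (intro cINF_greatest) auto
      then show "u (x + y) \<le> u x + u y" using y by (simp add: u_def)
    next
      fix x and r :: real assume x: "x \<in> S" and r: "r > 0"
      have rx: "r *\<^sub>R x \<in> S" using x S by (simp add: subspace_scale)
      have "u (r *\<^sub>R x) / r \<le> q x" if "q \<in> C" for q
        using ule[OF rx that] sublinear_on_scale[OF sq[OF that] x r] r by (simp add: field_simps)
      then have "u (r *\<^sub>R x) / r \<le> (INF q\<in>C. q x)"
        using False by (intro cINF_greatest) auto
      then show "u (r *\<^sub>R x) \<le> r * u x" using r x by (simp add: u_def field_simps)
    qed
    have "u \<in> A"
    proof -
      obtain q where "q \<in> C" using False by auto
      then have "\<forall>x\<in>S. u x \<le> p x" using ule CA[of q] by (fastforce simp: A_def)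
      then show ?thesis using usub by (simp add: A_def u_def)
    qed
    moreover have "\<forall>a\<in>C. P a u" using ule by (simp add: P_def)
    ultimately show ?thesis by blast
  qed
  obtain q where qA: "q \<in> A" and qmin: "\<And>a. a \<in> A \<Longrightarrow> P q a \<Longrightarrow> a = q"
    using predicate_Zorn[OF po ch] by blast
  show thesis
  proof (rule that[of q])
    show "sublinear_on S q" "\<And>x. x \<in> S \<Longrightarrow> q x \<le> p x" using qA by (auto simp: A_def)
    fix q' x assume q': "sublinear_on S q'" "\<And>x. x \<in> S \<Longrightarrow> q' x \<le> q x" and x: "x \<in> S"
    define q0 where "q0 = (\<lambda>x. if x \<in> S then q' x else 0)"
    have "sublinear_on S q0"
      using q'(1) S by (auto simp: q0_def sublinear_on_def subspace_add subspace_scale)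
    moreover have "q0 x \<le> p x" if "x \<in> S" for x
      using q'(2)[OF that] qA that by (force simp: A_def q0_def)
    ultimately have "q0 \<in> A" by (simp add: A_def q0_def)
    moreover have "P q q0" using q'(2) by (simp add: P_def q0_def)
    ultimately have "q0 = q" by (rule qmin)
    then have "q0 x = q x" by simp
    then show "q' x = q x" using x by (simp add: q0_def)
  qed
qed

text \<open>Minimality is taken below \<open>push_down v p\<close> rather than below
  \<open>p\<close>: the choice \<open>t = 1\<close> there gives
  \<open>F (- v) \<le> p 0 - p v\<close>, which forces \<open>F v = p v\<close>.\<close>

theorem hahn_banach_sublinear:
  assumes p: "sublinear_on S p" and S: "subspace S" and v: "v \<in> S"
  obtains F where "linear_functional_on S F" "\<And>x. x \<in> S \<Longrightarrow> F x \<le> p x" "F v = p v"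
proof -
  obtain F where F: "sublinear_on S F" "\<And>x. x \<in> S \<Longrightarrow> F x \<le> push_down v p x"
    and min: "\<And>q' x. sublinear_on S q' \<Longrightarrow> (\<And>x. x \<in> S \<Longrightarrow> q' x \<le> F x) \<Longrightarrow> x \<in> S \<Longrightarrow> q' x = F x"
    by (rule minimal_sublinear[OF sublinear_push_down[OF p S v] S]; blast)
  have add: "F (x + y) = F x + F y" if x: "x \<in> S" and y: "y \<in> S" for x y
  proof -
    have "push_down y F x = F x"
      using push_down_le[OF F(1) S y, of _ 0]
      by (intro min sublinear_push_down F(1) S y x) auto
    then have "F x \<le> F (x + y) - F y"
      using push_down_le[OF F(1) S y x, of 1] by simp
    then show ?thesis using sublinear_on_add[OF F(1) x y] by simp
  qed
  have neg: "F (- x) = - F x" if "x \<in> S" for x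
    using add[OF that subspace_neg[OF S that]] sublinear_on_zero[OF F(1) S] by simp
  have scale: "F (r *\<^sub>R x) = r * F x" if x: "x \<in> S" for x r
  proof -
    consider "r = 0" | "r > 0" | "r < 0" by linarith
    then show ?thesis
    proof cases
      case 1 then show ?thesis using sublinear_on_zero[OF F(1) S] by simp
    next
      case 2 then show ?thesis using sublinear_on_scale[OF F(1) x] by simp
    next
      case 3
      then have "F ((- r) *\<^sub>R x) = - r * F x"
        by (intro sublinear_on_scale[OF F(1) x]) auto
      then show ?thesis using neg[OF subspace_scale[OF S x], of r] by simp
    qed
  qed
  have le: "F x \<le> p x" if "x \<in> S" for x
    using F(2)[OF that] push_down_le[OF p S v that, of 0] by simp
  have "F (- v) \<le> p (- v + 1 *\<^sub>R v) - 1 * p v"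
    using F(2)[OF subspace_neg[OF S v]] push_down_le[OF p S v subspace_neg[OF S v], of 1] by simp
  then have "p v \<le> F v" using neg[OF v] sublinear_on_zero[OF p S] by simp
  with le[OF v] have "F v = p v" by simp
  with add scale le show thesis by (intro that[of F]) (auto simp: linear_functional_on_def)
qed

text \<open>The interface for all later separation arguments: \<open>A x\<close> is the set of upper
  bounds that some witness certifies for \<open>x\<close>, and adding and scaling witnesses gives
  sublinearity of the infimum. Equality at the prescribed \<open>v\<close> is the quantitative
  content.\<close>

theorem hahn_banach_Inf:
  fixes A :: "'v::real_vector \<Rightarrow> real set"
  assumes S: "subspace S" and v: "v \<in> S"
    and ne: "\<And>x. x \<in> S \<Longrightarrow> A x \<noteq> {}" and bdd: "\<And>x. x \<in> S \<Longrightarrow> bdd_below (A x)"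
    and add: "\<And>x y l k. l \<in> A x \<Longrightarrow> k \<in> A y \<Longrightarrow> l + k \<in> A (x + y)"
    and scale: "\<And>x r l. r > 0 \<Longrightarrow> l \<in> A x \<Longrightarrow> r * l \<in> A (r *\<^sub>R x)"
  obtains F where "linear_functional_on S F" "\<And>x l. x \<in> S \<Longrightarrow> l \<in> A x \<Longrightarrow> F x \<le> l" "F v = Inf (A v)"
proof -
  define p where "p x = Inf (A x)" for x
  have ple: "p x \<le> l" if "x \<in> S" "l \<in> A x" for x l
    unfolding p_def using that by (intro cInf_lower bdd)
  have pge: "c \<le> p x" if "x \<in> S" "\<And>l. l \<in> A x \<Longrightarrow> c \<le> l" for x c
    unfolding p_def using that by (intro cInf_greatest ne)
  have sub: "sublinear_on S p"
  proof (rule sublinear_onI[OF _ _ S])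
    fix x y assume x: "x \<in> S" and y: "y \<in> S"
    have xy: "x + y \<in> S" using S x y by (rule subspace_add)
    have *: "p (x + y) - k \<le> p x" if k: "k \<in> A y" for k
    proof (rule pge[OF x])
      show "p (x + y) - k \<le> l" if "l \<in> A x" for l using ple[OF xy add[OF that k]] by simp
    qed
    have "p (x + y) - p x \<le> p y"
    proof (rule pge[OF y])
      show "p (x + y) - p x \<le> k" if "k \<in> A y" for k using *[OF that] by simp
    qed
    then show "p (x + y) \<le> p x + p y" by simp
  next
    fix x and r :: real assume x: "x \<in> S" and r: "r > 0"
    have rx: "r *\<^sub>R x \<in> S" using S x by (rule subspace_scale)
    have "p (r *\<^sub>R x) / r \<le> p x"
    proof (rule pge[OF x])
      show "p (r *\<^sub>R x) / r \<le> l" if "l \<in> A x" for l using ple[OF rx scale[OF r that]] r by (simp add: field_simps)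
    qed
    then show "p (r *\<^sub>R x) \<le> r * p x" using r by (simp add: field_simps)
  qed
  obtain F where F: "linear_functional_on S F" "\<And>x. x \<in> S \<Longrightarrow> F x \<le> p x" "F v = p v"
    by (rule hahn_banach_sublinear[OF sub S v]; blast)
  show thesis
  proof (rule that[OF F(1)])
    show "F x \<le> l" if "x \<in> S" "l \<in> A x" for x l using F(2)[OF that(1)] ple[OF that] by simp
    show "F v = Inf (A v)" using F(3) by (simp add: p_def)
  qed
qed

section \<open>Bauer's maximum principle and Stone-Weierstrass\<close>

lemma compactin_index_subcover:
  assumes "compactin T A" "\<And>i. i \<in> I \<Longrightarrow> openin T (U i)" "A \<subseteq> (\<Union>i\<in>I. U i)"
  obtains J where "finite J" "J \<subseteq> I" "A \<subseteq> (\<Union>i\<in>J. U i)"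
proof -
  obtain \<F> where "finite \<F>" "\<F> \<subseteq> U ` I" "A \<subseteq> \<Union>\<F>"
    using compactinD[OF assms(1), of "U ` I"] assms(2,3) by auto
  then show thesis by (metis finite_subset_image that)
qed

lemma continuous_attains_max:
  fixes g :: "'a \<Rightarrow> real"
  assumes "compactin T A" "A \<noteq> {}" "continuous_map T euclideanreal g"
  obtains z where "z \<in> A" "\<And>y. y \<in> A \<Longrightarrow> g y \<le> g z"
proof -
  have "compact (g ` A)"
    using image_compactin[OF assms(1,3)] by simp
  then obtain s where "s \<in> g ` A" "\<forall>t\<in>g ` A. t \<le> s"
    using compact_attains_sup assms(2) by (metis image_is_empty)
  then show thesis using that by auto
qed

lemma continuous_map_bounded:
  fixes g :: "'a \<Rightarrow> real"
  assumes "compact_space T" "continuous_map T euclideanreal g"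
  obtains B where "B > 0" "\<And>x. x \<in> topspace T \<Longrightarrow> \<bar>g x\<bar> \<le> B"
proof -
  have "compact (g ` topspace T)"
    using image_compactin[of T "topspace T" euclideanreal g] assms by (simp add: compact_space_def)
  then have "bounded (g ` topspace T)" by (rule compact_imp_bounded)
  then obtain B where "B > 0" "\<forall>y\<in>g ` topspace T. norm y \<le> B" using bounded_pos by blast
  then show thesis using that by auto
qed

lemma closedin_level_set:
  fixes g :: "'a \<Rightarrow> real"
  assumes "continuous_map T euclideanreal g" "closedin T A"
  shows "closedin T {x \<in> A. g x = c}"
proof -
  have "closedin T {x \<in> topspace T. g x \<in> {c}}"
    by (rule closedin_continuous_map_preimage[OF assms(1)]) simp
  then have "closedin T (A \<inter> {x \<in> topspace T. g x \<in> {c}})" using assms(2) by blast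
  moreover have "A \<inter> {x \<in> topspace T. g x \<in> {c}} = {x \<in> A. g x = c}"
    using closedin_subset[OF assms(2)] by auto
  ultimately show ?thesis by simp
qed

text \<open>The extreme point is found as a minimal closed extremal subset of the set of maximisers.\<close>

theorem bauer_maximum_principle:
  fixes K :: "'v::real_vector set" and f :: "'v \<Rightarrow> real"
  assumes K: "compactin W K" "K \<noteq> {}"
    and L: "\<And>l. l \<in> L \<Longrightarrow> linear l" "\<And>l. l \<in> L \<Longrightarrow> continuous_map (subtopology W K) euclideanreal l"
    and sep: "\<And>x y. x \<in> K \<Longrightarrow> y \<in> K \<Longrightarrow> (\<And>l. l \<in> L \<Longrightarrow> l x = l y) \<Longrightarrow> x = y"
    and f: "continuous_map (subtopology W K) euclideanreal f" "convex_on K f"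
  obtains x where "x extreme_point_of K" "\<And>y. y \<in> K \<Longrightarrow> f y \<le> f x"
proof -
  define T where "T = subtopology W K"
  have top: "topspace T = K"
    using compactin_subset_topspace[OF K(1)] by (auto simp: T_def)
  have cT: "compact_space T" using K(1) by (simp add: T_def compact_space_subtopology)
  have cin: "compactin T A" if "closedin T A" for A
    using cT that by (simp add: closedin_compact_space)
  define extremal where
    "extremal A \<longleftrightarrow> A \<noteq> {} \<and> closedin T A \<and> (\<forall>u\<in>K. \<forall>v\<in>K. \<forall>z\<in>open_segment u v. z \<in> A \<longrightarrow> u \<in> A \<and> v \<in> A)" for A
  have sub: "A \<subseteq> K" if "extremal A" for A
    using that closedin_subset[of T A] top by (auto simp: extremal_def)
  \<comment> \<open>If a convex function takes its maximum over \<open>A\<close> at an inner point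
    of a segment with ends in \<open>A\<close>, it takes it at both ends, so the maximisers are
    again extremal.\<close>
  have argmax: "extremal {x \<in> A. g x = g z}"
    if A: "extremal A" and g: "continuous_map T euclideanreal g" "convex_on K g"
      and z: "z \<in> A" "\<And>y. y \<in> A \<Longrightarrow> g y \<le> g z" for A g z
    unfolding extremal_def
  proof (intro conjI ballI impI)
    show "{x \<in> A. g x = g z} \<noteq> {}" using z by auto
    show "closedin T {x \<in> A. g x = g z}"
      using A g by (intro closedin_level_set) (auto simp: extremal_def)
  next
    fix u v w assume u: "u \<in> K" and v: "v \<in> K" and w: "w \<in> open_segment u v" "w \<in> {x \<in> A. g x = g z}"
    have uv: "u \<in> A" "v \<in> A" using A u v w unfolding extremal_def by blast+
    obtain t where t: "0 < t" "t < 1" "w = (1 - t) *\<^sub>R u + t *\<^sub>R v"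
      using w(1) by (auto simp: in_segment)
    have "g w \<le> (1 - t) * g u + t * g v"
      using convex_onD[OF g(2), of t u v] t u v by simp
    then have *: "(1 - t) * (g z - g u) + t * (g z - g v) \<le> 0"
      using w(2) by (simp add: algebra_simps)
    have "(1 - t) * (g z - g u) \<ge> 0" "t * (g z - g v) \<ge> 0"
      using t z(2) uv by auto
    with * have "(1 - t) * (g z - g u) = 0" "t * (g z - g v) = 0" by linarith+
    then have "g u = g z" "g v = g z" using t by auto
    then show "u \<in> {x \<in> A. g x = g z}" "v \<in> {x \<in> A. g x = g z}" using uv by auto
  qed
  have "extremal K"
    using K(2) top by (auto simp: extremal_def)
  moreover obtain z where z: "z \<in> K" "\<And>y. y \<in> K \<Longrightarrow> f y \<le> f z"
    using continuous_attains_max[of T K f] cin[of K] K(2) f(1) top closedin_topspace[of T]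
    by (auto simp: T_def)
  ultimately have M: "extremal {x \<in> K. f x = f z}"
    using argmax[of K f z] f by (auto simp: T_def)
  define M where "M = {x \<in> K. f x = f z}"
  define \<A> where "\<A> = {A. extremal A \<and> A \<subseteq> M}"
  define P where "P = (\<lambda>A B :: 'v set. B \<subseteq> A)"
  have po: "partial_order_on \<A> (relation_of P \<A>)"
    unfolding partial_order_on_def preorder_on_def refl_on_def trans_def antisym_def relation_of_def P_def
    by auto
  have ch: "\<exists>u\<in>\<A>. \<forall>a\<in>\<C>. P a u" if C: "\<C> \<in> Chains (relation_of P \<A>)" for \<C>
  proof (cases "\<C> = {}")
    case True
    then show ?thesis using M by (auto simp: \<A>_def M_def)
  next
    case False
    have CA: "\<C> \<subseteq> \<A>" and tot: "\<And>A B. A \<in> \<C> \<Longrightarrow> B \<in> \<C> \<Longrightarrow> A \<subseteq> B \<or> B \<subseteq> A"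
      using C unfolding Chains_def relation_of_def P_def by auto
    have fin: "\<Inter>\<F> \<in> \<F>" if "finite \<F>" "\<F> \<noteq> {}" "\<F> \<subseteq> \<C>" for \<F>
      using that
    proof (induction \<F> rule: finite_ne_induct)
      case (insert A \<F>)
      then have "\<Inter>\<F> \<in> \<F>" by auto
      moreover have "A \<subseteq> \<Inter>\<F> \<or> \<Inter>\<F> \<subseteq> A" using tot[of A "\<Inter>\<F>"] insert calculation by auto
      ultimately show ?case by (auto simp: Int_absorb1 Int_absorb2)
    qed simp
    have "\<Inter>\<C> \<noteq> {}"
    proof -
      have c1: "closedin T A" if "A \<in> \<C>" for A using CA that by (auto simp: \<A>_def extremal_def)
      have c2: "\<Inter>\<F> \<noteq> {}" if "finite \<F>" "\<F> \<subseteq> \<C>" for \<F>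
      proof (cases "\<F> = {}")
        case False
        then have "\<Inter>\<F> \<in> \<C>" using fin that by blast
        then show ?thesis using CA by (auto simp: \<A>_def extremal_def)
      qed auto
      show ?thesis
        by (rule cT[unfolded compact_space_fip, THEN spec, THEN mp]) (use c1 c2 in blast)
    qed
    moreover have "closedin T (\<Inter>\<C>)"
      using CA False by (intro closedin_Inter) (auto simp: \<A>_def extremal_def)
    moreover have "\<forall>u\<in>K. \<forall>v\<in>K. \<forall>z\<in>open_segment u v. z \<in> \<Inter>\<C> \<longrightarrow> u \<in> \<Inter>\<C> \<and> v \<in> \<Inter>\<C>"
      using CA unfolding \<A>_def extremal_def by blast
    ultimately have "extremal (\<Inter>\<C>)" unfolding extremal_def by (intro conjI)
    moreover have "\<Inter>\<C> \<subseteq> M" using False CA by (auto simp: \<A>_def)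
    ultimately have "\<Inter>\<C> \<in> \<A>" by (simp add: \<A>_def)
    then show ?thesis by (auto simp: P_def)
  qed
  obtain A where A: "A \<in> \<A>" and Amin: "\<And>B. B \<in> \<A> \<Longrightarrow> B \<subseteq> A \<Longrightarrow> B = A"
    using predicate_Zorn[OF po ch] unfolding P_def by blast
  have extA: "extremal A" and AM: "A \<subseteq> M" using A by (auto simp: \<A>_def)
  have AK: "A \<subseteq> K" using sub[OF extA] .
  \<comment> \<open>The maximisers of \<open>l\<close> in \<open>A\<close> form an extremal subset
    of \<open>A\<close>, hence all of \<open>A\<close> by minimality; as \<open>L\<close> separates
    points, \<open>A\<close> is a single point.\<close>
  have const: "l x = l y" if l: "l \<in> L" and "x \<in> A" "y \<in> A" for l x y
  proof -
    have "continuous_map T euclideanreal l" using L(2)[OF l] by (simp add: T_def)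
    moreover obtain w where w: "w \<in> A" "\<And>y. y \<in> A \<Longrightarrow> l y \<le> l w"
      using continuous_attains_max[of T A l] extA cin calculation by (metis extremal_def)
    moreover have "convex_on K l"
      using f(2) L(1)[OF l] unfolding convex_on_def
      by (simp add: linear_add linear_scale)
    ultimately have "extremal {x \<in> A. l x = l w}" using argmax[OF extA] by blast
    then have "{x \<in> A. l x = l w} = A" using AM by (intro Amin) (auto simp: \<A>_def)
    then have "l x = l w" "l y = l w" using that by blast+
    then show ?thesis by simp
  qed
  obtain x where x: "x \<in> A" using extA by (auto simp: extremal_def)
  have "y = x" if "y \<in> A" for y
  proof (rule sep)
    show "y \<in> K" "x \<in> K" using that x AK by blast+
    show "l y = l x" if "l \<in> L" for l using const[OF that \<open>y \<in> A\<close> x] .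
  qed
  then have Ax: "A = {x}" using x by blast
  have "x extreme_point_of K"
    unfolding extreme_point_of_def
  proof (intro conjI ballI notI)
    show "x \<in> K" using x AK by auto
    fix a b assume ab: "a \<in> K" "b \<in> K" "x \<in> open_segment a b"
    then have "a \<in> A" "b \<in> A" using extA x unfolding extremal_def by blast+
    then have "a = b" using Ax by blast
    then show False using ab by simp
  qed
  moreover have "f y \<le> f x" if "y \<in> K" for y
    using z(2)[OF that] x AM by (auto simp: M_def)
  ultimately show thesis by (rule that)
qed

text \<open>Kakutani's argument, with compactness used twice: for fixed \<open>s\<close>, a maximum
  of finitely many two-point interpolants lies above \<open>f - \<epsilon>\<close> everywhere and
  still equals \<open>f\<close> at \<open>s\<close>; a minimum of finitely many of these stays above
  \<open>f - \<epsilon>\<close> and falls below \<open>f + \<epsilon>\<close>.\<close>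

theorem lattice_stone_weierstrass:
  fixes f :: "'a \<Rightarrow> real"
  assumes T: "compact_space T" and ne: "L \<noteq> {}"
    and cont: "\<And>h. h \<in> L \<Longrightarrow> continuous_map T euclideanreal h"
    and max: "\<And>h k. h \<in> L \<Longrightarrow> k \<in> L \<Longrightarrow> (\<lambda>x. max (h x) (k x)) \<in> L"
    and min: "\<And>h k. h \<in> L \<Longrightarrow> k \<in> L \<Longrightarrow> (\<lambda>x. min (h x) (k x)) \<in> L"
    and f: "continuous_map T euclideanreal f"
    and interp: "\<And>s t. s \<in> topspace T \<Longrightarrow> t \<in> topspace T \<Longrightarrow> \<exists>h\<in>L. h s = f s \<and> h t = f t"
    and eps: "\<epsilon> > 0"
  obtains h where "h \<in> L" "\<And>x. x \<in> topspace T \<Longrightarrow> \<bar>h x - f x\<bar> < \<epsilon>"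
proof (cases "topspace T = {}")
  case True
  then show thesis using ne that by auto
next
  case ne': False
  \<comment> \<open>The last conjunct, that each value of the maximum is a value of some member, is
    what preserves exact interpolation at \<open>s\<close>.\<close>
  have fmax: "\<exists>m\<in>L. (\<forall>x. \<forall>k\<in>A. k x \<le> m x) \<and> (\<forall>x. \<exists>k\<in>A. m x = k x)"
    if "finite A" "A \<noteq> {}" "A \<subseteq> L" for A
    using that
  proof (induction A rule: finite_ne_induct)
    case (singleton k)
    then show ?case by (intro bexI[of _ k]) auto
  next
    case (insert k A)
    then obtain m where "m \<in> L" "\<forall>x. \<forall>k\<in>A. k x \<le> m x" "\<forall>x. \<exists>k\<in>A. m x = k x" by auto
    moreover have "\<exists>j\<in>insert k A. max (k x) (m x) = j x" for x
      using calculation(3)[rule_format, of x] by (auto simp: max_def)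
    ultimately show ?case using insert.prems max[of k m]
      by (intro bexI[of _ "\<lambda>x. max (k x) (m x)"]) (auto intro: max.coboundedI2)
  qed
  have fmin: "\<exists>m\<in>L. (\<forall>x. \<forall>k\<in>A. m x \<le> k x) \<and> (\<forall>x. \<exists>k\<in>A. m x = k x)"
    if "finite A" "A \<noteq> {}" "A \<subseteq> L" for A
    using that
  proof (induction A rule: finite_ne_induct)
    case (singleton k)
    then show ?case by (intro bexI[of _ k]) auto
  next
    case (insert k A)
    then obtain m where "m \<in> L" "\<forall>x. \<forall>k\<in>A. m x \<le> k x" "\<forall>x. \<exists>k\<in>A. m x = k x" by auto
    moreover have "\<exists>j\<in>insert k A. min (k x) (m x) = j x" for x
      using calculation(3)[rule_format, of x] by (auto simp: min_def)
    ultimately show ?case using insert.prems min[of k m]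
      by (intro bexI[of _ "\<lambda>x. min (k x) (m x)"]) (auto intro: min.coboundedI2)
  qed
  have opn: "openin T {x \<in> topspace T. g x > 0}" if "continuous_map T euclideanreal g" for g :: "'a \<Rightarrow> real"
    using openin_continuous_map_preimage[OF that, of "{0<..}"] by simp
  have comp: "compactin T (topspace T)" using T by (simp add: compact_space_def)
  have step: "\<exists>h\<in>L. h s = f s \<and> (\<forall>x\<in>topspace T. h x > f x - \<epsilon>)" if s: "s \<in> topspace T" for s
  proof -
    obtain h where h: "\<And>t. t \<in> topspace T \<Longrightarrow> h t \<in> L \<and> h t s = f s \<and> h t t = f t"
      using interp[OF s] by metis
    obtain J where J: "finite J" "J \<subseteq> topspace T" "topspace T \<subseteq> (\<Union>t\<in>J. {x \<in> topspace T. h t x - f x + \<epsilon> > 0})"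
    proof (rule compactin_index_subcover[OF comp, of "topspace T" "\<lambda>t. {x \<in> topspace T. h t x - f x + \<epsilon> > 0}"])
      show "openin T {x \<in> topspace T. h t x - f x + \<epsilon> > 0}" if "t \<in> topspace T" for t
        using cont h that f by (intro opn continuous_intros) auto
      show "topspace T \<subseteq> (\<Union>t\<in>topspace T. {x \<in> topspace T. 0 < h t x - f x + \<epsilon>})"
        using h eps by auto
    qed
    have "h ` J \<noteq> {}" "h ` J \<subseteq> L" using J ne' h by auto
    then obtain m where m: "m \<in> L" "\<And>x k. k \<in> h ` J \<Longrightarrow> k x \<le> m x" "\<And>x. \<exists>k\<in>h ` J. m x = k x"
      using fmax[of "h ` J"] J(1) by auto
    have "m s = f s" using m(3)[of s] h J(2) by auto
    moreover have "m x > f x - \<epsilon>" if "x \<in> topspace T" for x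
    proof -
      obtain t where "t \<in> J" "h t x - f x + \<epsilon> > 0" using J(3) \<open>x \<in> topspace T\<close> by auto
      then show ?thesis using m(2)[of "h t" x] by auto
    qed
    ultimately show ?thesis using m(1) by blast
  qed
  then obtain h where h: "\<And>s. s \<in> topspace T \<Longrightarrow> h s \<in> L \<and> h s s = f s \<and> (\<forall>x\<in>topspace T. h s x > f x - \<epsilon>)"
    by metis
  obtain J where J: "finite J" "J \<subseteq> topspace T" "topspace T \<subseteq> (\<Union>s\<in>J. {x \<in> topspace T. f x - h s x + \<epsilon> > 0})"
  proof (rule compactin_index_subcover[OF comp, of "topspace T" "\<lambda>s. {x \<in> topspace T. f x - h s x + \<epsilon> > 0}"])
    show "openin T {x \<in> topspace T. f x - h t x + \<epsilon> > 0}" if "t \<in> topspace T" for t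
      using cont h that f by (intro opn continuous_intros) auto
    show "topspace T \<subseteq> (\<Union>t\<in>topspace T. {x \<in> topspace T. 0 < f x - h t x + \<epsilon>})"
      using h eps by auto
  qed
  have "h ` J \<noteq> {}" "h ` J \<subseteq> L" using J ne' h by auto
  then obtain m where m: "m \<in> L" "\<And>x k. k \<in> h ` J \<Longrightarrow> m x \<le> k x" "\<And>x. \<exists>k\<in>h ` J. m x = k x"
    using fmin[of "h ` J"] J(1) by auto
  show thesis
  proof (rule that[OF m(1)])
    fix x assume x: "x \<in> topspace T"
    have "m x > f x - \<epsilon>" using m(3)[of x] h J(2) x by auto
    moreover obtain t where "t \<in> J" "f x - h t x + \<epsilon> > 0" using J(3) x by auto
    then have "m x < f x + \<epsilon>" using m(2)[of "h t" x] by auto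
    ultimately show "\<bar>m x - f x\<bar> < \<epsilon>" by auto
  qed
qed

section \<open>Positive parts of functionals\<close>

text \<open>The order is encoded by its cone: \<open>x \<le> y\<close> means
  \<open>y - x \<in> C\<close>. One notion thus serves \<open>E\<close>, its dual and subspaces of
  the dual; for \<open>S = UNIV\<close> and a proper cone it amounts to being a vector
  lattice.\<close>

definition positive_parts :: "'v::real_vector set \<Rightarrow> 'v set \<Rightarrow> bool" where
  "positive_parts S C \<longleftrightarrow> (\<forall>v\<in>S. \<exists>p\<in>C. p - v \<in> C \<and> (\<forall>u\<in>C. u - v \<in> C \<longrightarrow> u - p \<in> C))"

text \<open>The supremum of \<open>F\<close> over the order interval below \<open>f\<close> is
  additive on the cone because positive parts yield the Riesz decomposition property; it then
  extends to differences of cone elements. The carrier \<open>S\<close> is left general because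
  under compatibility it is a subspace of the dual.\<close>

theorem riesz_kantorovich:
  fixes S C :: "'v::real_vector set" and F :: "'v \<Rightarrow> real"
  assumes S: "subspace S" and CS: "C \<subseteq> S"
    and Cadd: "\<And>f g. f \<in> C \<Longrightarrow> g \<in> C \<Longrightarrow> f + g \<in> C"
    and Cscale: "\<And>f r. f \<in> C \<Longrightarrow> r \<ge> 0 \<Longrightarrow> r *\<^sub>R f \<in> C"
    and parts: "positive_parts S C"
    and F: "linear_functional_on S F"
    and bdd: "\<And>f. f \<in> C \<Longrightarrow> bdd_above (F ` {g \<in> C. f - g \<in> C})"
  obtains H where "linear_functional_on S H"
    "\<And>f. f \<in> C \<Longrightarrow> 0 \<le> H f" "\<And>f. f \<in> C \<Longrightarrow> F f \<le> H f"
    "\<And>G f. linear_functional_on S G \<Longrightarrow> (\<And>f. f \<in> C \<Longrightarrow> 0 \<le> G f) \<Longrightarrow>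
        (\<And>f. f \<in> C \<Longrightarrow> F f \<le> G f) \<Longrightarrow> f \<in> C \<Longrightarrow> H f \<le> G f"
proof -
  note lub = parts[unfolded positive_parts_def, rule_format]
  have C0: "0 \<in> C" using lub[OF subspace_0[OF S]] Cscale[of _ 0] by auto
  have Fadd: "F (x + y) = F x + F y" if "x \<in> C" "y \<in> C" for x y
    using F that CS unfolding linear_functional_on_def by blast
  have Fscale: "F (r *\<^sub>R x) = r * F x" if "x \<in> C" for x r
    using F that CS by (auto simp: linear_functional_on_def)
  have F0: "F 0 = 0" using Fscale[OF C0, of 0] by simp
  define h where "h f = Sup (F ` {g \<in> C. f - g \<in> C})" for f
  have hge: "F g \<le> h f" if "g \<in> C" "f - g \<in> C" "f \<in> C" for f g
    unfolding h_def using that by (intro cSUP_upper bdd) auto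
  have hle: "h f \<le> c" if "f \<in> C" "\<And>g. g \<in> C \<Longrightarrow> f - g \<in> C \<Longrightarrow> F g \<le> c" for f c
    unfolding h_def using that C0 by (intro cSUP_least) auto
  have hadd: "h (f1 + f2) = h f1 + h f2" if f1: "f1 \<in> C" and f2: "f2 \<in> C" for f1 f2
  proof (rule antisym)
    have f12: "f1 + f2 \<in> C" using Cadd f1 f2 by simp
    show "h (f1 + f2) \<le> h f1 + h f2"
    proof (rule hle[OF f12])
      fix g assume g: "g \<in> C" "f1 + f2 - g \<in> C"
      have "g - f1 \<in> S" using g f1 CS S by (auto intro: subspace_diff)
      \<comment> \<open>\<open>g2\<close> is the positive part of \<open>g - f1\<close>; then
        \<open>g - g2\<close> lies between 0 and \<open>f1\<close>, and \<open>g2\<close> between 0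
        and \<open>f2\<close>.\<close>
      then obtain g2 where g2: "g2 \<in> C" "g2 - (g - f1) \<in> C" "\<And>u. u \<in> C \<Longrightarrow> u - (g - f1) \<in> C \<Longrightarrow> u - g2 \<in> C"
        using lub[of "g - f1"] by metis
      have "f2 - g2 \<in> C" using g2(3)[OF f2] g by (simp add: algebra_simps)
      moreover have "g - g2 \<in> C" using g2(3)[OF g(1)] f1 by simp
      moreover have "f1 - (g - g2) \<in> C" using g2(2) by (simp add: algebra_simps)
      ultimately have "F (g - g2) \<le> h f1" "F g2 \<le> h f2" using hge f1 f2 g2(1) by auto
      moreover have "F g = F (g - g2) + F g2" using Fadd[OF \<open>g - g2 \<in> C\<close> g2(1)] by simp
      ultimately show "F g \<le> h f1 + h f2" by simp
    qed
    have *: "F g1 + F g2 \<le> h (f1 + f2)" if g1: "g1 \<in> C" "f1 - g1 \<in> C" and g2: "g2 \<in> C" "f2 - g2 \<in> C" for g1 g2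
      using hge[of "g1 + g2" "f1 + f2"] Cadd[OF g1(1) g2(1)] Cadd[OF g1(2) g2(2)] f12 Fadd[OF g1(1) g2(1)]
      by (simp add: algebra_simps)
    have "h f1 \<le> h (f1 + f2) - F g2" if g2: "g2 \<in> C" "f2 - g2 \<in> C" for g2
      using *[OF _ _ g2] by (intro hle[OF f1]) (auto simp: algebra_simps)
    then have "h f2 \<le> h (f1 + f2) - h f1"
      by (intro hle[OF f2]) (auto simp: algebra_simps)
    then show "h f1 + h f2 \<le> h (f1 + f2)" by simp
  qed
  have hscale_le: "h (r *\<^sub>R f) \<le> r * h f" if f: "f \<in> C" and r: "r > 0" for f r
  proof (rule hle)
    show "r *\<^sub>R f \<in> C" using Cscale f r by simp
    fix g assume g: "g \<in> C" "r *\<^sub>R f - g \<in> C"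
    have "inverse r *\<^sub>R g \<in> C" "inverse r *\<^sub>R (r *\<^sub>R f - g) \<in> C" using Cscale g r by auto
    then have "F (inverse r *\<^sub>R g) \<le> h f" using f r by (intro hge) (auto simp: algebra_simps)
    then show "F g \<le> r * h f" using Fscale[OF g(1)] r by (simp add: field_simps)
  qed
  have hscale: "h (r *\<^sub>R f) = r * h f" if f: "f \<in> C" and r: "r > 0" for f r
  proof -
    have "h (inverse r *\<^sub>R (r *\<^sub>R f)) \<le> inverse r * h (r *\<^sub>R f)"
      using Cscale[OF f] r by (intro hscale_le) auto
    then have "r * h f \<le> h (r *\<^sub>R f)" using r by (simp add: field_simps)
    then show ?thesis using hscale_le[OF f r] by simp
  qed
  have h0: "h 0 = 0" using hadd[OF C0 C0] by simp
  \<comment> \<open>Any majorant in \<open>C\<close> serves, not only the least one: it represents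
    \<open>v\<close> as \<open>pp v - (pp v - v)\<close>, and \<open>Heq\<close> shows that the
    value of \<open>H\<close> does not depend on the representation.\<close>
  define pp where "pp v = (SOME p. p \<in> C \<and> p - v \<in> C)" for v
  have pp: "pp v \<in> C \<and> pp v - v \<in> C" if "v \<in> S" for v
    unfolding pp_def by (rule someI_ex) (use lub[OF that] in blast)
  define H where "H v = h (pp v) - h (pp v - v)" for v
  have Heq: "H (f - g) = h f - h g" if f: "f \<in> C" and g: "g \<in> C" for f g
  proof -
    have "f - g \<in> S" using f g CS S by (auto intro: subspace_diff)
    note p = pp[OF this]
    have "h (pp (f - g) + g) = h (f + (pp (f - g) - (f - g)))" by simp
    then have "h (pp (f - g)) + h g = h f + h (pp (f - g) - (f - g))"
      using hadd p f g by metis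
    then show ?thesis by (simp add: H_def)
  qed
  have HC: "H f = h f" if "f \<in> C" for f using Heq[OF that C0] h0 by simp
  have Hadd: "H (v + w) = H v + H w" if v: "v \<in> S" and w: "w \<in> S" for v w
  proof -
    have "H ((pp v + pp w) - ((pp v - v) + (pp w - w))) = h (pp v + pp w) - h ((pp v - v) + (pp w - w))"
      using pp v w Cadd by (intro Heq) auto
    moreover have "(pp v + pp w) - ((pp v - v) + (pp w - w)) = v + w" by simp
    ultimately show ?thesis using hadd pp v w by (simp add: H_def)
  qed
  have Hneg: "H (- v) = - H v" if v: "v \<in> S" for v
    using Heq[of "pp v - v" "pp v"] pp[OF v] by (simp add: H_def)
  have Hpos: "H (r *\<^sub>R v) = r * H v" if v: "v \<in> S" and r: "r > 0" for v r
  proof -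
    have "H (r *\<^sub>R pp v - r *\<^sub>R (pp v - v)) = h (r *\<^sub>R pp v) - h (r *\<^sub>R (pp v - v))"
      using pp[OF v] r Cscale by (intro Heq) auto
    also have "\<dots> = r * H v" using hscale pp[OF v] r by (simp add: H_def right_diff_distrib)
    also have "r *\<^sub>R pp v - r *\<^sub>R (pp v - v) = r *\<^sub>R v" by (simp add: algebra_simps)
    finally show ?thesis .
  qed
  have Hscale: "H (r *\<^sub>R v) = r * H v" if v: "v \<in> S" for v r
  proof -
    consider "r = 0" | "r > 0" | "r < 0" by linarith
    then show ?thesis
    proof cases
      case 1 then show ?thesis using HC[OF C0] h0 by simp
    next
      case 2 then show ?thesis using Hpos[OF v] by simp
    next
      case 3
      then have "H ((- r) *\<^sub>R v) = - r * H v" by (intro Hpos[OF v]) auto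
      then show ?thesis using Hneg[OF subspace_scale[OF S v], of r] by simp
    qed
  qed
  show thesis
  proof (rule that[of H])
    show "linear_functional_on S H" using Hadd Hscale by (simp add: linear_functional_on_def)
    show "0 \<le> H f" if "f \<in> C" for f using hge[OF C0, of f] that HC F0 by simp
    show "F f \<le> H f" if "f \<in> C" for f using hge[of f f] that HC C0 by simp
    fix G f assume G: "linear_functional_on S G" "\<And>f. f \<in> C \<Longrightarrow> 0 \<le> G f" "\<And>f. f \<in> C \<Longrightarrow> F f \<le> G f" and f: "f \<in> C"
    have "F g \<le> G f" if g: "g \<in> C" "f - g \<in> C" for g
    proof -
      have "G (g + (f - g)) = G g + G (f - g)"
        using G(1) g CS unfolding linear_functional_on_def by blast
      then show ?thesis using G(2)[OF g(2)] G(3)[OF g(1)] by simp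
    qed
    then show "H f \<le> G f" using hle[OF f] HC[OF f] by simp
  qed
qed

section \<open>Riesz-Markov representation on compact Hausdorff spaces\<close>

lemma space_borel_of_topology [simp]: "space (borel_of_topology T) = topspace T"
  unfolding borel_of_topology_def by (rule space_measure_of) (auto dest: openin_subset)

lemma sets_borel_of_topology: "sets (borel_of_topology T) = sigma_sets (topspace T) {U. openin T U}"
  unfolding borel_of_topology_def by (rule sets_measure_of) (auto dest: openin_subset)

lemma openin_sets_borel_of_topology: "openin T U \<Longrightarrow> U \<in> sets (borel_of_topology T)"
  by (auto simp: sets_borel_of_topology)

lemma closedin_sets_borel_of_topology: "closedin T U \<Longrightarrow> U \<in> sets (borel_of_topology T)"
  using sets.compl_sets[OF openin_sets_borel_of_topology[of T "topspace T - U"]]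
  by (auto simp: closedin_def double_diff)

lemma continuous_map_borel_measurable:
  fixes f :: "'a \<Rightarrow> real"
  assumes "sets \<mu> = sets (borel_of_topology T)" "continuous_map T euclideanreal f"
  shows "f \<in> borel_measurable \<mu>"
proof (rule borel_measurableI)
  fix S :: "real set" assume "open S"
  then have "openin T {x \<in> topspace T. f x \<in> S}"
    using openin_continuous_map_preimage[OF assms(2), of S] by simp
  moreover have "f -` S \<inter> space \<mu> = {x \<in> topspace T. f x \<in> S}"
    using sets_eq_imp_space_eq[OF assms(1)] by auto
  ultimately show "f -` S \<inter> space \<mu> \<in> sets \<mu>"
    using openin_sets_borel_of_topology assms(1) by auto
qed

lemma radon_prob_measureD:
  assumes "radon_prob_measure T \<mu>"
  shows "prob_space \<mu>" "sets \<mu> = sets (borel_of_topology T)" "space \<mu> = topspace T"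
    "\<And>B. B \<in> sets \<mu> \<Longrightarrow> emeasure \<mu> B = (SUP C\<in>{C. compactin T C \<and> C \<subseteq> B}. emeasure \<mu> C)"
  using assms sets_eq_imp_space_eq[of \<mu> "borel_of_topology T"] by (auto simp: radon_prob_measure_def)

lemma radon_integrable:
  fixes f :: "'a \<Rightarrow> real"
  assumes "radon_prob_measure T \<mu>" "compact_space T" "continuous_map T euclideanreal f"
  shows "integrable \<mu> f"
proof -
  interpret prob_space \<mu> using assms(1) by (rule radon_prob_measureD)
  obtain B where "\<And>x. x \<in> topspace T \<Longrightarrow> \<bar>f x\<bar> \<le> B"
    using continuous_map_bounded[OF assms(2,3)] by metis
  then show ?thesis
    using continuous_map_borel_measurable[OF radon_prob_measureD(2)[OF assms(1)] assms(3)]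
      radon_prob_measureD(3)[OF assms(1)]
    by (intro integrable_const_bound[where B = B]) auto
qed

lemma urysohn_compact_Hausdorff:
  assumes "compact_space T" "Hausdorff_space T" "closedin T C" "openin T U" "C \<subseteq> U"
  obtains g :: "'a \<Rightarrow> real" where "continuous_map T euclideanreal g"
    "\<And>x. x \<in> topspace T \<Longrightarrow> 0 \<le> g x \<and> g x \<le> 1" "\<And>x. x \<in> C \<Longrightarrow> g x = 1"
    "\<And>x. x \<in> topspace T - U \<Longrightarrow> g x = 0"
proof -
  have "normal_space T" using assms(1,2) by (simp add: compact_Hausdorff_or_regular_imp_normal_space)
  moreover have "closedin T (topspace T - U)" using assms(4) by blast
  moreover have "disjnt (topspace T - U) C" using assms(5) by (auto simp: disjnt_def)
  ultimately obtain g where "continuous_map T (top_of_set {0..1::real}) g"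
      "g ` (topspace T - U) \<subseteq> {0}" "g ` C \<subseteq> {1}"
    using Urysohn_lemma[of T "topspace T - U" C 0 1] assms(3) by (metis zero_le_one)
  then show thesis
    by (intro that[of g]) (auto simp: continuous_map_in_subtopology)
qed

text \<open>Inner regularity reduces equality to compact sets. For disjoint compact \<open>C\<close>
  and \<open>D\<close>, a Urysohn function that is 1 on \<open>C\<close> and 0 on \<open>D\<close>
  shows that the \<open>\<mu>\<close>-measure of \<open>C\<close> is at most 1 minus the
  \<open>\<nu>\<close>-measure of \<open>D\<close>; the supremum over \<open>D\<close> gives one
  inequality on \<open>C\<close>, and the situation is symmetric.\<close>

theorem radon_prob_measure_eqI:
  assumes T: "compact_space T" "Hausdorff_space T"
    and \<mu>: "radon_prob_measure T \<mu>" and \<nu>: "radon_prob_measure T \<nu>"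
    and eq: "\<And>f :: 'a \<Rightarrow> real. continuous_map T euclideanreal f \<Longrightarrow> integral\<^sup>L \<mu> f = integral\<^sup>L \<nu> f"
  shows "\<mu> = \<nu>"
proof -
  have comp_le: "emeasure \<mu> C \<le> emeasure \<nu> C"
    if \<mu>: "radon_prob_measure T \<mu>" and \<nu>: "radon_prob_measure T \<nu>"
      and eq: "\<And>f :: 'a \<Rightarrow> real. continuous_map T euclideanreal f \<Longrightarrow> integral\<^sup>L \<mu> f = integral\<^sup>L \<nu> f"
      and C: "compactin T C" for \<mu> \<nu> C
  proof -
    interpret M: prob_space \<mu> using \<mu> by (rule radon_prob_measureD)
    interpret N: prob_space \<nu> using \<nu> by (rule radon_prob_measureD)
    note sM = radon_prob_measureD(2)[OF \<mu>] and sN = radon_prob_measureD(2)[OF \<nu>]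
    note spM = radon_prob_measureD(3)[OF \<mu>] and spN = radon_prob_measureD(3)[OF \<nu>]
    have clC: "closedin T C" using C T(2) compactin_imp_closedin by blast
    have CM: "C \<in> sets \<mu>" and CN: "C \<in> sets \<nu>" using closedin_sets_borel_of_topology[OF clC] sM sN by auto
    have "emeasure \<nu> (topspace T - C) \<le> ennreal (1 - measure \<mu> C)"
    proof -
      have "emeasure \<nu> D \<le> ennreal (1 - measure \<mu> C)" if D: "compactin T D" "D \<subseteq> topspace T - C" for D
      proof -
        have clD: "closedin T D" using D T(2) compactin_imp_closedin by blast
        have DN: "D \<in> sets \<nu>" using closedin_sets_borel_of_topology[OF clD] sN by auto
        have U: "openin T (topspace T - D)" using clD by blast
        obtain g :: "'a \<Rightarrow> real" where g: "continuous_map T euclideanreal g"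
          "\<And>x. x \<in> topspace T \<Longrightarrow> 0 \<le> g x \<and> g x \<le> 1" "\<And>x. x \<in> C \<Longrightarrow> g x = 1"
          "\<And>x. x \<in> topspace T - (topspace T - D) \<Longrightarrow> g x = 0"
        proof (rule urysohn_compact_Hausdorff[OF T clC U])
          show "C \<subseteq> topspace T - D" using D closedin_subset[OF clC] by blast
        qed blast
        have iD: "integrable \<nu> (indicator D :: 'a \<Rightarrow> real)"
          using DN by (simp add: N.emeasure_eq_measure)
        have gD: "g x = 0" if "x \<in> D" for x using g(4)[of x] that closedin_subset[OF clD] by auto
        have "measure \<mu> C = integral\<^sup>L \<mu> (indicator C)" using CM by simp
        also have "\<dots> \<le> integral\<^sup>L \<mu> g"
          using CM g spM closedin_subset[OF clC]
          by (intro integral_mono[OF _ radon_integrable[OF \<mu> T(1) g(1)]]) (auto simp: indicator_def M.emeasure_eq_measure)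
        also have "\<dots> = integral\<^sup>L \<nu> g" by (rule eq[OF g(1)])
        also have "\<dots> \<le> integral\<^sup>L \<nu> (\<lambda>x. 1 - indicator D x)"
          using DN g gD spN
          by (intro integral_mono[OF radon_integrable[OF \<nu> T(1) g(1)]] Bochner_Integration.integrable_diff iD)
            (auto simp: indicator_def)
        also have "\<dots> = 1 - measure \<nu> D"
          using Bochner_Integration.integral_diff[OF _ iD, of "\<lambda>x. 1"] DN by (simp add: N.prob_space)
        finally have "measure \<nu> D \<le> 1 - measure \<mu> C" by simp
        then show ?thesis by (simp add: N.emeasure_eq_measure ennreal_leI)
      qed
      moreover have "topspace T - C \<in> sets \<nu>" using CN spN by (metis sets.compl_sets)
      ultimately show ?thesis by (subst radon_prob_measureD(4)[OF \<nu>]) (auto intro!: SUP_least)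
    qed
    then have "measure \<nu> (topspace T - C) \<le> 1 - measure \<mu> C"
      by (simp add: N.emeasure_eq_measure)
    then have "measure \<mu> C \<le> measure \<nu> C" using N.prob_compl[OF CN] spN by simp
    then show ?thesis by (simp add: M.emeasure_eq_measure N.emeasure_eq_measure)
  qed
  show ?thesis
  proof (rule measure_eqI)
    show s: "sets \<mu> = sets \<nu>" using radon_prob_measureD(2) \<mu> \<nu> by metis
    fix B assume B: "B \<in> sets \<mu>"
    show "emeasure \<mu> B = emeasure \<nu> B"
      unfolding radon_prob_measureD(4)[OF \<mu> B] radon_prob_measureD(4)[OF \<nu> B[unfolded s]]
      using comp_le[OF \<mu> \<nu> eq] comp_le[OF \<nu> \<mu> eq[symmetric]] by (intro SUP_cong) (auto intro: antisym)
  qed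
qed

section \<open>The regular measure of a normalised positive functional\<close>

locale compact_positive_functional =
  fixes T :: "'a topology" and \<Lambda> :: "('a \<Rightarrow> real) \<Rightarrow> real"
  assumes T: "compact_space T" "Hausdorff_space T"
    and add: "\<And>f g. continuous_map T euclideanreal f \<Longrightarrow> continuous_map T euclideanreal g \<Longrightarrow>
      \<Lambda> (\<lambda>x. f x + g x) = \<Lambda> f + \<Lambda> g"
    and scale: "\<And>f c. continuous_map T euclideanreal f \<Longrightarrow> \<Lambda> (\<lambda>x. c * f x) = c * \<Lambda> f"
    and pos: "\<And>f. continuous_map T euclideanreal f \<Longrightarrow> (\<And>x. x \<in> topspace T \<Longrightarrow> 0 \<le> f x) \<Longrightarrow> 0 \<le> \<Lambda> f"
    and one: "\<Lambda> (\<lambda>x. 1) = 1"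
begin

abbreviation cont :: "('a \<Rightarrow> real) \<Rightarrow> bool" where
  "cont f \<equiv> continuous_map T euclideanreal f"

lemma diff: "cont f \<Longrightarrow> cont g \<Longrightarrow> \<Lambda> (\<lambda>x. f x - g x) = \<Lambda> f - \<Lambda> g"
  using add[of f "\<lambda>x. -1 * g x"] scale[of g "-1"] by (simp add: continuous_map_minus)

lemma mono: "cont f \<Longrightarrow> cont g \<Longrightarrow> (\<And>x. x \<in> topspace T \<Longrightarrow> f x \<le> g x) \<Longrightarrow> \<Lambda> f \<le> \<Lambda> g"
  using pos[of "\<lambda>x. g x - f x"] diff[of g f] by (simp add: continuous_map_diff)

lemma const: "\<Lambda> (\<lambda>x. c) = c"
  using scale[of "\<lambda>x. 1" c] one by simp

lemma sum: "finite J \<Longrightarrow> (\<And>i. i \<in> J \<Longrightarrow> cont (g i)) \<Longrightarrow> \<Lambda> (\<lambda>x. \<Sum>i\<in>J. g i x) = (\<Sum>i\<in>J. \<Lambda> (g i))"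
proof (induction J rule: finite_induct)
  case empty
  then show ?case using const[of 0] by simp
next
  case (insert j J)
  then show ?case by (simp add: add continuous_map_sum)
qed

text \<open>Vanishing off \<open>U\<close> stands in for compact support inside \<open>U\<close>;
  compactness is recovered by passing to the level set where
  \<open>f \<ge> \<delta>\<close>.\<close>

definition subord :: "'a set \<Rightarrow> ('a \<Rightarrow> real) set" where
  "subord U = {f. cont f \<and> (\<forall>x\<in>topspace T. 0 \<le> f x \<and> f x \<le> 1) \<and> (\<forall>x\<in>topspace T - U. f x = 0)}"

definition content :: "'a set \<Rightarrow> real" where
  "content U = Sup (\<Lambda> ` subord U)"

definition outer :: "'a set \<Rightarrow> real" where
  "outer A = Inf (content ` {U. openin T U \<and> A \<subseteq> U})"

lemma subord_le_1: "f \<in> subord U \<Longrightarrow> \<Lambda> f \<le> 1"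
  using mono[of f "\<lambda>x. 1"] one by (simp add: subord_def)

lemma zero_subord: "(\<lambda>x. 0) \<in> subord U"
  by (simp add: subord_def)

lemma bdd_subord: "bdd_above (\<Lambda> ` subord U)"
  using subord_le_1 by (intro bdd_aboveI2[of _ _ 1])

lemma subord_le_content: "f \<in> subord U \<Longrightarrow> \<Lambda> f \<le> content U"
  unfolding content_def by (intro cSUP_upper bdd_subord)

lemma content_le: "(\<And>f. f \<in> subord U \<Longrightarrow> \<Lambda> f \<le> c) \<Longrightarrow> content U \<le> c"
  unfolding content_def using zero_subord by (intro cSUP_least) auto

lemma content_nonneg: "0 \<le> content U"
  using subord_le_content[OF zero_subord] const[of 0] by simp

lemma content_mono: "U \<subseteq> V \<Longrightarrow> content U \<le> content V"
  by (rule content_le, rule subord_le_content) (auto simp: subord_def)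

lemma outer_le_content: "openin T U \<Longrightarrow> A \<subseteq> U \<Longrightarrow> outer A \<le> content U"
  unfolding outer_def using content_nonneg by (intro cINF_lower bdd_belowI2[of _ 0]) auto

lemma le_outer:
  assumes "A \<subseteq> topspace T" "\<And>U. openin T U \<Longrightarrow> A \<subseteq> U \<Longrightarrow> c \<le> content U"
  shows "c \<le> outer A"
  unfolding outer_def using assms by (intro cINF_greatest) (auto intro: exI[of _ "topspace T"])

lemma outer_open: "openin T U \<Longrightarrow> outer U = content U"
  by (intro antisym outer_le_content le_outer content_mono) (auto dest: openin_subset)

lemma outer_nonneg: "A \<subseteq> topspace T \<Longrightarrow> 0 \<le> outer A"
  by (rule le_outer) (auto simp: content_nonneg)

lemma outer_mono: "A \<subseteq> B \<Longrightarrow> B \<subseteq> topspace T \<Longrightarrow> outer A \<le> outer B"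
  by (rule le_outer) (auto intro: outer_le_content)

lemma outer_approx:
  assumes "A \<subseteq> topspace T" "\<epsilon> > 0"
  obtains U where "openin T U" "A \<subseteq> U" "content U < outer A + \<epsilon>"
proof (rule ccontr)
  assume "\<not> thesis"
  then have "outer A + \<epsilon> \<le> outer A"
    using that by (intro le_outer assms) (meson not_le)
  then show False using assms by simp
qed

lemma outer_space: "outer (topspace T) = 1"
proof -
  have "content (topspace T) = 1"
  proof (rule antisym)
    show "content (topspace T) \<le> 1" by (rule content_le) (rule subord_le_1)
    show "1 \<le> content (topspace T)"
      using subord_le_content[of "\<lambda>x. 1" "topspace T"] one by (simp add: subord_def)
  qed
  then show ?thesis by (simp add: outer_open)
qed

lemma outer_empty: "outer {} = 0"
proof -
  have "content {} \<le> 0"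
    by (rule content_le, subst const[of 0, symmetric], rule mono) (auto simp: subord_def)
  then show ?thesis using outer_open[of "{}"] content_nonneg[of "{}"] by simp
qed

text \<open>A weak partition of unity: the sum has only to reach 1 on \<open>C\<close>, which lets
  the induction treat separately the part of \<open>C\<close> where the new function is large and
  the part covered by the other sets.\<close>

lemma subordinate_partition:
  assumes "finite J" "\<And>i. i \<in> J \<Longrightarrow> openin T (U i)" "closedin T C" "C \<subseteq> (\<Union>i\<in>J. U i)"
  shows "\<exists>g. (\<forall>i\<in>J. g i \<in> subord (U i)) \<and> (\<forall>x\<in>C. 1 \<le> (\<Sum>i\<in>J. g i x))"
  using assms
proof (induction J arbitrary: C rule: finite_induct)
  case empty
  then show ?case by auto
next
  case (insert j J)
  have "closedin T (C - (\<Union>i\<in>J. U i))"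
    using insert.prems by (intro closedin_diff openin_Union) auto
  then obtain h where h: "cont h" "\<And>x. x \<in> topspace T \<Longrightarrow> 0 \<le> h x \<and> h x \<le> 1"
    "\<And>x. x \<in> C - (\<Union>i\<in>J. U i) \<Longrightarrow> h x = 1" "\<And>x. x \<in> topspace T - U j \<Longrightarrow> h x = 0"
    by (rule urysohn_compact_Hausdorff[OF T, of "C - (\<Union>i\<in>J. U i)" "U j"]) (use insert.prems in auto)
  have "closedin T (C \<inter> {x \<in> topspace T. h x \<in> {..1/2}})"
    using insert.prems(2) closedin_continuous_map_preimage[OF h(1), of "{..1/2}"] by auto
  moreover have "C \<inter> {x \<in> topspace T. h x \<in> {..1/2}} \<subseteq> (\<Union>i\<in>J. U i)"
    using h(3) by force
  ultimately obtain g where g: "\<forall>i\<in>J. g i \<in> subord (U i)"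
    "\<forall>x\<in>C \<inter> {x \<in> topspace T. h x \<in> {..1/2}}. 1 \<le> (\<Sum>i\<in>J. g i x)"
    using insert.IH[of "C \<inter> {x \<in> topspace T. h x \<in> {..1/2}}"] insert.prems by auto
  \<comment> \<open>Doubling makes the new summand equal to 1 wherever \<open>h\<close> is at least
    1/2; the points of \<open>C\<close> with smaller \<open>h\<close> are served by the induction
    hypothesis.\<close>
  define g' where "g' = g(j := (\<lambda>x. min 1 (2 * h x)))"
  have J: "(\<Sum>i\<in>J. g' i x) = (\<Sum>i\<in>J. g i x)" for x
    using insert.hyps by (intro sum.cong) (auto simp: g'_def)
  have "g' i \<in> subord (U i)" if "i \<in> insert j J" for i
  proof (cases "i = j")
    case True
    have "cont (\<lambda>x. min 1 (2 * h x))" using h(1) by (intro continuous_intros) auto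
    then show ?thesis using True h by (auto simp: g'_def subord_def min_def)
  next
    case False
    then show ?thesis using g that by (auto simp: g'_def)
  qed
  moreover have "1 \<le> (\<Sum>i\<in>insert j J. g' i x)" if x: "x \<in> C" for x
  proof -
    have xT: "x \<in> topspace T" using x closedin_subset[OF insert.prems(2)] by auto
    have gn: "0 \<le> (\<Sum>i\<in>J. g i x)" using g(1) xT by (intro sum_nonneg) (auto simp: subord_def)
    have eq: "(\<Sum>i\<in>insert j J. g' i x) = min 1 (2 * h x) + (\<Sum>i\<in>J. g i x)"
      using insert.hyps J by (simp add: g'_def)
    show ?thesis
    proof (cases "h x \<le> 1/2")
      case True
      then have "1 \<le> (\<Sum>i\<in>J. g i x)" using g(2) x xT by auto
      then show ?thesis using eq h(2)[OF xT] by auto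
    next
      case False
      then show ?thesis using eq gn by auto
    qed
  qed
  ultimately show ?case by (intro exI[of _ g']) blast
qed

text \<open>Compactness of the set where \<open>f \<ge> \<delta>\<close> leaves finitely many
  \<open>U i\<close>; with a subordinate family on them, \<open>f\<close> is everywhere at most
  \<open>\<delta>\<close> plus the sum of the family.\<close>

lemma content_subadditive:
  assumes f: "f \<in> subord (\<Union>i\<in>I. U i)" and U: "\<And>i. i \<in> I \<Longrightarrow> openin T (U i)" and d: "\<delta> > 0"
  obtains J where "finite J" "J \<subseteq> I" "\<Lambda> f \<le> \<delta> + (\<Sum>i\<in>J. content (U i))"
proof -
  have cf: "cont f" using f by (simp add: subord_def)
  define C where "C = {x \<in> topspace T. f x \<in> {\<delta>..}}"
  have C: "closedin T C"
    unfolding C_def by (rule closedin_continuous_map_preimage[OF cf]) auto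
  have CU: "C \<subseteq> (\<Union>i\<in>I. U i)" using f d by (force simp: C_def subord_def)
  obtain J where J: "finite J" "J \<subseteq> I" "C \<subseteq> (\<Union>i\<in>J. U i)"
    using compactin_index_subcover[of T C I U] closedin_compact_space[OF T(1) C] CU U by metis
  obtain g where g: "\<And>i. i \<in> J \<Longrightarrow> g i \<in> subord (U i)" "\<And>x. x \<in> C \<Longrightarrow> 1 \<le> (\<Sum>i\<in>J. g i x)"
    using subordinate_partition[OF J(1) _ C J(3)] U J(2) by (metis subsetD)
  have gc: "cont (\<lambda>x. \<Sum>i\<in>J. g i x)" using g(1) J(1) by (intro continuous_map_sum) (auto simp: subord_def)
  have "\<Lambda> f \<le> \<Lambda> (\<lambda>x. \<delta> + (\<Sum>i\<in>J. g i x))"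
  proof (rule mono[OF cf])
    show "cont (\<lambda>x. \<delta> + (\<Sum>i\<in>J. g i x))" using gc by (intro continuous_map_add gc) auto
    fix x assume x: "x \<in> topspace T"
    show "f x \<le> \<delta> + (\<Sum>i\<in>J. g i x)"
    proof (cases "x \<in> C")
      case True
      then show ?thesis using g(2)[OF True] f d x by (fastforce simp: subord_def)
    next
      case False
      have "0 \<le> (\<Sum>i\<in>J. g i x)" using g(1) x by (intro sum_nonneg) (auto simp: subord_def)
      then show ?thesis using False x by (auto simp: C_def)
    qed
  qed
  also have "\<dots> = \<delta> + (\<Sum>i\<in>J. \<Lambda> (g i))"
  proof -
    have "\<Lambda> (\<lambda>x. \<Sum>i\<in>J. g i x) = (\<Sum>i\<in>J. \<Lambda> (g i))"
      using g(1) by (intro sum J(1)) (simp add: subord_def)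
    then show ?thesis using add[of "\<lambda>x. \<delta>", OF _ gc] const[of \<delta>] by simp
  qed
  also have "\<dots> \<le> \<delta> + (\<Sum>i\<in>J. content (U i))"
    using g(1) by (intro add_left_mono sum_mono subord_le_content) auto
  finally show thesis using J that by blast
qed

lemma outer_countably_subadditive: "countably_subadditive (Pow (topspace T)) (\<lambda>A. ennreal (outer A))"
  unfolding countably_subadditive_def
proof (intro allI impI)
  fix A :: "nat \<Rightarrow> 'a set" assume A: "range A \<subseteq> Pow (topspace T)"
  have AT: "A i \<subseteq> topspace T" for i using A by auto
  show "ennreal (outer (\<Union>i. A i)) \<le> (\<Sum>i. ennreal (outer (A i)))"
  proof (rule ennreal_le_epsilon)
    fix \<epsilon> :: real assume e: "\<epsilon> > 0"
    \<comment> \<open>The errors of the covers add up to \<open>\<epsilon>/2\<close>; the other half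
      is spent as the \<open>\<delta>\<close> of \<open>content_subadditive\<close>.\<close>
    have "\<exists>U. openin T U \<and> A i \<subseteq> U \<and> content U < outer (A i) + \<epsilon>/2 * (1/2) ^ Suc i" for i
      using outer_approx[OF AT[of i], of "\<epsilon>/2 * (1/2) ^ Suc i"] e by (metis divide_pos_pos mult_pos_pos zero_less_numeral zero_less_one zero_less_power)
    then obtain U where U: "\<And>i. openin T (U i)" "\<And>i. A i \<subseteq> U i" "\<And>i. content (U i) < outer (A i) + \<epsilon>/2 * (1/2) ^ Suc i"
      by metis
    have "openin T (\<Union>i. U i)" using U by blast
    then have "outer (\<Union>i. A i) \<le> content (\<Union>i. U i)" using U(2) by (intro outer_le_content) auto
    have half: "(\<lambda>i. ennreal (\<epsilon>/2 * (1/2) ^ Suc i)) sums ennreal (\<epsilon>/2)"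
      using sums_mult[OF power_half_series, of "\<epsilon>/2"] e by (subst sums_ennreal) auto
    have "ennreal (\<Lambda> f) \<le> (\<Sum>i. ennreal (outer (A i))) + ennreal \<epsilon>" if f: "f \<in> subord (\<Union>i. U i)" for f
    proof -
      obtain J where J: "finite J" "\<Lambda> f \<le> \<epsilon>/2 + (\<Sum>i\<in>J. content (U i))"
        using content_subadditive[OF f U(1), of "\<epsilon>/2"] e by auto
      have "\<Lambda> f \<le> \<epsilon>/2 + (\<Sum>i\<in>J. outer (A i) + \<epsilon>/2 * (1/2) ^ Suc i)"
        using J(2) sum_mono[of J "\<lambda>i. content (U i)" "\<lambda>i. outer (A i) + \<epsilon>/2 * (1/2) ^ Suc i"] U(3)
        by (smt (verit) less_imp_le)
      then have "ennreal (\<Lambda> f) \<le> ennreal (\<epsilon>/2 + (\<Sum>i\<in>J. outer (A i) + \<epsilon>/2 * (1/2) ^ Suc i))"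
        by (rule ennreal_leI)
      also have "\<dots> = ennreal (\<epsilon>/2) + (\<Sum>i\<in>J. ennreal (outer (A i)) + ennreal (\<epsilon>/2 * (1/2) ^ Suc i))"
        using e outer_nonneg[OF AT]
        by (subst ennreal_plus) (auto simp: sum_nonneg ennreal_plus[symmetric] simp del: ennreal_plus)
      also have "\<dots> \<le> ennreal (\<epsilon>/2) + (\<Sum>i. ennreal (outer (A i)) + ennreal (\<epsilon>/2 * (1/2) ^ Suc i))"
        using J(1) by (intro add_left_mono sum_le_suminf) auto
      also have "(\<Sum>i. ennreal (outer (A i)) + ennreal (\<epsilon>/2 * (1/2) ^ Suc i)) = (\<Sum>i. ennreal (outer (A i))) + ennreal (\<epsilon>/2)"
        using half by (subst suminf_add[symmetric]) (auto simp: sums_iff)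
      also have "ennreal (\<epsilon>/2) + ((\<Sum>i. ennreal (outer (A i))) + ennreal (\<epsilon>/2)) = (\<Sum>i. ennreal (outer (A i))) + ennreal \<epsilon>"
        using e by (simp add: ac_simps flip: ennreal_plus)
      finally show ?thesis .
    qed
    note bound = this
    show "ennreal (outer (\<Union>i. A i)) \<le> (\<Sum>i. ennreal (outer (A i))) + ennreal \<epsilon>"
    proof (cases "(\<Sum>i. ennreal (outer (A i))) + ennreal \<epsilon> = top")
      case False
      then obtain r where r: "r \<ge> 0" "(\<Sum>i. ennreal (outer (A i))) + ennreal \<epsilon> = ennreal r"
        by (metis ennreal_cases infinity_ennreal_def)
      have "\<Lambda> f \<le> r" if "f \<in> subord (\<Union>i. U i)" for f
        using bound[OF that] r by (simp add: ennreal_le_iff)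
      then have "content (\<Union>i. U i) \<le> r" by (rule content_le)
      then show ?thesis using r \<open>outer (\<Union>i. A i) \<le> content (\<Union>i. U i)\<close> by (simp add: ennreal_leI)
    qed simp
  qed
qed

lemma outer_measure_space_outer: "outer_measure_space (Pow (topspace T)) (\<lambda>A. ennreal (outer A))"
  unfolding outer_measure_space_def positive_def increasing_def
  using outer_countably_subadditive outer_empty by (auto intro!: ennreal_leI outer_mono)

text \<open>Caratheodory's inequality for open sets. A function subordinate to
  \<open>U \<inter> V\<close>, lowered by \<open>\<delta>\<close>, and one subordinate to
  \<open>U\<close> minus the level set live on disjoint sets, so their sum is still bounded by 1 and
  subordinate to \<open>U\<close>.\<close>

lemma openin_split:
  assumes V: "openin T V" and A: "A \<subseteq> topspace T"
  shows "outer (V \<inter> A) + outer (A - V) \<le> outer A"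
proof (rule le_outer[OF A])
  fix U assume U: "openin T U" "A \<subseteq> U"
  have UV: "openin T (U \<inter> V)" using U V by blast
  have "\<Lambda> f \<le> content U - outer (U - V)" if f: "f \<in> subord (U \<inter> V)" for f
  proof (rule field_le_epsilon)
    fix \<delta> :: real assume d: "\<delta> > 0"
    have cf: "cont f" using f by (simp add: subord_def)
    define C where "C = {x \<in> topspace T. f x \<in> {\<delta>..}}"
    have C: "closedin T C"
      unfolding C_def by (rule closedin_continuous_map_preimage[OF cf]) auto
    have op: "openin T (U - C)" using U(1) C by blast
    have "U - V \<subseteq> U - C" using f d openin_subset[OF U(1)] by (force simp: C_def subord_def)
    then have 1: "outer (U - V) \<le> content (U - C)" by (rule outer_le_content[OF op])
    define f' where "f' = (\<lambda>x. max (f x - \<delta>) 0)"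
    have cf': "cont f'" unfolding f'_def using cf by (intro continuous_intros) auto
    have "\<Lambda> (\<lambda>x. f x - \<delta>) \<le> \<Lambda> f'"
      using cf cf' by (intro mono continuous_intros) (auto simp: f'_def)
    then have 2: "\<Lambda> f - \<delta> \<le> \<Lambda> f'" using diff[OF cf, of "\<lambda>x. \<delta>"] const by simp
    have "\<Lambda> g \<le> content U - \<Lambda> f'" if g: "g \<in> subord (U - C)" for g
    proof -
      have "(\<lambda>x. f' x + g x) \<in> subord U"
        unfolding subord_def
      proof (intro CollectI conjI ballI)
        show "cont (\<lambda>x. f' x + g x)" using cf' g by (intro continuous_intros) (auto simp: subord_def)
        fix x
        { assume x: "x \<in> topspace T"
          show "0 \<le> f' x + g x" using g x by (auto simp: f'_def subord_def)
          show "f' x + g x \<le> 1"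
          proof (cases "x \<in> C")
            case True
            then have "g x = 0" using g x by (auto simp: subord_def)
            then show ?thesis using f x d by (fastforce simp: f'_def subord_def)
          next
            case False
            then show ?thesis using g x by (auto simp: f'_def subord_def C_def)
          qed }
        assume x: "x \<in> topspace T - U"
        then have "f x = 0" "g x = 0" using f g by (auto simp: subord_def)
        then show "f' x + g x = 0" using d by (simp add: f'_def)
      qed
      then have "\<Lambda> (\<lambda>x. f' x + g x) \<le> content U" by (rule subord_le_content)
      then show ?thesis using add[OF cf', of g] g by (simp add: subord_def)
    qed
    then have "content (U - C) \<le> content U - \<Lambda> f'" by (rule content_le)
    then show "\<Lambda> f \<le> content U - outer (U - V) + \<delta>" using 1 2 by linarith
  qed
  then have "content (U \<inter> V) \<le> content U - outer (U - V)" by (rule content_le)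
  moreover have "outer (V \<inter> A) \<le> content (U \<inter> V)" using U by (intro outer_le_content UV) auto
  moreover have "outer (A - V) \<le> outer (U - V)" using U openin_subset[OF U(1)] by (intro outer_mono) auto
  ultimately show "outer (V \<inter> A) + outer (A - V) \<le> content U" by linarith
qed

definition riesz_measure :: "'a measure" where
  "riesz_measure = measure_of (topspace T) {U. openin T U} (\<lambda>A. ennreal (outer A))"

lemma sets_riesz_measure: "sets riesz_measure = sets (borel_of_topology T)"
  unfolding riesz_measure_def borel_of_topology_def
  by (subst (1 2) sets_measure_of) (auto dest: openin_subset)

text \<open>By \<open>openin_split\<close> the open sets lie in the Caratheodory system of the outer
  measure, hence so does the sigma-algebra they generate, and there \<open>outer\<close> is
  countably additive.\<close>

lemma emeasure_riesz_measure:
  assumes "B \<in> sets riesz_measure"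
  shows "emeasure riesz_measure B = ennreal (outer B)"
proof -
  let ?f = "\<lambda>A. ennreal (outer A)"
  interpret P: sigma_algebra "topspace T" "Pow (topspace T)" by (rule sigma_algebra_Pow)
  let ?L = "lambda_system (topspace T) (Pow (topspace T)) ?f"
  have ms: "measure_space (topspace T) ?L ?f"
    by (rule P.caratheodory_lemma[OF outer_measure_space_outer])
  have "V \<in> ?L" if V: "openin T V" for V
    unfolding lambda_system_def
  proof (intro CollectI conjI ballI)
    show "V \<in> Pow (topspace T)" using openin_subset[OF V] by simp
    fix A assume "A \<in> Pow (topspace T)"
    then have A: "A \<subseteq> topspace T" by simp
    have eq: "(topspace T - V) \<inter> A = A - V" using A by auto
    have "subadditive (Pow (topspace T)) ?f"
      using outer_measure_space_outer by (intro P.countably_subadditive_subadditive) (auto simp: outer_measure_space_def)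
    then have "?f ((V \<inter> A) \<union> (A - V)) \<le> ?f (V \<inter> A) + ?f (A - V)"
      using A by (intro subadditiveD) auto
    moreover have "(V \<inter> A) \<union> (A - V) = A" by auto
    moreover have "?f (V \<inter> A) + ?f (A - V) \<le> ?f A"
      using openin_split[OF V A] A
      by (subst ennreal_plus[symmetric]) (auto intro!: outer_nonneg ennreal_leI)
    ultimately show "?f (V \<inter> A) + ?f ((topspace T - V) \<inter> A) = ?f A"
      using eq by (simp add: antisym)
  qed
  then have sub: "sigma_sets (topspace T) {U. openin T U} \<subseteq> ?L"
    using ms unfolding measure_space_def by (intro sigma_algebra.sigma_sets_subset) auto
  then have sub': "sets riesz_measure \<subseteq> ?L"
    by (simp add: sets_riesz_measure sets_borel_of_topology)
  show ?thesis
  proof (rule emeasure_measure_of[OF riesz_measure_def])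
    show "{U. openin T U} \<subseteq> Pow (topspace T)" by (auto dest: openin_subset)
    show "positive (sets riesz_measure) ?f" by (simp add: positive_def outer_empty)
    show "countably_additive (sets riesz_measure) ?f"
      using ms sub' unfolding measure_space_def countably_additive_def by blast
  qed (rule assms)
qed

lemma space_riesz_measure: "space riesz_measure = topspace T"
  using sets_eq_imp_space_eq[OF sets_riesz_measure] by simp

lemma prob_space_riesz_measure: "prob_space riesz_measure"
proof
  have "topspace T \<in> sets riesz_measure"
    using sets.top[of riesz_measure] by (simp add: space_riesz_measure)
  then show "emeasure riesz_measure (space riesz_measure) = 1"
    by (simp add: space_riesz_measure emeasure_riesz_measure outer_space)
qed

lemma measure_riesz_measure: "B \<in> sets riesz_measure \<Longrightarrow> measure riesz_measure B = outer B"
  using sets.sets_into_space[of B riesz_measure]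
  by (simp add: measure_def emeasure_riesz_measure space_riesz_measure outer_nonneg)

text \<open>\<open>outer\<close> approximates from outside by open sets, by definition. In a compact
  space complements of open sets are compact, so outer approximation of the complement is inner
  approximation of the set.\<close>

lemma radon_riesz_measure: "radon_prob_measure T riesz_measure"
  unfolding radon_prob_measure_def
proof (intro conjI ballI prob_space_riesz_measure sets_riesz_measure)
  interpret prob_space riesz_measure by (rule prob_space_riesz_measure)
  fix B assume B: "B \<in> sets riesz_measure"
  have BT: "B \<subseteq> topspace T" using sets.sets_into_space[OF B] by (simp add: space_riesz_measure)
  show "emeasure riesz_measure B = (SUP C\<in>{C. compactin T C \<and> C \<subseteq> B}. emeasure riesz_measure C)"
  proof (rule antisym)
    show "(SUP C\<in>{C. compactin T C \<and> C \<subseteq> B}. emeasure riesz_measure C) \<le> emeasure riesz_measure B"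
      using B by (auto intro!: SUP_least emeasure_mono)
    show "emeasure riesz_measure B \<le> (SUP C\<in>{C. compactin T C \<and> C \<subseteq> B}. emeasure riesz_measure C)"
    proof (rule ennreal_le_epsilon)
      fix \<epsilon> :: real assume e: "\<epsilon> > 0"
      obtain U where U: "openin T U" "topspace T - B \<subseteq> U" "content U < outer (topspace T - B) + \<epsilon>"
        using outer_approx[of "topspace T - B" \<epsilon>] e by auto
      have cl: "closedin T (topspace T - U)" using U(1) by blast
      have comp: "compactin T (topspace T - U)" using closedin_compact_space[OF T(1) cl] .
      have US: "U \<in> sets riesz_measure" using openin_sets_borel_of_topology[OF U(1)] by (simp add: sets_riesz_measure)
      have "measure riesz_measure (topspace T - U) = 1 - content U"
        using prob_compl[OF US] measure_riesz_measure[OF US] outer_open[OF U(1)] by (simp add: space_riesz_measure)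
      moreover have "outer (topspace T - B) = 1 - measure riesz_measure B"
        using prob_compl[OF B] measure_riesz_measure[of "topspace T - B"] sets.compl_sets[OF B] by (simp add: space_riesz_measure)
      ultimately have "measure riesz_measure B \<le> measure riesz_measure (topspace T - U) + \<epsilon>" using U(3) by simp
      then have "emeasure riesz_measure B \<le> emeasure riesz_measure (topspace T - U) + ennreal \<epsilon>"
        using e by (simp add: emeasure_eq_measure flip: ennreal_plus)
      also have "\<dots> \<le> (SUP C\<in>{C. compactin T C \<and> C \<subseteq> B}. emeasure riesz_measure C) + ennreal \<epsilon>"
        using comp U(2) by (intro add_right_mono SUP_upper) auto
      finally show "emeasure riesz_measure B \<le> (SUP C\<in>{C. compactin T C \<and> C \<subseteq> B}. emeasure riesz_measure C) + ennreal \<epsilon>" .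
    qed
  qed
qed

text \<open>On the open set where \<open>g > 1 - \<delta>\<close>, a subordinate function multiplied
  by \<open>1 - \<delta>\<close> stays below \<open>g\<close>; the bound follows by letting
  \<open>\<delta>\<close> tend to 0.\<close>

lemma measure_le_functional:
  assumes g: "cont g" "\<And>x. x \<in> topspace T \<Longrightarrow> 0 \<le> g x" and A: "A \<in> sets riesz_measure"
    and ge: "\<And>x. x \<in> A \<Longrightarrow> 1 \<le> g x"
  shows "measure riesz_measure A \<le> \<Lambda> g"
proof -
  have AT: "A \<subseteq> topspace T" using sets.sets_into_space[OF A] by (simp add: space_riesz_measure)
  have *: "(1 - \<delta>) * outer A \<le> \<Lambda> g" if d: "0 < \<delta>" "\<delta> < 1" for \<delta>
  proof -
    define U where "U = {x \<in> topspace T. g x \<in> {1 - \<delta><..}}"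
    have U: "openin T U" unfolding U_def by (rule openin_continuous_map_preimage[OF g(1)]) auto
    have "\<Lambda> h \<le> \<Lambda> g / (1 - \<delta>)" if h: "h \<in> subord U" for h
    proof -
      have ch: "cont h" using h by (simp add: subord_def)
      have "\<Lambda> (\<lambda>x. (1 - \<delta>) * h x) \<le> \<Lambda> g"
      proof (rule mono[OF _ g(1)])
        show "cont (\<lambda>x. (1 - \<delta>) * h x)" using ch by (intro continuous_intros) auto
        fix x assume x: "x \<in> topspace T"
        show "(1 - \<delta>) * h x \<le> g x"
        proof (cases "x \<in> U")
          case True
          have "(1 - \<delta>) * h x \<le> (1 - \<delta>) * 1" using h x d by (intro mult_left_mono) (auto simp: subord_def)
          then show ?thesis using True by (simp add: U_def)
        next
          case False
          then show ?thesis using h g(2)[OF x] x by (simp add: subord_def)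
        qed
      qed
      then have "(1 - \<delta>) * \<Lambda> h \<le> \<Lambda> g" by (simp only: scale[OF ch])
      then show ?thesis using d by (simp add: field_simps)
    qed
    then have "content U \<le> \<Lambda> g / (1 - \<delta>)" by (rule content_le)
    moreover have "outer A \<le> content U" using ge AT d by (intro outer_le_content U) (force simp: U_def)
    ultimately have "outer A \<le> \<Lambda> g / (1 - \<delta>)" by simp
    then show ?thesis using d by (simp add: field_simps)
  qed
  have "outer A \<le> \<Lambda> g"
  proof (rule tendsto_upperbound)
    show "((\<lambda>\<delta>. (1 - \<delta>) * outer A) \<longlongrightarrow> outer A) (at_right 0)"
      by (auto intro!: tendsto_eq_intros)
    show "\<forall>\<^sub>F \<delta> in at_right 0. (1 - \<delta>) * outer A \<le> \<Lambda> g"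
      using * unfolding eventually_at_right_field by (intro exI[of _ 1]) auto
  qed auto
  then show ?thesis by (simp add: measure_riesz_measure[OF A])
qed

text \<open>\<open>f\<close> is cut into \<open>N\<close> slices of height \<open>1 / N\<close>. The
  functional and the integral of each rescaled slice both lie between the measures of two
  consecutive superlevel sets, so the total error telescopes to at most 1 before the division by
  \<open>N\<close>.\<close>

lemma integral_riesz_measure_unit:
  assumes f: "cont f" "\<And>x. x \<in> topspace T \<Longrightarrow> 0 \<le> f x \<and> f x \<le> 1"
  shows "\<bar>\<Lambda> f - integral\<^sup>L riesz_measure f\<bar> \<le> 1 / real (Suc n)"
proof -
  interpret prob_space riesz_measure by (rule prob_space_riesz_measure)
  define N where "N = real (Suc n)"
  have N: "N > 0" by (simp add: N_def)
  define F where "F i = (\<lambda>x. min (f x) (real i / N))" for i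
  define s where "s i = (\<lambda>x. N * (F (Suc i) x - F i x))" for i
  have cF: "cont (F i)" for i unfolding F_def using f(1) by (intro continuous_intros) auto
  have cs: "cont (s i)" for i unfolding s_def using cF by (intro continuous_intros) auto
  have int: "integrable riesz_measure g" if "cont g" for g
    by (rule radon_integrable[OF radon_riesz_measure T(1) that])
  define m where "m i = measure riesz_measure {x \<in> topspace T. f x \<in> {real i / N<..}}" for i
  have bound: "\<bar>\<Lambda> (s i) - integral\<^sup>L riesz_measure (s i)\<bar> \<le> m i - m (Suc i)" for i
  proof -
    define U where "U = {x \<in> topspace T. f x \<in> {real i / N<..}}"
    define A where "A = {x \<in> topspace T. f x \<in> {real (Suc i) / N<..}}"
    have oU: "openin T U" unfolding U_def by (rule openin_continuous_map_preimage[OF f(1)]) auto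
    have oA: "openin T A" unfolding A_def by (rule openin_continuous_map_preimage[OF f(1)]) auto
    have SU: "U \<in> sets riesz_measure" and SA: "A \<in> sets riesz_measure"
      using oU oA openin_sets_borel_of_topology by (auto simp: sets_riesz_measure)
    have mi: "m i = measure riesz_measure U" "m (Suc i) = measure riesz_measure A" by (simp_all add: m_def U_def A_def)
    have step: "real (Suc i) / N = real i / N + 1 / N" using N by (simp add: field_simps)
    have s01: "0 \<le> s i x" "s i x \<le> 1" for x
    proof -
      have "1 / N > 0" using N by simp
      then have "F i x \<le> F (Suc i) x" "F (Suc i) x \<le> F i x + 1 / N"
        unfolding F_def step by linarith+
      then have d: "0 \<le> F (Suc i) x - F i x" "F (Suc i) x - F i x \<le> 1 / N" by auto
      show "0 \<le> s i x" using d N by (simp add: s_def)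
      have "N * (F (Suc i) x - F i x) \<le> N * (1 / N)" using d N by (intro mult_left_mono) auto
      then show "s i x \<le> 1" using N by (simp add: s_def)
    qed
    have s1: "s i x = 1" if "x \<in> A" for x
    proof -
      have "f x > real (Suc i) / N" using that by (simp add: A_def)
      moreover have "real i / N < real (Suc i) / N" using step N by simp
      ultimately have "F (Suc i) x = real (Suc i) / N" "F i x = real i / N" by (simp_all add: F_def min_def)
      then show ?thesis using N by (simp add: s_def field_simps)
    qed
    have s0: "s i x = 0" if "x \<in> topspace T - U" for x
    proof -
      have "f x \<le> real i / N" using that by (auto simp: U_def)
      moreover have "real i / N \<le> real (Suc i) / N" using step N by simp
      ultimately have "F (Suc i) x = f x" "F i x = f x" unfolding F_def by linarith+
      then show ?thesis by (simp add: s_def)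
    qed
    have "\<Lambda> (s i) \<le> measure riesz_measure U"
      unfolding measure_riesz_measure[OF SU] outer_open[OF oU]
      using s01 s0 cs by (intro subord_le_content) (auto simp: subord_def)
    moreover have "measure riesz_measure A \<le> \<Lambda> (s i)"
      using s01 s1 by (intro measure_le_functional cs SA) auto
    moreover have "integral\<^sup>L riesz_measure (s i) \<le> integral\<^sup>L riesz_measure (indicator U)"
      using s01 s0 SU by (intro integral_mono[OF int[OF cs]]) (auto simp: indicator_def space_riesz_measure emeasure_eq_measure)
    moreover have "integral\<^sup>L riesz_measure (indicator A) \<le> integral\<^sup>L riesz_measure (s i)"
      using s01 s1 SA by (intro integral_mono[OF _ int[OF cs]]) (auto simp: indicator_def emeasure_eq_measure)
    ultimately show ?thesis using SU SA mi by simp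
  qed
  have fs: "f x = (\<Sum>i<Suc n. s i x / N)" if "x \<in> topspace T" for x
  proof -
    have "(\<Sum>i<Suc n. s i x / N) = (\<Sum>i<Suc n. F (Suc i) x - F i x)" using N by (simp add: s_def)
    also have "\<dots> = F (Suc n) x - F 0 x" by (rule sum_lessThan_telescope)
    also have "F (Suc n) x = f x" using f(2)[OF that] N by (simp add: F_def N_def)
    also have "F 0 x = 0" using f(2)[OF that] by (simp add: F_def)
    finally show ?thesis by simp
  qed
  have csn: "cont (\<lambda>x. (1 / N) * s i x)" for i using cs by (intro continuous_intros) auto
  have "\<Lambda> f = \<Lambda> (\<lambda>x. \<Sum>i<Suc n. (1 / N) * s i x)"
    using fs csn f(1) by (intro antisym mono continuous_map_sum) auto
  also have "\<dots> = (\<Sum>i<Suc n. \<Lambda> (\<lambda>x. (1 / N) * s i x))" using csn by (intro sum) auto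
  also have "\<dots> = (\<Sum>i<Suc n. \<Lambda> (s i)) / N" by (simp only: scale[OF cs]) (simp add: sum_divide_distrib add_divide_distrib)
  finally have 1: "\<Lambda> f = (\<Sum>i<Suc n. \<Lambda> (s i)) / N" .
  have "integral\<^sup>L riesz_measure f = integral\<^sup>L riesz_measure (\<lambda>x. \<Sum>i<Suc n. s i x / N)"
    using fs by (intro Bochner_Integration.integral_cong) (auto simp: space_riesz_measure)
  also have "\<dots> = (\<Sum>i<Suc n. integral\<^sup>L riesz_measure (s i)) / N"
    using int[OF cs] by (subst Bochner_Integration.integral_sum) (auto simp: sum_divide_distrib add_divide_distrib)
  finally have 2: "integral\<^sup>L riesz_measure f = (\<Sum>i<Suc n. integral\<^sup>L riesz_measure (s i)) / N" .
  have "\<bar>(\<Sum>i<Suc n. \<Lambda> (s i)) - (\<Sum>i<Suc n. integral\<^sup>L riesz_measure (s i))\<bar> \<le> (\<Sum>i<Suc n. m i - m (Suc i))"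
    unfolding sum_subtractf[symmetric] using bound by (intro order_trans[OF sum_abs] sum_mono) auto
  also have "\<dots> = m 0 - m (Suc n)" by (rule sum_lessThan_telescope')
  also have "\<dots> \<le> 1" unfolding m_def using prob_le_1 by (smt (verit) measure_nonneg)
  finally have "\<bar>(\<Sum>i<Suc n. \<Lambda> (s i)) - (\<Sum>i<Suc n. integral\<^sup>L riesz_measure (s i))\<bar> / N \<le> 1 / N"
    using N by (simp add: divide_right_mono)
  then show ?thesis using N unfolding 1 2 N_def[symmetric] by (simp add: abs_divide flip: diff_divide_distrib)
qed

theorem riesz_markov: "cont f \<Longrightarrow> \<Lambda> f = integral\<^sup>L riesz_measure f"
proof -
  interpret prob_space riesz_measure by (rule prob_space_riesz_measure)
  assume f: "cont f"
  obtain B where B: "B > 0" "\<And>x. x \<in> topspace T \<Longrightarrow> \<bar>f x\<bar> \<le> B"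
    using continuous_map_bounded[OF T(1) f] by metis
  \<comment> \<open>An affine change that brings \<open>f\<close> into the unit interval, where the
    slicing estimate applies.\<close>
  define g where "g = (\<lambda>x. 1/2 + (1 / (2 * B)) * f x)"
  have cg0: "cont (\<lambda>x. (1 / (2 * B)) * f x)" using f by (intro continuous_intros) auto
  have cg: "cont g" unfolding g_def using f by (intro continuous_intros) auto
  have "0 \<le> g x \<and> g x \<le> 1" if "x \<in> topspace T" for x
    using B(1) B(2)[OF that] by (auto simp: g_def field_simps)
  then have "\<bar>\<Lambda> g - integral\<^sup>L riesz_measure g\<bar> \<le> 1 / real (Suc n)" for n
    by (intro integral_riesz_measure_unit cg)
  then have "\<bar>\<Lambda> g - integral\<^sup>L riesz_measure g\<bar> \<le> 0"
    by (intro tendsto_lowerbound[OF LIMSEQ_Suc[OF lim_1_over_n]]) auto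
  then have eq: "\<Lambda> g = integral\<^sup>L riesz_measure g" by simp
  have "\<Lambda> g = 1/2 + (1 / (2 * B)) * \<Lambda> f"
    unfolding g_def using add[of "\<lambda>x. 1/2", OF _ cg0] scale[OF f, of "1 / (2 * B)"] const[of "1/2"]
    by (simp del: times_divide_eq_left)
  moreover have "integral\<^sup>L riesz_measure g = 1/2 + (1 / (2 * B)) * integral\<^sup>L riesz_measure f"
    unfolding g_def using radon_integrable[OF radon_riesz_measure T(1) f]
    by (subst Bochner_Integration.integral_add) (auto simp: prob_space)
  ultimately show ?thesis using eq B(1) by simp
qed

end

section \<open>Order-unit Banach spaces\<close>

text \<open>Linear functions bounded by \<open>r * norm x\<close> form a closed subset of a product
  of compact intervals, and \<open>Blinfun\<close> maps it continuously onto the ball.\<close>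

theorem banach_alaoglu:
  "compactin weak_star_topology {\<phi> :: 'a::real_normed_vector \<Rightarrow>\<^sub>L real. norm \<phi> \<le> r}"
proof (cases "r \<ge> 0")
  case False
  then have "{\<phi> :: 'a \<Rightarrow>\<^sub>L real. norm \<phi> \<le> r} = {}" using norm_ge_zero by (auto simp: not_le intro: less_le_trans)
  then show ?thesis by simp
next
  case True
  define P where "P = (\<Pi>\<^sub>E x\<in>(UNIV::'a set). {- (r * norm x)..r * norm x})"
  define C where "C = {f \<in> P. linear f}"
  have "compactin (product_topology (\<lambda>_. euclideanreal) UNIV) P"
    unfolding P_def by (subst compactin_PiE) auto
  then have "compactin euclidean P" by (simp add: euclidean_product_topology)
  moreover have "closed {f :: 'a \<Rightarrow> real. linear f}"
  proof -
    have eq: "{f :: 'a \<Rightarrow> real. linear f} =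
        (\<Inter>x. \<Inter>y. {f. f (x + y) = f x + f y}) \<inter> (\<Inter>c. \<Inter>x. {f. f (c *\<^sub>R x) = c *\<^sub>R f x})"
      by (auto simp: linear_iff)
    have "closed {f :: 'a \<Rightarrow> real. f (x + y) = f x + f y}" for x y
      by (intro closed_Collect_eq continuous_intros continuous_on_product_coordinates)
    moreover have "closed {f :: 'a \<Rightarrow> real. f (c *\<^sub>R x) = c *\<^sub>R f x}" for c x
      by (intro closed_Collect_eq continuous_intros continuous_on_product_coordinates)
    ultimately show ?thesis unfolding eq by (intro closed_Int closed_INT) auto
  qed
  ultimately have "compactin euclidean C"
    unfolding C_def using compact_Int_closed[of P "{f. linear f}"] by (simp add: Int_def)
  then have cC: "compactin (subtopology euclidean C) C" by (simp add: compactin_subtopology)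
  have bl: "bounded_linear f" "norm (Blinfun f) \<le> r" if "f \<in> C" for f
  proof -
    have f: "linear f" "\<And>x. norm (f x) \<le> norm x * r" using that by (auto simp: C_def P_def PiE_def Pi_def abs_le_iff mult.commute minus_le_iff)
    then show "bounded_linear f" by (intro bounded_linear.intro bounded_linear_axioms.intro exI[of _ r]) auto
    then show "norm (Blinfun f) \<le> r"
      using f True by (intro norm_blinfun_bound) (auto simp: bounded_linear_Blinfun_apply mult.commute)
  qed
  have "continuous_map (subtopology euclidean C) weak_star_topology Blinfun"
    unfolding continuous_on_strong_operator_topo_iff_coordinatewise
  proof
    fix x
    have "continuous_map (subtopology euclidean C) euclideanreal (\<lambda>f. f x)"
      by (simp add: continuous_on_product_coordinates continuous_on_subset[OF continuous_on_product_coordinates])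
    then show "continuous_map (subtopology euclidean C) euclideanreal (\<lambda>f. blinfun_apply (Blinfun f) x)"
      by (rule continuous_map_eq) (auto simp: bl bounded_linear_Blinfun_apply)
  qed
  from image_compactin[OF cC this] have "compactin weak_star_topology (Blinfun ` C)" .
  moreover have "Blinfun ` C = {\<phi>. norm \<phi> \<le> r}"
  proof (intro set_eqI iffI)
    fix \<phi> :: "'a \<Rightarrow>\<^sub>L real" assume "\<phi> \<in> {\<phi>. norm \<phi> \<le> r}"
    then have "norm (blinfun_apply \<phi> x) \<le> r * norm x" for x
      using norm_blinfun[of \<phi> x] mult_right_mono[of "norm \<phi>" r "norm x"] by auto
    then have "blinfun_apply \<phi> \<in> C"
      by (force simp: C_def P_def abs_le_iff intro: bounded_linear.linear blinfun.bounded_linear_right)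
    then show "\<phi> \<in> Blinfun ` C" by (intro image_eqI[of _ _ "blinfun_apply \<phi>"]) (auto simp: blinfun_apply_inverse)
  qed (auto simp: bl)
  ultimately show ?thesis by simp
qed

lemma is_lattice_order_iff_positive_parts:
  fixes C :: "'v::real_vector set"
  assumes C: "0 \<in> C" "\<And>x y. x \<in> C \<Longrightarrow> y \<in> C \<Longrightarrow> x + y \<in> C"
    and anti: "\<And>x. x \<in> C \<Longrightarrow> - x \<in> C \<Longrightarrow> x = 0"
  shows "is_lattice_order (\<lambda>x y. y - x \<in> C) \<longleftrightarrow> positive_parts UNIV C"
proof
  assume "is_lattice_order (\<lambda>x y. y - x \<in> C)"
  then obtain inf sup where L: "class.lattice inf (\<lambda>x y. y - x \<in> C) (\<lambda>x y. y - x \<in> C \<and> \<not> x - y \<in> C) sup"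
    by (auto simp: is_lattice_order_def)
  then interpret L: lattice inf "\<lambda>x y. y - x \<in> C" "\<lambda>x y. y - x \<in> C \<and> \<not> x - y \<in> C" sup .
  show "positive_parts UNIV C"
    unfolding positive_parts_def
  proof (intro ballI bexI conjI impI)
    fix v
    show "sup v 0 - v \<in> C" by (rule L.sup_ge1)
    show "sup v 0 \<in> C" using L.sup_ge2[of 0 v] L.sup_ge2[of v 0] by simp
    show "u - sup v 0 \<in> C" if "u \<in> C" "u - v \<in> C" for u
      using L.sup_least[of u v 0] that by simp
  qed
next
  assume "positive_parts UNIV C"
  then obtain pp where pp: "\<And>v. pp v \<in> C" "\<And>v. pp v - v \<in> C" "\<And>u v. u \<in> C \<Longrightarrow> u - v \<in> C \<Longrightarrow> u - pp v \<in> C"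
    unfolding positive_parts_def by (metis UNIV_I)
  have "class.lattice (\<lambda>x y. x - pp (x - y)) (\<lambda>x y. y - x \<in> C) (\<lambda>x y. y - x \<in> C \<and> \<not> x - y \<in> C) (\<lambda>x y. y + pp (x - y))"
  proof
    fix x y z
    show "x - x \<in> C" using C by simp
    show "z - x \<in> C" if "y - x \<in> C" "z - y \<in> C" using C(2)[OF that] by simp
    show "x = y" if "y - x \<in> C" "x - y \<in> C" using anti[of "y - x"] that by simp
    show "x - (x - pp (x - y)) \<in> C" using pp(1) by simp
    show "y - (x - pp (x - y)) \<in> C" using pp(2)[of "x - y"] by (simp add: algebra_simps)
    show "y - pp (y - z) - x \<in> C" if "y - x \<in> C" "z - x \<in> C"
      using pp(3)[of "y - x" "y - z"] that by (simp add: algebra_simps)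
    show "y + pp (x - y) - x \<in> C" using pp(2)[of "x - y"] by (simp add: algebra_simps)
    show "y + pp (x - y) - y \<in> C" using pp(1) by simp
    show "x - (z + pp (y - z)) \<in> C" if "x - y \<in> C" "x - z \<in> C"
      using pp(3)[of "x - z" "y - z"] that by (simp add: algebra_simps)
  qed auto
  then show "is_lattice_order (\<lambda>x y. y - x \<in> C)"
    unfolding is_lattice_order_def by blast
qed

abbreviation pos_cone :: "'a::ordered_real_vector set" where
  "pos_cone \<equiv> {a. 0 \<le> a}"

lemma linear_functional_on_UNIV: "linear_functional_on UNIV F \<longleftrightarrow> linear F"
  by (auto simp: linear_functional_on_def linear_iff)

section \<open>Interplay of order and norm in an order-unit space\<close>

locale order_unit_banach =
  fixes e :: "'a::{banach, ordered_real_vector}"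
  assumes ou: "order_unit_banach_space e"
begin

lemma e_nonneg: "0 \<le> e"
proof -
  obtain r where r: "r > 0" "0 \<le> r *\<^sub>R e"
    using ou unfolding order_unit_banach_space_def order_unit_def by blast
  have "inverse r *\<^sub>R 0 \<le> inverse r *\<^sub>R (r *\<^sub>R e)"
    using r by (intro scaleR_left_mono) auto
  then show ?thesis using r by simp
qed

lemma scaleR_e_mono: "r \<le> s \<Longrightarrow> r *\<^sub>R e \<le> s *\<^sub>R e"
  by (rule scaleR_right_mono[OF _ e_nonneg])

lemma archimedean:
  assumes "\<And>\<epsilon>. \<epsilon> > 0 \<Longrightarrow> a \<le> b + \<epsilon> *\<^sub>R e"
  shows "a \<le> b"
proof -
  have "real n *\<^sub>R (a - b) \<le> e" for n
  proof (cases "n = 0")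
    case False
    have "a - b \<le> (1 / real n) *\<^sub>R e" using assms[of "1 / real n"] False by (simp add: algebra_simps)
    then have "real n *\<^sub>R (a - b) \<le> real n *\<^sub>R ((1 / real n) *\<^sub>R e)" by (intro scaleR_left_mono) auto
    then show ?thesis using False by simp
  qed (simp add: e_nonneg)
  then have "a - b \<le> 0" using ou unfolding order_unit_banach_space_def by blast
  then show ?thesis by simp
qed

lemma norm_eq: "norm a = Inf {r. r > 0 \<and> - (r *\<^sub>R e) \<le> a \<and> a \<le> r *\<^sub>R e}"
  using ou by (simp add: order_unit_banach_space_def)

lemma norm_leI:
  assumes "- (r *\<^sub>R e) \<le> a" "a \<le> r *\<^sub>R e" "0 \<le> r"
  shows "norm a \<le> r"
proof (cases "r = 0")
  case True
  then show ?thesis using assms by simp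
next
  case False
  then show ?thesis unfolding norm_eq using assms by (intro cInf_lower bdd_belowI[of _ 0]) auto
qed

text \<open>The Archimedean property makes the infimum defining the norm attained; from here on norm
  bounds and order bounds by multiples of \<open>e\<close> are interchangeable.\<close>

lemma le_norm: "a \<le> norm a *\<^sub>R e" and minus_le_norm: "- (norm a *\<^sub>R e) \<le> a"
proof -
  have *: "- ((norm a + \<epsilon>) *\<^sub>R e) \<le> a \<and> a \<le> (norm a + \<epsilon>) *\<^sub>R e" if "\<epsilon> > 0" for \<epsilon>
  proof -
    have "{r. r > 0 \<and> - (r *\<^sub>R e) \<le> a \<and> a \<le> r *\<^sub>R e} \<noteq> {}"
      using ou unfolding order_unit_banach_space_def order_unit_def by blast
    moreover have "Inf {r. r > 0 \<and> - (r *\<^sub>R e) \<le> a \<and> a \<le> r *\<^sub>R e} < norm a + \<epsilon>" using norm_eq[of a] that by simp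
    ultimately obtain r where r: "- (r *\<^sub>R e) \<le> a" "a \<le> r *\<^sub>R e" "r < norm a + \<epsilon>" 
      using cInf_lessD[of "{r. r > 0 \<and> - (r *\<^sub>R e) \<le> a \<and> a \<le> r *\<^sub>R e}" "norm a + \<epsilon>"] by auto
    have "r *\<^sub>R e \<le> (norm a + \<epsilon>) *\<^sub>R e" using r by (intro scaleR_e_mono) auto
    moreover from this have "- ((norm a + \<epsilon>) *\<^sub>R e) \<le> - (r *\<^sub>R e)" by simp
    ultimately show ?thesis using order_trans[OF _ r(1)] order_trans[OF r(2)] by simp
  qed
  show "a \<le> norm a *\<^sub>R e" by (rule archimedean) (use * in \<open>simp add: algebra_simps\<close>)
  show "- (norm a *\<^sub>R e) \<le> a"
  proof (rule archimedean)
    fix \<epsilon> :: real assume "\<epsilon> > 0"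
    then have "- (norm a *\<^sub>R e) - \<epsilon> *\<^sub>R e \<le> a" using *[of \<epsilon>] by (simp add: scaleR_add_left)
    then show "- (norm a *\<^sub>R e) \<le> a + \<epsilon> *\<^sub>R e" by (simp only: diff_le_eq)
  qed
qed

lemma norm_plus_nonneg: "0 \<le> norm a *\<^sub>R e + a"
  using add_left_mono[OF minus_le_norm[of a], of "norm a *\<^sub>R e"] by simp

lemma norm_leD:
  assumes "norm a \<le> r"
  shows "a \<le> r *\<^sub>R e" "- (r *\<^sub>R e) \<le> a"
proof -
  have *: "norm a *\<^sub>R e \<le> r *\<^sub>R e" using assms by (rule scaleR_e_mono)
  show "a \<le> r *\<^sub>R e" using le_norm * by (rule order_trans)
  have "- (r *\<^sub>R e) \<le> - (norm a *\<^sub>R e)" using * by simp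
  then show "- (r *\<^sub>R e) \<le> a" using minus_le_norm by (rule order_trans)
qed

lemma trivial: "e = 0 \<Longrightarrow> (a::'a) = 0"
  using le_norm[of a] minus_le_norm[of a] by simp

lemma norm_e_le: "norm e \<le> 1"
proof -
  have "- e \<le> e" using e_nonneg by (metis neg_le_0_iff_le order_trans)
  then show ?thesis using norm_leI[of 1 e] by simp
qed

lemma scaleR_e_nonneg_iff: "e \<noteq> 0 \<Longrightarrow> 0 \<le> r *\<^sub>R e \<longleftrightarrow> 0 \<le> r"
proof
  assume "e \<noteq> 0" "0 \<le> r *\<^sub>R e"
  show "0 \<le> r"
  proof (rule ccontr)
    assume "\<not> 0 \<le> r"
    then have "r < 0" by simp
    then have "inverse (- r) *\<^sub>R 0 \<le> inverse (- r) *\<^sub>R (r *\<^sub>R e)" using \<open>0 \<le> r *\<^sub>R e\<close> by (intro scaleR_left_mono) auto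
    then have "e \<le> 0" using \<open>r < 0\<close> by simp
    then show False using e_nonneg \<open>e \<noteq> 0\<close> by simp
  qed
qed (use scaleR_e_mono[of 0 r] in simp)

lemma pos_coneD: "0 \<le> a \<Longrightarrow> \<exists>M>0. 0 \<le> (1 / M) *\<^sub>R a \<and> (1 / M) *\<^sub>R a \<le> e"
proof (intro exI[of _ "norm a + 1"] conjI)
  assume a: "0 \<le> a"
  let ?M = "norm a + 1"
  show M: "?M > 0" by (simp add: add_nonneg_pos)
  show "0 \<le> (1 / ?M) *\<^sub>R a" using a M by (intro scaleR_nonneg_nonneg) auto
  have "a \<le> ?M *\<^sub>R e" by (rule norm_leD) simp
  then have "(1 / ?M) *\<^sub>R a \<le> (1 / ?M) *\<^sub>R (?M *\<^sub>R e)" using M by (intro scaleR_left_mono) auto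
  then show "(1 / ?M) *\<^sub>R a \<le> e" using M by simp
qed

lemma dual_cone_bound:
  assumes "\<phi> \<in> dual_cone"
  shows "\<bar>blinfun_apply \<phi> a\<bar> \<le> norm a * blinfun_apply \<phi> e"
proof -
  have "0 \<le> blinfun_apply \<phi> (norm a *\<^sub>R e - a)" "0 \<le> blinfun_apply \<phi> (norm a *\<^sub>R e + a)"
    using assms le_norm[of a] norm_plus_nonneg[of a] by (auto simp: dual_cone_def)
  then show ?thesis by (auto simp: blinfun.bilinear_simps abs_le_iff)
qed

lemma norm_dual_cone: "\<phi> \<in> dual_cone \<Longrightarrow> norm \<phi> = blinfun_apply \<phi> e"
proof (rule antisym)
  assume \<phi>: "\<phi> \<in> dual_cone"
  then have e: "0 \<le> blinfun_apply \<phi> e" using e_nonneg by (simp add: dual_cone_def)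
  show "norm \<phi> \<le> blinfun_apply \<phi> e"
    using dual_cone_bound[OF \<phi>] e by (intro norm_blinfun_bound) (auto simp: mult.commute)
  have "blinfun_apply \<phi> e \<le> norm \<phi> * norm e" using norm_blinfun[of \<phi> e] e by simp
  also have "\<dots> \<le> norm \<phi>" using norm_e_le by (simp add: mult_left_le)
  finally show "blinfun_apply \<phi> e \<le> norm \<phi>" .
qed

lemma state_space_eq: "state_space e = {\<phi> \<in> dual_cone. blinfun_apply \<phi> e = 1}"
  using norm_dual_cone by (auto simp: state_space_def)

lemma positive_bounded_linear:
  fixes f :: "'a \<Rightarrow> real"
  assumes "linear f" "\<And>a. 0 \<le> a \<Longrightarrow> 0 \<le> f a"
  shows "bounded_linear f"
proof (intro bounded_linear.intro bounded_linear_axioms.intro exI[of _ "f e"] allI assms(1))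
  fix a
  have "0 \<le> f (norm a *\<^sub>R e - a)" "0 \<le> f (norm a *\<^sub>R e + a)"
    using assms(2) le_norm[of a] norm_plus_nonneg[of a] by auto
  then show "norm (f a) \<le> norm a * f e"
    using assms(1) by (auto simp: linear_diff linear_add linear_scale abs_le_iff)
qed

lemma dual_cone_add: "\<phi> \<in> dual_cone \<Longrightarrow> \<psi> \<in> dual_cone \<Longrightarrow> \<phi> + \<psi> \<in> (dual_cone :: ('a \<Rightarrow>\<^sub>L real) set)"
  by (auto simp: dual_cone_def blinfun.bilinear_simps)

lemma dual_cone_scale: "\<phi> \<in> dual_cone \<Longrightarrow> 0 \<le> r \<Longrightarrow> r *\<^sub>R \<phi> \<in> (dual_cone :: ('a \<Rightarrow>\<^sub>L real) set)"
  by (auto simp: dual_cone_def blinfun.bilinear_simps)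

lemma dual_cone_zero: "0 \<in> (dual_cone :: ('a \<Rightarrow>\<^sub>L real) set)"
  by (auto simp: dual_cone_def)

lemma dual_cone_anti:
  assumes "\<phi> \<in> dual_cone" "- \<phi> \<in> dual_cone" shows "\<phi> = (0 :: 'a \<Rightarrow>\<^sub>L real)"
proof -
  have "norm \<phi> = - norm (- \<phi>)" using norm_dual_cone[OF assms(1)] norm_dual_cone[OF assms(2)] by (simp add: blinfun.bilinear_simps)
  then show ?thesis by simp
qed

lemma lattice_dual_iff:
  "is_lattice_order (dual_le :: ('a \<Rightarrow>\<^sub>L real) \<Rightarrow> ('a \<Rightarrow>\<^sub>L real) \<Rightarrow> bool)
     \<longleftrightarrow> positive_parts UNIV (dual_cone :: ('a \<Rightarrow>\<^sub>L real) set)"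
proof -
  have "(dual_le :: ('a \<Rightarrow>\<^sub>L real) \<Rightarrow> ('a \<Rightarrow>\<^sub>L real) \<Rightarrow> bool) = (\<lambda>x y. y - x \<in> dual_cone)"
    by (intro ext) (simp add: dual_le_def)
  then show ?thesis
    using is_lattice_order_iff_positive_parts[OF dual_cone_zero dual_cone_add dual_cone_anti] by simp
qed

text \<open>Riesz-Kantorovich for the cone of \<open>E\<close> and the functional
  \<open>\<phi>\<close>: order intervals are norm bounded, so the suprema are finite, and positive
  functionals are automatically bounded, so the result lies in the dual.\<close>

lemma dual_positive_parts:
  assumes "positive_parts UNIV (pos_cone :: 'a set)"
  shows "positive_parts UNIV (dual_cone :: ('a \<Rightarrow>\<^sub>L real) set)"
  unfolding positive_parts_def
proof
  fix \<phi> :: "'a \<Rightarrow>\<^sub>L real"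
  have bdd: "bdd_above (blinfun_apply \<phi> ` {g \<in> pos_cone. f - g \<in> pos_cone})" if "f \<in> pos_cone" for f
  proof (rule bdd_aboveI2)
    fix g assume "g \<in> {g \<in> pos_cone. f - g \<in> pos_cone}"
    then have g: "0 \<le> g" "g \<le> f" by auto
    have "norm g \<le> norm f"
    proof (rule norm_leI)
      have "0 \<le> norm f *\<^sub>R e" using e_nonneg by (simp add: scaleR_nonneg_nonneg)
      then have "- (norm f *\<^sub>R e) \<le> 0" by simp
      then show "- (norm f *\<^sub>R e) \<le> g" using g(1) by (rule order_trans)
      show "g \<le> norm f *\<^sub>R e" using g(2) le_norm by (rule order_trans)
    qed simp
    then have "norm (blinfun_apply \<phi> g) \<le> norm \<phi> * norm f"
      using norm_blinfun[of \<phi> g] by (meson mult_left_mono norm_ge_zero order_trans)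
    then show "blinfun_apply \<phi> g \<le> norm \<phi> * norm f" by simp
  qed
  obtain H where H: "linear_functional_on UNIV H" "\<And>f. f \<in> pos_cone \<Longrightarrow> 0 \<le> H f"
    "\<And>f. f \<in> pos_cone \<Longrightarrow> blinfun_apply \<phi> f \<le> H f"
    "\<And>G f. linear_functional_on UNIV G \<Longrightarrow> (\<And>f. f \<in> pos_cone \<Longrightarrow> 0 \<le> G f) \<Longrightarrow>
        (\<And>f. f \<in> pos_cone \<Longrightarrow> blinfun_apply \<phi> f \<le> G f) \<Longrightarrow> f \<in> pos_cone \<Longrightarrow> H f \<le> G f"
  proof (rule riesz_kantorovich[OF _ _ _ _ assms _ bdd])
    show "linear_functional_on UNIV (blinfun_apply \<phi>)"
      by (simp add: linear_functional_on_def blinfun.bilinear_simps)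
  qed (auto simp: scaleR_nonneg_nonneg)
  have bl: "bounded_linear H"
    using H(1,2) by (intro positive_bounded_linear) (auto simp: linear_functional_on_UNIV)
  show "\<exists>p\<in>dual_cone. p - \<phi> \<in> dual_cone \<and> (\<forall>u\<in>dual_cone. u - \<phi> \<in> dual_cone \<longrightarrow> u - p \<in> dual_cone)"
  proof (intro bexI[of _ "Blinfun H"] conjI ballI impI)
    show "Blinfun H \<in> dual_cone" "Blinfun H - \<phi> \<in> dual_cone"
      using H(2,3) by (auto simp: dual_cone_def blinfun.bilinear_simps bounded_linear_Blinfun_apply[OF bl])
    fix u :: "'a \<Rightarrow>\<^sub>L real" assume u: "u \<in> dual_cone" "u - \<phi> \<in> dual_cone"
    have "H f \<le> blinfun_apply u f" if "f \<in> pos_cone" for f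
      using u that
      by (intro H(4)) (auto simp: linear_functional_on_def dual_cone_def blinfun.bilinear_simps)
    then show "u - Blinfun H \<in> dual_cone"
      by (auto simp: dual_cone_def blinfun.bilinear_simps bounded_linear_Blinfun_apply[OF bl])
  qed
qed

lemma compatible_if_positive_parts:
  assumes "positive_parts UNIV (pos_cone :: 'a set)" "measurement e 2 a" "measurement e 2 b"
  shows "compatible 2 2 a b"
proof -
  have two: "{1..2::nat} = {1, 2}" by auto
  have a: "0 \<le> a 1" "0 \<le> a 2" "a 1 + a 2 = e" and b: "0 \<le> b 1" "0 \<le> b 2" "b 1 + b 2 = e"
    using assms(2,3) unfolding measurement_def two by auto
  obtain p where p: "0 \<le> p" "b 1 - a 1 \<le> p" "\<And>u. 0 \<le> u \<Longrightarrow> b 1 - a 1 \<le> u \<Longrightarrow> p \<le> u"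
    using assms(1) unfolding positive_parts_def by fastforce
  have p1: "p \<le> b 1" using p(3)[of "b 1"] a b by simp
  have "b 1 \<le> e" using b by (metis le_add_same_cancel1)
  then have p2: "p \<le> a 2" using p(3)[of "a 2"] a by (simp add: algebra_simps)
  \<comment> \<open>\<open>b 1 - p\<close> is the infimum of \<open>a 1\<close> and
    \<open>b 1\<close>; the other three entries are dictated by the marginals, and
    \<open>p \<le> b 1\<close> and \<open>p \<le> a 2\<close> make the diagonal entries
    nonnegative.\<close>
  define c where "c = (\<lambda>j k. if j = (1::nat) then (if k = (1::nat) then b 1 - p else a 1 - (b 1 - p))
     else (if k = 1 then p else a 2 - p))"
  have b2: "b 2 = a 1 + a 2 - b 1" using a(3) b(3) by (simp add: algebra_simps)
  show ?thesis
    unfolding compatible_def two using p(1,2) p1 p2 b2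
    by (intro exI[of _ c]) (auto simp: c_def algebra_simps)
qed

end

section \<open>Lattice structure from a predual\<close>

context order_unit_banach
begin

text \<open>Hahn-Banach on \<open>E \<times> E\<close>, the functional being sought as
  \<open>F (a, b) = f1 a + f2 b\<close>. The choice \<open>c = 0\<close>, \<open>l = 0\<close> makes
  both parts positive, \<open>(a, - a)\<close> with \<open>c = - a\<close>, \<open>l = 0\<close>
  gives \<open>f1 - f2 = \<phi>\<close>, and \<open>(e, e)\<close> with \<open>c = 0\<close>,
  \<open>l = 1\<close> bounds the total mass by \<open>norm \<phi>\<close>.\<close>

lemma jordan_decomposition:
  fixes \<phi> :: "'a \<Rightarrow>\<^sub>L real"
  obtains \<phi>1 \<phi>2 where "\<phi>1 \<in> dual_cone" "\<phi>2 \<in> dual_cone" "\<phi> = \<phi>1 - \<phi>2"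
    "blinfun_apply \<phi>1 e + blinfun_apply \<phi>2 e \<le> norm \<phi>"
proof (cases "e = 0")
  case True
  have z: "(a::'a) = 0" for a using trivial[OF True] .
  have "blinfun_apply \<phi> a = blinfun_apply 0 a" for a using z[of a] by (simp add: blinfun.zero_right)
  then have "\<phi> = 0" by (intro blinfun_eqI) simp
  then show thesis using that[of 0 0] dual_cone_zero by simp
next
  case False
  define A where "A = (\<lambda>x :: 'a \<times> 'a. {norm \<phi> * l - blinfun_apply \<phi> c | l c. fst x + c \<le> l *\<^sub>R e \<and> snd x - c \<le> l *\<^sub>R e})"
  \<comment> \<open>The two inequalities confine \<open>c\<close> to an interval of radius
    \<open>m\<close>, so \<open>\<phi>\<close> is at most \<open>norm \<phi> * m\<close> at
    \<open>c\<close>; that \<open>m\<close> is nonnegative uses \<open>e \<noteq> 0\<close>.\<close>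
  have lower: "- (norm \<phi> * (norm (fst x) + norm (snd x))) \<le> r" if rA: "r \<in> A x" for x r
  proof -
    obtain l c where lc: "r = norm \<phi> * l - blinfun_apply \<phi> c" "fst x + c \<le> l *\<^sub>R e" "snd x - c \<le> l *\<^sub>R e"
      using rA unfolding A_def by blast
    define m where "m = l + norm (fst x) + norm (snd x)"
    have "c \<le> l *\<^sub>R e + norm (fst x) *\<^sub>R e"
      using add_mono[OF lc(2) le_norm[of "- fst x"]] by simp
    also have "\<dots> \<le> m *\<^sub>R e" unfolding scaleR_add_left[symmetric] m_def by (intro scaleR_e_mono) simp
    finally have c1: "c \<le> m *\<^sub>R e" .
    have "- c \<le> l *\<^sub>R e + norm (snd x) *\<^sub>R e"
      using add_mono[OF lc(3) le_norm[of "- snd x"]] by simp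
    also have "\<dots> \<le> m *\<^sub>R e" unfolding scaleR_add_left[symmetric] m_def by (intro scaleR_e_mono) simp
    finally have c2: "- c \<le> m *\<^sub>R e" .
    have "0 \<le> (2 * m) *\<^sub>R e" using add_mono[OF c1 c2] by (simp flip: scaleR_add_left)
    then have "0 \<le> m" using scaleR_e_nonneg_iff[OF False, of "2 * m"] by simp
    then have "norm c \<le> m" using c1 c2 by (intro norm_leI) (auto simp: minus_le_iff)
    then have "norm (blinfun_apply \<phi> c) \<le> norm \<phi> * m"
      using norm_blinfun[of \<phi> c] by (meson mult_left_mono norm_ge_zero order_trans)
    then have "blinfun_apply \<phi> c \<le> norm \<phi> * m" by simp
    then show ?thesis using lc(1) by (simp add: m_def algebra_simps)
  qed
  have bdd: "bdd_below (A x)" for x using lower by (intro bdd_belowI)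
  have ne: "A x \<noteq> {}" for x
  proof -
    have "fst x + 0 \<le> max (norm (fst x)) (norm (snd x)) *\<^sub>R e" "snd x - 0 \<le> max (norm (fst x)) (norm (snd x)) *\<^sub>R e"
      using norm_leD(1)[of _ "max (norm (fst x)) (norm (snd x))"] by auto
    then show ?thesis unfolding A_def by blast
  qed
  have AI: "norm \<phi> * l - blinfun_apply \<phi> c \<in> A x" if "fst x + c \<le> l *\<^sub>R e" "snd x - c \<le> l *\<^sub>R e" for x l c
    using that unfolding A_def by blast
  have add: "l + k \<in> A (x + y)" if lk: "l \<in> A x" "k \<in> A y" for x y l k
  proof -
    obtain m c n d where l: "l = norm \<phi> * m - blinfun_apply \<phi> c" "fst x + c \<le> m *\<^sub>R e" "snd x - c \<le> m *\<^sub>R e"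
      and k: "k = norm \<phi> * n - blinfun_apply \<phi> d" "fst y + d \<le> n *\<^sub>R e" "snd y - d \<le> n *\<^sub>R e"
      using lk unfolding A_def by blast
    have "l + k = norm \<phi> * (m + n) - blinfun_apply \<phi> (c + d)"
      by (simp add: l(1) k(1) algebra_simps blinfun.bilinear_simps)
    moreover have "norm \<phi> * (m + n) - blinfun_apply \<phi> (c + d) \<in> A (x + y)"
      using add_mono[OF l(2) k(2)] add_mono[OF l(3) k(3)] by (intro AI) (auto simp: algebra_simps)
    ultimately show ?thesis by simp
  qed
  have scale: "r * l \<in> A (r *\<^sub>R x)" if r: "r > 0" and lA: "l \<in> A x" for x r l
  proof -
    obtain m c where l: "l = norm \<phi> * m - blinfun_apply \<phi> c" "fst x + c \<le> m *\<^sub>R e" "snd x - c \<le> m *\<^sub>R e"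
      using lA unfolding A_def by blast
    have "r *\<^sub>R (fst x + c) \<le> r *\<^sub>R (m *\<^sub>R e)" "r *\<^sub>R (snd x - c) \<le> r *\<^sub>R (m *\<^sub>R e)"
      using l r scaleR_left_mono[of _ _ r] by (metis less_imp_le)+
    then have "norm \<phi> * (r * m) - blinfun_apply \<phi> (r *\<^sub>R c) \<in> A (r *\<^sub>R x)"
      by (intro AI) (auto simp: algebra_simps)
    moreover have "r * l = norm \<phi> * (r * m) - blinfun_apply \<phi> (r *\<^sub>R c)"
      by (simp add: l(1) algebra_simps blinfun.bilinear_simps)
    ultimately show ?thesis by simp
  qed
  obtain F where F0: "linear_functional_on UNIV F" "\<And>x l. x \<in> UNIV \<Longrightarrow> l \<in> A x \<Longrightarrow> F x \<le> l" "F 0 = Inf (A 0)"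
    by (rule hahn_banach_Inf[OF subspace_UNIV UNIV_I[of 0] ne bdd add scale]; blast)
  then have F: "linear F" by (simp add: linear_functional_on_UNIV)
  have Fle: "F (a, b) \<le> norm \<phi> * l - blinfun_apply \<phi> c" if "a + c \<le> l *\<^sub>R e" "b - c \<le> l *\<^sub>R e" for a b l c
    using that by (intro F0(2) AI) auto
  have F0: "F (a, b) \<le> 0" if "a \<le> 0" "b \<le> 0" for a b
    using Fle[of a 0 0 b] that by (simp add: blinfun.zero_right)
  define f1 where "f1 a = F (a, 0)" for a
  define f2 where "f2 a = F (0, a)" for a
  have lin1: "linear f1"
    using linear_add[OF F, of "(a, 0)" "(b, 0)" for a b] linear_scale[OF F, of r "(b, 0)" for r b]
    by (intro linearI) (simp_all add: f1_def)
  have lin2: "linear f2"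
    using linear_add[OF F, of "(0, a)" "(0, b)" for a b] linear_scale[OF F, of r "(0, b)" for r b]
    by (intro linearI) (simp_all add: f2_def)
  have pos1: "0 \<le> f1 a" if "0 \<le> a" for a
    using F0[of "- a" 0] that linear_neg[OF lin1, of a] by (simp add: f1_def)
  have pos2: "0 \<le> f2 a" if "0 \<le> a" for a
    using F0[of 0 "- a"] that linear_neg[OF lin2, of a] by (simp add: f2_def)
  have Fsplit: "F (a, b) = f1 a + f2 b" for a b
    using linear_add[OF F, of "(a, 0)" "(0, b)"] by (simp add: f1_def f2_def)
  have le: "f1 a - f2 a \<le> blinfun_apply \<phi> a" for a
    using Fle[of a "- a" 0 "- a"] Fsplit[of a "- a"] linear_neg[OF lin2, of a]
    by (simp add: blinfun.bilinear_simps)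
  have eq: "f1 a - f2 a = blinfun_apply \<phi> a" for a
    using le[of a] le[of "- a"] linear_neg[OF lin1, of a] linear_neg[OF lin2, of a]
    by (simp add: blinfun.bilinear_simps)
  have bl: "bounded_linear f1" "bounded_linear f2"
    using positive_bounded_linear lin1 lin2 pos1 pos2 by blast+
  show thesis
  proof (rule that[of "Blinfun f1" "Blinfun f2"])
    show "Blinfun f1 \<in> dual_cone" "Blinfun f2 \<in> dual_cone"
      using pos1 pos2 by (auto simp: dual_cone_def bounded_linear_Blinfun_apply bl)
    show "\<phi> = Blinfun f1 - Blinfun f2"
      by (rule blinfun_eqI) (simp add: blinfun.bilinear_simps bounded_linear_Blinfun_apply bl eq)
    have "F (e, e) \<le> norm \<phi>"
      using Fle[of e 0 1 e] by (simp add: blinfun.zero_right)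
    then show "blinfun_apply (Blinfun f1) e + blinfun_apply (Blinfun f2) e \<le> norm \<phi>"
      by (simp add: bounded_linear_Blinfun_apply bl Fsplit)
  qed
qed

end

section \<open>The predual as a space of functionals on \<open>E\<close>\<close>

locale order_unit_predual = order_unit_banach e
  for e :: "'a::{banach, ordered_real_vector}" +
  fixes T :: "('p::banach \<Rightarrow>\<^sub>L real) \<Rightarrow> 'a"
  assumes iso: "isometric_isomorphism T"
begin

definition pre :: "'a \<Rightarrow> 'p \<Rightarrow>\<^sub>L real" where
  "pre = inv T"

text \<open>The canonical embedding of the predual into the dual of \<open>E\<close>, with
  \<open>E\<close> identified through \<open>T\<close> with the dual of the predual.\<close>

definition normal :: "'p \<Rightarrow> 'a \<Rightarrow>\<^sub>L real" where
  "normal x = Blinfun (\<lambda>a. blinfun_apply (pre a) x)"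

lemma T_pre: "T (pre a) = a" and pre_T: "pre (T \<psi>) = \<psi>"
  using iso unfolding isometric_isomorphism_def pre_def
  by (auto simp: bij_is_surj surj_f_inv_f bij_is_inj)

lemma linear_T: "linear T" and norm_T: "norm (T \<psi>) = norm \<psi>"
  using iso by (auto simp: isometric_isomorphism_def)

lemma norm_pre: "norm (pre a) = norm a"
  using norm_T[of "pre a"] by (simp add: T_pre)

lemma linear_pre: "linear pre"
proof (rule linearI)
  fix a b :: 'a and r :: real
  show "pre (a + b) = pre a + pre b" "pre (r *\<^sub>R a) = r *\<^sub>R pre a"
    using linear_add[OF linear_T, of "pre a" "pre b"] linear_scale[OF linear_T, of r "pre a"] pre_T T_pre by metis+
qed

lemma normal_apply: "blinfun_apply (normal x) a = blinfun_apply (pre a) x"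
proof -
  have "bounded_linear (\<lambda>a. blinfun_apply (pre a) x)"
  proof (intro bounded_linear.intro bounded_linear_axioms.intro exI[of _ "norm x"] allI)
    show "linear (\<lambda>a. blinfun_apply (pre a) x)"
      by (rule linearI) (simp_all add: linear_add[OF linear_pre] linear_scale[OF linear_pre] blinfun.bilinear_simps)
    show "norm (blinfun_apply (pre a) x) \<le> norm a * norm x" for a
      using norm_blinfun[of "pre a" x] by (simp add: norm_pre)
  qed
  then show ?thesis by (simp add: normal_def bounded_linear_Blinfun_apply)
qed

lemma norm_normal_le: "norm (normal x) \<le> norm x"
proof (rule norm_blinfun_bound)
  show "norm (blinfun_apply (normal x) a) \<le> norm x * norm a" for a
    using norm_blinfun[of "pre a" x] by (simp add: normal_apply norm_pre mult.commute)
qed simp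

lemma linear_normal: "linear normal"
  by (rule linearI; rule blinfun_eqI) (simp_all add: normal_apply blinfun.bilinear_simps)

lemma norm_le_normal:
  assumes "\<And>x. \<bar>blinfun_apply (normal x) a\<bar> \<le> r * norm x" "0 \<le> r"
  shows "norm a \<le> r"
  unfolding norm_pre[symmetric] using assms by (intro norm_blinfun_bound) (auto simp: normal_apply)

lemma normal_sep: "(\<And>x. blinfun_apply (normal x) a = blinfun_apply (normal x) b) \<Longrightarrow> a = b"
  by (metis T_pre blinfun_eqI normal_apply)

text \<open>A functional on \<open>N\<close> restricts to the predual and so names an element of \<open>E\<close>; positivity
  survives because \<open>0 \<le> d\<close> is a norm condition, \<open>norm (l *\<^sub>R e - d) \<le> l\<close>.\<close>

lemma nonneg_of_positive_functional:
  assumes N: "subspace N" "range normal \<subseteq> N"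
    and jordan: "\<And>x. \<exists>f1\<in>N \<inter> dual_cone. \<exists>f2\<in>N \<inter> dual_cone. normal x = f1 - f2 \<and> blinfun_apply f1 e + blinfun_apply f2 e \<le> norm x"
    and G: "linear_functional_on N G" "\<And>f. f \<in> N \<inter> dual_cone \<Longrightarrow> 0 \<le> G f"
      "\<And>f. f \<in> N \<inter> dual_cone \<Longrightarrow> G f \<le> l * blinfun_apply f e"
    and d: "\<And>x. blinfun_apply (normal x) d = G (normal x)" and l: "0 \<le> l"
  shows "0 \<le> d"
proof -
  have "norm (l *\<^sub>R e - d) \<le> l"
  proof (rule norm_le_normal[OF _ l])
    fix x
    obtain f1 f2 where f: "f1 \<in> N \<inter> dual_cone" "f2 \<in> N \<inter> dual_cone" "normal x = f1 - f2"
      "blinfun_apply f1 e + blinfun_apply f2 e \<le> norm x" using jordan by blast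
    have "G (f1 + - f2) = G f1 + G (- f2)" "G (-1 *\<^sub>R f2) = -1 * G f2"
      using G(1) f N(1) unfolding linear_functional_on_def by (blast intro: subspace_neg)+
    then have "G (normal x) = G f1 - G f2" using f(3) by simp
    \<comment> \<open>Each bracket lies between 0 and \<open>l\<close> times the mass of
      \<open>f1\<close> or \<open>f2\<close>, and so their difference is at most
      \<open>l * norm x\<close> in absolute value.\<close>
    then have "blinfun_apply (normal x) (l *\<^sub>R e - d) =
        (l * blinfun_apply f1 e - G f1) - (l * blinfun_apply f2 e - G f2)"
    proof -
      have "blinfun_apply (normal x) e = blinfun_apply f1 e - blinfun_apply f2 e"
        using f(3) by (simp add: blinfun.bilinear_simps)
      then show ?thesis
        using d[of x] \<open>G (normal x) = G f1 - G f2\<close>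
        by (simp add: blinfun.diff_right blinfun.scaleR_right right_diff_distrib)
    qed
    moreover have "l * blinfun_apply f1 e - G f1 \<ge> 0" "l * blinfun_apply f2 e - G f2 \<ge> 0" "G f1 \<ge> 0" "G f2 \<ge> 0"
      using G(2,3) f(1,2) by auto
    moreover have "l * (blinfun_apply f1 e + blinfun_apply f2 e) \<le> l * norm x"
      using f(4) l by (intro mult_left_mono)
    ultimately show "\<bar>blinfun_apply (normal x) (l *\<^sub>R e - d)\<bar> \<le> l * norm x"
      by (simp add: abs_le_iff distrib_left)
  qed
  then have "l *\<^sub>R e - d \<le> l *\<^sub>R e" by (rule norm_leD)
  then show ?thesis by simp
qed

text \<open>Riesz-Kantorovich on \<open>N\<close> for evaluation at \<open>a\<close> yields
  \<open>H\<close>; the Jordan bound makes its restriction to the predual bounded, hence given by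
  some \<open>c\<close> in \<open>E\<close>. As \<open>c\<close> represents \<open>H\<close> only on
  normal functionals, each of \<open>0 \<le> c\<close>, \<open>a \<le> c\<close> and
  \<open>c \<le> u\<close> is proved by \<open>nonneg_of_positive_functional\<close>.\<close>

lemma positive_parts_from_dual_subspace:
  assumes N: "subspace N" "range normal \<subseteq> N"
    and parts: "positive_parts N (N \<inter> dual_cone)"
    and jordan: "\<And>x. \<exists>f1\<in>N \<inter> dual_cone. \<exists>f2\<in>N \<inter> dual_cone. normal x = f1 - f2 \<and> blinfun_apply f1 e + blinfun_apply f2 e \<le> norm x"
  shows "positive_parts UNIV (pos_cone :: 'a set)"
  unfolding positive_parts_def
proof
  fix a :: 'a
  let ?C = "N \<inter> dual_cone"
  let ?F = "\<lambda>f. blinfun_apply f a"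
  have linF: "linear_functional_on N (\<lambda>f. blinfun_apply f b)" for b
    by (simp add: linear_functional_on_def blinfun.bilinear_simps)
  have bound: "?F g \<le> norm a * blinfun_apply f e" if "g \<in> dual_cone" "f - g \<in> dual_cone" for f g
  proof -
    have "?F g \<le> norm a * blinfun_apply g e" using dual_cone_bound[OF that(1), of a] by simp
    also have "\<dots> \<le> norm a * blinfun_apply f e"
      using that(2) e_nonneg by (intro mult_left_mono) (auto simp: dual_cone_def blinfun.bilinear_simps)
    finally show ?thesis .
  qed
  have bdd: "bdd_above (?F ` {g \<in> ?C. f - g \<in> ?C})" for f
    using bound by (intro bdd_aboveI2[of _ _ "norm a * blinfun_apply f e"]) auto
  obtain H where H: "linear_functional_on N H" "\<And>f. f \<in> ?C \<Longrightarrow> 0 \<le> H f" "\<And>f. f \<in> ?C \<Longrightarrow> ?F f \<le> H f"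
    "\<And>G f. linear_functional_on N G \<Longrightarrow> (\<And>f. f \<in> ?C \<Longrightarrow> 0 \<le> G f) \<Longrightarrow>
        (\<And>f. f \<in> ?C \<Longrightarrow> ?F f \<le> G f) \<Longrightarrow> f \<in> ?C \<Longrightarrow> H f \<le> G f"
    by (rule riesz_kantorovich[OF N(1) _ _ _ parts linF bdd])
      (use N(1) in \<open>auto intro: subspace_add subspace_scale dual_cone_add dual_cone_scale\<close>)
  have Hle: "H f \<le> norm a * blinfun_apply f e" if "f \<in> ?C" for f
  proof -
    have "H f \<le> blinfun_apply f (norm a *\<^sub>R e)"
      using that
    proof (rule H(4)[OF linF, rotated 2])
      fix g assume g: "g \<in> ?C"
      then show "0 \<le> blinfun_apply g (norm a *\<^sub>R e)" using e_nonneg by (simp add: dual_cone_def scaleR_nonneg_nonneg)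
      show "?F g \<le> blinfun_apply g (norm a *\<^sub>R e)"
        using dual_cone_bound[of g a] g by (simp add: blinfun.bilinear_simps)
    qed
    then show ?thesis by (simp add: blinfun.bilinear_simps)
  qed
  have Hadd: "H (f + g) = H f + H g" if "f \<in> N" "g \<in> N" for f g
    using H(1) that by (auto simp: linear_functional_on_def)
  have Hscale: "H (r *\<^sub>R f) = r * H f" if "f \<in> N" for f r
    using H(1) that by (auto simp: linear_functional_on_def)
  have nN: "normal x \<in> N" for x using N(2) by auto
  define h where "h x = H (normal x)" for x
  have "bounded_linear h"
  proof (intro bounded_linear.intro bounded_linear_axioms.intro exI[of _ "norm a"] allI)
    show "linear h"
      unfolding h_def using linear_add[OF linear_normal] linear_scale[OF linear_normal] nN
      by (intro linearI) (simp_all add: Hadd Hscale)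
    fix x
    obtain f1 f2 where f: "f1 \<in> ?C" "f2 \<in> ?C" "normal x = f1 - f2"
      "blinfun_apply f1 e + blinfun_apply f2 e \<le> norm x" using jordan by blast
    have "H (f1 + -1 *\<^sub>R f2) = H f1 - H f2"
      using Hadd[of f1 "-1 *\<^sub>R f2"] Hscale[of f2 "-1"] f subspace_neg[OF N(1), of f2] by simp
    then have "h x = H f1 - H f2" using f(3) by (simp add: h_def)
    moreover have "norm a * (blinfun_apply f1 e + blinfun_apply f2 e) \<le> norm a * norm x"
      using f(4) by (intro mult_left_mono) auto
    ultimately show "norm (h x) \<le> norm x * norm a"
      using H(2)[OF f(1)] H(2)[OF f(2)] Hle[OF f(1)] Hle[OF f(2)] by (simp add: abs_le_iff distrib_left mult.commute)
  qed
  define c where "c = T (Blinfun h)"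
  have c: "blinfun_apply (normal x) c = H (normal x)" for x
    using \<open>bounded_linear h\<close> by (simp add: c_def normal_apply pre_T bounded_linear_Blinfun_apply h_def)
  have linsub: "linear_functional_on N (\<lambda>f. G1 f - G2 f)"
    if "linear_functional_on N G1" "linear_functional_on N G2" for G1 G2
    using that by (simp add: linear_functional_on_def algebra_simps)
  have e0: "0 \<le> blinfun_apply f e" if "f \<in> ?C" for f using that e_nonneg by (simp add: dual_cone_def)
  have low: "- (norm b * blinfun_apply f e) \<le> blinfun_apply f b" "blinfun_apply f b \<le> norm b * blinfun_apply f e" if "f \<in> ?C" for f b
    using dual_cone_bound[of f b] that by auto
  have c0: "0 \<le> c"
    using H(1,2) Hle c by (intro nonneg_of_positive_functional[OF N jordan]) auto
  have ca: "0 \<le> c - a"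
  proof (rule nonneg_of_positive_functional[OF N jordan linsub[OF H(1) linF[of a]], where l = "2 * norm a"])
    fix f assume f: "f \<in> ?C"
    show "0 \<le> H f - ?F f" using H(3)[OF f] by simp
    show "H f - ?F f \<le> 2 * norm a * blinfun_apply f e" using Hle[OF f] low(1)[OF f, of a] by simp
  qed (auto simp: c blinfun.bilinear_simps)
  have least: "0 \<le> u - c" if u: "0 \<le> u" "0 \<le> u - a" for u
  proof (rule nonneg_of_positive_functional[OF N jordan linsub[OF linF[of u] H(1)], where l = "norm u"])
    fix f assume f: "f \<in> ?C"
    have "H f \<le> blinfun_apply f u"
    proof (rule H(4)[OF linF _ _ f])
      fix g assume "g \<in> ?C"
      then have "0 \<le> blinfun_apply g u" "0 \<le> blinfun_apply g (u - a)" using u by (auto simp: dual_cone_def)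
      then show "0 \<le> blinfun_apply g u" "?F g \<le> blinfun_apply g u" by (auto simp: blinfun.bilinear_simps)
    qed
    then show "0 \<le> blinfun_apply f u - H f" by simp
    show "blinfun_apply f u - H f \<le> norm u * blinfun_apply f e" using H(2)[OF f] low(2)[OF f, of u] by simp
  qed (auto simp: c blinfun.bilinear_simps)
  show "\<exists>p\<in>pos_cone. p - a \<in> pos_cone \<and> (\<forall>u\<in>pos_cone. u - a \<in> pos_cone \<longrightarrow> u - p \<in> pos_cone)"
    using c0 ca least by (intro bexI[of _ c]) auto
qed

lemma positive_parts_if_dual:
  assumes "positive_parts UNIV (dual_cone :: ('a \<Rightarrow>\<^sub>L real) set)"
  shows "positive_parts UNIV (pos_cone :: 'a set)"
proof (rule positive_parts_from_dual_subspace[of UNIV])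
  fix x
  show "\<exists>f1\<in>UNIV \<inter> dual_cone. \<exists>f2\<in>UNIV \<inter> dual_cone. normal x = f1 - f2 \<and> blinfun_apply f1 e + blinfun_apply f2 e \<le> norm x"
  proof -
    obtain f1 f2 where f: "f1 \<in> dual_cone" "f2 \<in> dual_cone" "normal x = f1 - f2"
      "blinfun_apply f1 e + blinfun_apply f2 e \<le> norm (normal x)"
      by (rule jordan_decomposition)
    then have "blinfun_apply f1 e + blinfun_apply f2 e \<le> norm x" using norm_normal_le[of x] by linarith
    then show ?thesis using f by blast
  qed
qed (use assms in auto)

text \<open>The weak* topology that \<open>E\<close> carries as the dual of its predual, as opposed
  to the topology on the dual of \<open>E\<close>.\<close>

definition pre_topology :: "'a topology" where
  "pre_topology = pullback_topology UNIV pre weak_star_topology"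

lemma topspace_pre_topology [simp]: "topspace pre_topology = UNIV"
  by (simp add: pre_topology_def topspace_pullback_topology strong_operator_topology_topspace)

lemma continuous_normal: "continuous_map pre_topology euclideanreal (blinfun_apply (normal x))"
proof -
  have "continuous_map pre_topology euclideanreal ((\<lambda>\<psi>. blinfun_apply \<psi> x) \<circ> pre)"
    unfolding pre_topology_def
    by (intro continuous_map_pullback strong_operator_topology_continuous_evaluation)
  moreover have "blinfun_apply (normal x) = (\<lambda>\<psi>. blinfun_apply \<psi> x) \<circ> pre"
    by (simp add: fun_eq_iff normal_apply)
  ultimately show ?thesis by simp
qed

text \<open>In an order-unit space the order interval from 0 to \<open>e\<close> is a norm ball,
  centred at half the unit; this is how Banach-Alaoglu makes the set of effects compact.\<close>

lemma effect_iff: "a \<in> {0..e} \<longleftrightarrow> norm (a - (1/2) *\<^sub>R e) \<le> 1/2"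
proof -
  have half: "(1/2) *\<^sub>R e + (1/2) *\<^sub>R e = e" by (simp flip: scaleR_add_left)
  have e2: "e - (1/2) *\<^sub>R e = (1/2) *\<^sub>R e" using half by (simp add: algebra_simps)
  show ?thesis
  proof
    assume a: "a \<in> {0..e}"
    show "norm (a - (1/2) *\<^sub>R e) \<le> 1/2"
    proof (rule norm_leI)
      show "a - (1/2) *\<^sub>R e \<le> (1/2) *\<^sub>R e" using a by (simp only: diff_le_eq half) simp
    qed (use a in auto)
  next
    assume "norm (a - (1/2) *\<^sub>R e) \<le> 1/2"
    then have "a - (1/2) *\<^sub>R e \<le> (1/2) *\<^sub>R e" "- ((1/2) *\<^sub>R e) \<le> a - (1/2) *\<^sub>R e"
      by (rule norm_leD)+
    then show "a \<in> {0..e}" by (simp only: diff_le_eq half atLeastAtMost_iff) simp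
  qed
qed

lemma compact_effects: "compactin pre_topology {0..e}"
proof -
  let ?g = "\<lambda>\<psi>. T \<psi> + (1/2) *\<^sub>R e"
  have "continuous_map weak_star_topology pre_topology ?g"
    unfolding pre_topology_def
  proof (rule continuous_map_pullback')
    have "continuous_map weak_star_topology euclideanreal (\<lambda>\<psi>. blinfun_apply \<psi> x + blinfun_apply (pre ((1/2) *\<^sub>R e)) x)" for x
      by (intro continuous_map_add strong_operator_topology_continuous_evaluation) auto
    then show "continuous_map weak_star_topology weak_star_topology (pre \<circ> ?g)"
      unfolding continuous_on_strong_operator_topo_iff_coordinatewise
      by (simp add: linear_add[OF linear_pre] pre_T blinfun.bilinear_simps)
  qed auto
  from image_compactin[OF banach_alaoglu[of "1/2"] this]
  have "compactin pre_topology (?g ` {\<psi>. norm \<psi> \<le> 1/2})" .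
  moreover have "?g ` {\<psi>. norm \<psi> \<le> 1/2} = {0..e}"
  proof (intro set_eqI iffI)
    fix a assume "a \<in> ?g ` {\<psi>. norm \<psi> \<le> 1/2}"
    then show "a \<in> {0..e}" unfolding effect_iff by (auto simp: norm_T)
  next
    fix a assume "a \<in> {0..e}"
    then have "norm (pre (a - (1/2) *\<^sub>R e)) \<le> 1/2" unfolding effect_iff by (simp add: norm_pre)
    moreover have "a = ?g (pre (a - (1/2) *\<^sub>R e))" by (simp add: T_pre)
    ultimately show "a \<in> ?g ` {\<psi>. norm \<psi> \<le> 1/2}" by blast
  qed
  ultimately show ?thesis by simp
qed

lemma convex_effects: "convex {0..e}"
  unfolding convex_alt
proof (intro ballI allI impI)
  fix a b :: 'a and u :: real assume ab: "a \<in> {0..e}" "b \<in> {0..e}" and u: "0 \<le> u \<and> u \<le> 1"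
  have "(1 - u) *\<^sub>R a + u *\<^sub>R b \<le> (1 - u) *\<^sub>R e + u *\<^sub>R e"
    using ab u by (intro add_mono scaleR_left_mono) auto
  also have "\<dots> = e" by (simp flip: scaleR_add_left)
  finally show "(1 - u) *\<^sub>R a + u *\<^sub>R b \<in> {0..e}"
    using ab u by (auto intro!: add_nonneg_nonneg scaleR_nonneg_nonneg)
qed

end

section \<open>Splitting along an extreme effect\<close>

context order_unit_predual
begin

text \<open>\<open>c\<close> lies in the span of the interval below \<open>p\<close>, and
  \<open>b - c\<close> in the span of the interval below \<open>e - p\<close>. Allowing an arbitrary
  multiple \<open>r\<close> makes the relation linear in the pair \<open>b\<close>,
  \<open>c\<close>.\<close>

definition central_split :: "'a \<Rightarrow> 'a \<Rightarrow> 'a \<Rightarrow> bool" where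
  "central_split p b c \<longleftrightarrow> (\<exists>r>0. - (r *\<^sub>R p) \<le> c \<and> c \<le> r *\<^sub>R p \<and> - (r *\<^sub>R (e - p)) \<le> b - c \<and> b - c \<le> r *\<^sub>R (e - p))"

lemma interval_scaleR_mono:
  assumes "- (r *\<^sub>R p) \<le> c" "c \<le> r *\<^sub>R p" "r \<le> s" "0 \<le> (p :: 'a)"
  shows "- (s *\<^sub>R p) \<le> c" "c \<le> s *\<^sub>R p"
proof -
  have *: "r *\<^sub>R p \<le> s *\<^sub>R p" using assms by (intro scaleR_right_mono)
  show "c \<le> s *\<^sub>R p" using assms(2) * by (rule order_trans)
  have "- (s *\<^sub>R p) \<le> - (r *\<^sub>R p)" using * by simp
  then show "- (s *\<^sub>R p) \<le> c" using assms(1) by (rule order_trans)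
qed

lemma interval_add:
  assumes "- (r *\<^sub>R p) \<le> c" "c \<le> r *\<^sub>R p" "- (s *\<^sub>R p) \<le> d" "d \<le> s *\<^sub>R (p :: 'a)"
  shows "- ((r + s) *\<^sub>R p) \<le> c + d" "c + d \<le> (r + s) *\<^sub>R p"
  using add_mono[OF assms(1,3)] add_mono[OF assms(2,4)] by (simp_all add: scaleR_add_left)

lemma interval_scale:
  assumes "- (r *\<^sub>R p) \<le> c" "c \<le> r *\<^sub>R (p :: 'a)"
  shows "- ((\<bar>t\<bar> * r) *\<^sub>R p) \<le> t *\<^sub>R c" "t *\<^sub>R c \<le> (\<bar>t\<bar> * r) *\<^sub>R p"
proof -
  have "- ((\<bar>t\<bar> * r) *\<^sub>R p) \<le> t *\<^sub>R c \<and> t *\<^sub>R c \<le> (\<bar>t\<bar> * r) *\<^sub>R p"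
  proof (cases "t \<ge> 0")
    case True
    then show ?thesis
      using scaleR_left_mono[OF assms(1) True] scaleR_left_mono[OF assms(2) True] by simp
  next
    case False
    then have t: "- t \<ge> 0" by simp
    have 1: "- ((- t * r) *\<^sub>R p) \<le> - (t *\<^sub>R c)" "- (t *\<^sub>R c) \<le> (- t * r) *\<^sub>R p"
      using scaleR_left_mono[OF assms(1) t] scaleR_left_mono[OF assms(2) t] by simp_all
    then have "- ((- t * r) *\<^sub>R p) \<le> t *\<^sub>R c" "t *\<^sub>R c \<le> (- t * r) *\<^sub>R p"
      by (metis minus_le_iff, metis neg_le_iff_le)
    then show ?thesis using False by simp
  qed
  then show "- ((\<bar>t\<bar> * r) *\<^sub>R p) \<le> t *\<^sub>R c" "t *\<^sub>R c \<le> (\<bar>t\<bar> * r) *\<^sub>R p" by auto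
qed

lemma central_split_add:
  assumes "central_split p b c" "central_split p b' c'"
  shows "central_split p (b + b') (c + c')"
proof -
  obtain r where r: "r > 0" "- (r *\<^sub>R p) \<le> c" "c \<le> r *\<^sub>R p" "- (r *\<^sub>R (e - p)) \<le> b - c" "b - c \<le> r *\<^sub>R (e - p)"
    using assms(1) unfolding central_split_def by blast
  obtain s where s: "s > 0" "- (s *\<^sub>R p) \<le> c'" "c' \<le> s *\<^sub>R p" "- (s *\<^sub>R (e - p)) \<le> b' - c'" "b' - c' \<le> s *\<^sub>R (e - p)"
    using assms(2) unfolding central_split_def by blast
  have "b + b' - (c + c') = (b - c) + (b' - c')" by simp
  then show ?thesis
    unfolding central_split_def
    using r(1) s(1) interval_add[OF r(2,3) s(2,3)] interval_add[OF r(4,5) s(4,5)]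
    by (intro exI[of _ "r + s"]) (simp only:, simp)
qed

lemma central_split_scale:
  assumes "central_split p b c" "p \<in> {0..e}"
  shows "central_split p (t *\<^sub>R b) (t *\<^sub>R c)"
proof -
  have p: "0 \<le> p" "0 \<le> e - p" using assms(2) by auto
  obtain r where r: "r > 0" "- (r *\<^sub>R p) \<le> c" "c \<le> r *\<^sub>R p" "- (r *\<^sub>R (e - p)) \<le> b - c" "b - c \<le> r *\<^sub>R (e - p)"
    using assms(1) unfolding central_split_def by blast
  have le: "\<bar>t\<bar> * r \<le> \<bar>t\<bar> * r + 1" by simp
  have "t *\<^sub>R b - t *\<^sub>R c = t *\<^sub>R (b - c)" by (simp add: algebra_simps)
  moreover have "\<bar>t\<bar> * r + 1 > 0" using r(1) by (simp add: add_nonneg_pos)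
  ultimately show ?thesis
    unfolding central_split_def
    using interval_scaleR_mono[OF interval_scale[OF r(2,3), of t] le p(1)]
      interval_scaleR_mono[OF interval_scale[OF r(4,5), of t] le p(2)]
    by (intro exI[of _ "\<bar>t\<bar> * r + 1"]) auto
qed

lemma extreme_effect_sharp:
  assumes p: "p extreme_point_of {0..e}" and d: "p + d \<in> {0..e}" "p - d \<in> {0..e}"
  shows "d = 0"
proof (rule ccontr)
  assume "d \<noteq> 0"
  have "p - d \<noteq> p + d"
  proof
    assume "p - d = p + d"
    then have "- d + d = d + d" by simp
    then have "2 *\<^sub>R d = 0" by (simp add: scaleR_2)
    then show False using \<open>d \<noteq> 0\<close> by simp
  qed
  moreover have "p = (1 - 1/2) *\<^sub>R (p - d) + (1/2) *\<^sub>R (p + d)"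
  proof -
    have "(1 - 1/2) *\<^sub>R (p - d) + (1/2) *\<^sub>R (p + d) = (1/2) *\<^sub>R ((p - d) + (p + d))"
      unfolding scaleR_add_right by simp
    also have "(p - d) + (p + d) = 2 *\<^sub>R p" by (simp add: scaleR_2)
    finally show ?thesis by simp
  qed
  ultimately have "p \<in> open_segment (p - d) (p + d)"
    unfolding in_segment by (intro conjI exI[of _ "1/2"]) auto
  then show False using p d unfolding extreme_point_of_def by blast
qed

text \<open>The difference of two splittings, scaled to \<open>d\<close>, satisfies
  \<open>\<plusminus> d \<le> p\<close> and \<open>\<plusminus> d \<le> e - p\<close>, so
  \<open>p + d\<close> and \<open>p - d\<close> are effects with midpoint \<open>p\<close>, and
  extremality gives \<open>d = 0\<close>.\<close>

lemma central_split_unique: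
  assumes p: "p extreme_point_of {0..e}" and c: "central_split p b c" "central_split p b c'"
  shows "c = c'"
proof -
  have pe: "p \<in> {0..e}" using p by (simp add: extreme_point_of_def)
  then have p0: "0 \<le> p" "0 \<le> e - p" by auto
  have "central_split p (b + (-1) *\<^sub>R b) (c + (-1) *\<^sub>R c')"
    by (intro central_split_add central_split_scale c pe)
  then have "central_split p 0 (c - c')" by simp
  then obtain r where r: "r > 0" "- (r *\<^sub>R p) \<le> c - c'" "c - c' \<le> r *\<^sub>R p"
    "- (r *\<^sub>R (e - p)) \<le> 0 - (c - c')" "0 - (c - c') \<le> r *\<^sub>R (e - p)"
    unfolding central_split_def by blast
  define d where "d = (1 / r) *\<^sub>R (c - c')"
  have d1: "- p \<le> d" "d \<le> p"
    using interval_scale[OF r(2,3), of "1 / r"] r(1) by (simp_all add: d_def)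
  have "(1 / r) *\<^sub>R (0 - (c - c')) = - d" by (simp add: d_def algebra_simps)
  then have d2: "- (e - p) \<le> - d" "- d \<le> e - p"
    using interval_scale[OF r(4,5), of "1 / r"] r(1) by simp_all
  have "d = 0"
  proof (rule extreme_effect_sharp[OF p])
    show "p + d \<in> {0..e}" using d1 d2 add_left_mono[OF d1(1), of p] by (simp add: algebra_simps)
    show "p - d \<in> {0..e}" using d1 d2 by (simp add: algebra_simps)
  qed
  then show ?thesis using r(1) by (simp add: d_def)
qed

lemma convex_on_blinfun: "convex A \<Longrightarrow> convex_on A (blinfun_apply (f :: 'a \<Rightarrow>\<^sub>L real))"
  by (simp add: convex_on_def blinfun.bilinear_simps)

lemma extreme_effect_maximizer:
  fixes f :: "'a \<Rightarrow>\<^sub>L real"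
  assumes "continuous_map (subtopology pre_topology {0..e}) euclideanreal (blinfun_apply f)"
  obtains p where "p extreme_point_of {0..e}" "\<And>b. b \<in> {0..e} \<Longrightarrow> blinfun_apply f b \<le> blinfun_apply f p"
proof (rule bauer_maximum_principle[OF compact_effects, of "range (\<lambda>x. blinfun_apply (normal x))" "blinfun_apply f"])
  show "{0..e} \<noteq> {}" using e_nonneg by auto
  show "linear l" if "l \<in> range (\<lambda>x. blinfun_apply (normal x))" for l
    using that by (auto intro: bounded_linear.linear blinfun.bounded_linear_right)
  show "continuous_map (subtopology pre_topology {0..e}) euclideanreal l" if "l \<in> range (\<lambda>x. blinfun_apply (normal x))" for l
    using that continuous_normal by (auto intro: continuous_map_from_subtopology)
  show "x = y" if "\<And>l. l \<in> range (\<lambda>x. blinfun_apply (normal x)) \<Longrightarrow> l x = l y" for x y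
    using that by (intro normal_sep) auto
  show "convex_on {0..e} (blinfun_apply f)" by (rule convex_on_blinfun[OF convex_effects])
qed (use assms that in auto)

end

section \<open>Positive projections obtained from compatibility\<close>

locale compatible_predual = order_unit_predual e T
  for e :: "'a::{banach, ordered_real_vector}" and T :: "('p::banach \<Rightarrow>\<^sub>L real) \<Rightarrow> 'a" +
  assumes compat: "\<And>a b. measurement e 2 a \<Longrightarrow> measurement e 2 b \<Longrightarrow> compatible 2 2 a b"
begin

lemma split_effect:
  assumes p: "p \<in> {0..e}" and b: "b \<in> {0..e}"
  obtains c where "0 \<le> c" "c \<le> p" "0 \<le> b - c" "b - c \<le> e - p"
proof -
  have two: "{1..2::nat} = {1, 2}" by auto
  define m where "m = (\<lambda>(a::'a) (j::nat). if j = 1 then a else e - a)"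
  have m: "measurement e 2 (m a)" if "a \<in> {0..e}" for a
    unfolding measurement_def two using that by (simp add: m_def)
  obtain c where c: "\<forall>j\<in>{1, 2}. \<forall>k\<in>{1, 2}. 0 \<le> c j k \<and> m p j = (\<Sum>k'\<in>{1, 2}. c j k') \<and> m b k = (\<Sum>j'\<in>{1, 2}. c j' k)"
    using compat[OF m[OF p] m[OF b]] unfolding compatible_def two by blast
  have "0 \<le> c 1 1" "0 \<le> c 1 2" "0 \<le> c 2 1" "0 \<le> c 2 2" "p = c 1 1 + c 1 2" "b = c 1 1 + c 2 1" "e - p = c 2 1 + c 2 2"
    using c by (auto simp: m_def)
  then show thesis by (intro that[of "c 1 1"]) auto
qed

context
  fixes p assumes p: "p extreme_point_of {0..e}"
begin

lemma p_effect: "p \<in> {0..e}"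
  using p by (simp add: extreme_point_of_def)

lemma effect_central_split:
  assumes "b \<in> {0..e}"
  shows "\<exists>c. central_split p b c \<and> 0 \<le> c \<and> c \<le> p \<and> 0 \<le> b - c \<and> b - c \<le> e - p"
proof -
  obtain c where c: "0 \<le> c" "c \<le> p" "0 \<le> b - c" "b - c \<le> e - p"
    using split_effect[OF p_effect assms] .
  have "- p \<le> c" "- (e - p) \<le> b - c"
    using c p_effect order_trans[of "- p" 0 c] order_trans[of "- (e - p)" 0 "b - c"] by auto
  then have "central_split p b c"
    unfolding central_split_def using c by (intro exI[of _ 1]) auto
  then show ?thesis using c by blast
qed

text \<open>The projection \<open>Q\<close>: compatibility with \<open>p\<close> provides a
  splitting, extremality of \<open>p\<close> makes it unique, and uniqueness makes it
  linear.\<close>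

definition proj :: "'a \<Rightarrow> 'a" where
  "proj b = (THE c. central_split p b c)"

lemma proj_eq: "central_split p b c \<Longrightarrow> proj b = c"
  unfolding proj_def using central_split_unique[OF p] by blast

lemma proj_effect:
  assumes "b \<in> {0..e}"
  shows "0 \<le> proj b" "proj b \<le> p" "0 \<le> b - proj b" "b - proj b \<le> e - p"
  using effect_central_split[OF assms] proj_eq by auto

lemma central_split_proj: "central_split p b (proj b)"
proof -
  define M where "M = norm b + 1"
  have M: "M > 0" by (simp add: M_def add_nonneg_pos)
  \<comment> \<open>\<open>b'\<close> is an affine image of \<open>b\<close> that is an effect, with
    \<open>b = 2 M b' - M e\<close>; linearity of the splitting relation carries the case of effects
    over to \<open>b\<close>.\<close>
  define b' where "b' = (1 / (2 * M)) *\<^sub>R (b + M *\<^sub>R e)"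
  have bM: "b \<le> M *\<^sub>R e" "- (M *\<^sub>R e) \<le> b" using norm_leD[of b M] by (auto simp: M_def)
  have "0 \<le> b + M *\<^sub>R e" using add_right_mono[OF bM(2), of "M *\<^sub>R e"] by simp
  moreover have "b' \<le> (1 / (2 * M)) *\<^sub>R (M *\<^sub>R e + M *\<^sub>R e)"
    unfolding b'_def using bM M by (intro scaleR_left_mono add_mono) auto
  moreover have "(1 / (2 * M)) *\<^sub>R (M *\<^sub>R e + M *\<^sub>R e) = e"
    using M by (simp flip: scaleR_add_left)
  ultimately have "b' \<in> {0..e}" using M by (auto simp: b'_def intro!: scaleR_nonneg_nonneg)
  moreover have "e \<in> {0..e}" using e_nonneg by simp
  ultimately obtain c d where "central_split p b' c" "central_split p e d"
    using effect_central_split by blast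
  then have "central_split p ((2 * M) *\<^sub>R b' + (- M) *\<^sub>R e) ((2 * M) *\<^sub>R c + (- M) *\<^sub>R d)"
    by (intro central_split_add central_split_scale p_effect)
  moreover have "(2 * M) *\<^sub>R b' + (- M) *\<^sub>R e = b" using M by (simp add: b'_def)
  ultimately show ?thesis using proj_eq by simp
qed

lemma linear_proj: "linear proj"
  by (rule linearI; rule proj_eq; intro central_split_add central_split_scale central_split_proj p_effect)

lemma proj_e: "proj e = p"
proof (rule proj_eq)
  have "0 \<le> p" "0 \<le> e - p" using p_effect by auto
  then show "central_split p e p"
    unfolding central_split_def using order_trans[of "- p" 0 p] order_trans[of "- (e - p)" 0 "e - p"]
    by (intro exI[of _ 1]) auto
qed

lemma proj_nonneg:
  assumes "0 \<le> b"
  shows "0 \<le> proj b"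
proof -
  obtain M where M: "M > 0" "0 \<le> (1 / M) *\<^sub>R b" "(1 / M) *\<^sub>R b \<le> e" using pos_coneD[OF assms] by blast
  have "0 \<le> M *\<^sub>R proj ((1 / M) *\<^sub>R b)"
    using proj_effect(1)[of "(1 / M) *\<^sub>R b"] M by (intro scaleR_nonneg_nonneg) auto
  then show ?thesis using M(1) linear_scale[OF linear_proj] by simp
qed

lemma norm_proj: "norm (proj b) \<le> norm b"
proof (rule norm_leI)
  have "0 \<le> proj (norm b *\<^sub>R e - b)" "0 \<le> proj (norm b *\<^sub>R e + b)"
    using le_norm[of b] norm_plus_nonneg[of b] by (auto intro!: proj_nonneg)
  then have 1: "proj b \<le> norm b *\<^sub>R p" "0 \<le> norm b *\<^sub>R p + proj b"
    by (simp_all add: linear_diff[OF linear_proj] linear_add[OF linear_proj] linear_scale[OF linear_proj] proj_e)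
  have 2: "norm b *\<^sub>R p \<le> norm b *\<^sub>R e" using p_effect by (intro scaleR_left_mono) auto
  show "proj b \<le> norm b *\<^sub>R e" using 1(1) 2 by (rule order_trans)
  have "0 \<le> norm b *\<^sub>R e + proj b" using 1(2) 2 by (meson add_right_mono order_trans)
  then have "0 - norm b *\<^sub>R e \<le> proj b" by (simp only: diff_le_eq add.commute)
  then show "- (norm b *\<^sub>R e) \<le> proj b" by simp
qed simp

lemma bounded_linear_proj: "bounded_linear proj"
  using linear_proj norm_proj by (intro bounded_linear.intro bounded_linear_axioms.intro exI[of _ 1]) auto

abbreviation effect_topology :: "'a topology" where
  "effect_topology \<equiv> subtopology pre_topology {0..e}"

text \<open>Given \<open>d \<le> 2 e\<close>, positivity of \<open>d\<close> is equivalent to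
  \<open>norm (e - d) \<le> 1\<close>, and a norm bound can be tested on normal functionals. Order
  constraints thus become closed conditions for \<open>pre_topology\<close>.\<close>

lemma nonneg_iff_normal:
  assumes "d \<le> 2 *\<^sub>R e"
  shows "0 \<le> d \<longleftrightarrow> (\<forall>x. \<bar>blinfun_apply (normal x) (e - d)\<bar> \<le> norm x)"
proof
  assume d: "0 \<le> d"
  have "norm (e - d) \<le> 1"
  proof (rule norm_leI)
    show "e - d \<le> 1 *\<^sub>R e" using d by simp
    show "- (1 *\<^sub>R e) \<le> e - d" using assms by (simp add: scaleR_2 algebra_simps)
  qed simp
  show "\<forall>x. \<bar>blinfun_apply (normal x) (e - d)\<bar> \<le> norm x"
  proof
    fix x
    have "norm (blinfun_apply (normal x) (e - d)) \<le> norm (normal x) * norm (e - d)" by (rule norm_blinfun)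
    also have "\<dots> \<le> norm x * 1" using norm_normal_le[of x] \<open>norm (e - d) \<le> 1\<close> by (intro mult_mono) auto
    finally show "\<bar>blinfun_apply (normal x) (e - d)\<bar> \<le> norm x" by simp
  qed
next
  assume "\<forall>x. \<bar>blinfun_apply (normal x) (e - d)\<bar> \<le> norm x"
  then have "norm (e - d) \<le> 1" by (intro norm_le_normal) auto
  then have "e - d \<le> 1 *\<^sub>R e" by (rule norm_leD)
  then show "0 \<le> d" by simp
qed

lemma closedin_normal_condition:
  assumes D: "\<And>z. z \<in> {0..e} \<times> {0..e} \<Longrightarrow> D z \<le> 2 *\<^sub>R e"
    and cont: "\<And>x. continuous_map (prod_topology effect_topology effect_topology) euclideanreal (\<lambda>z. blinfun_apply (normal x) (D z))"
  shows "closedin (prod_topology effect_topology effect_topology) {z \<in> {0..e} \<times> {0..e}. 0 \<le> D z}"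
proof -
  let ?P = "prod_topology effect_topology effect_topology"
  have top: "topspace ?P = {0..e} \<times> {0..e}" by auto
  have "closedin ?P {z \<in> topspace ?P. \<bar>blinfun_apply (normal x) (e - D z)\<bar> \<in> {..norm x}}" for x
    by (rule closedin_continuous_map_preimage[of _ euclideanreal])
      (auto simp: blinfun.diff_right intro!: continuous_intros cont)
  then have "closedin ?P (\<Inter>x. {z \<in> topspace ?P. \<bar>blinfun_apply (normal x) (e - D z)\<bar> \<in> {..norm x}})"
    by (intro closedin_INT) auto
  also have "(\<Inter>x. {z \<in> topspace ?P. \<bar>blinfun_apply (normal x) (e - D z)\<bar> \<in> {..norm x}}) = {z \<in> {0..e} \<times> {0..e}. 0 \<le> D z}"
    unfolding top using nonneg_iff_normal[OF D] by blast
  finally show ?thesis .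
qed

text \<open>The graph of \<open>proj\<close> on the effects is closed in a compact product.\<close>

lemma continuous_proj:
  assumes f: "continuous_map effect_topology euclideanreal f"
  shows "continuous_map effect_topology euclideanreal (\<lambda>b. f (proj b))"
  unfolding continuous_map_closedin
proof (intro conjI allI impI)
  let ?P = "prod_topology effect_topology effect_topology"
  let ?E = "{0..e} \<times> {0..e}"
  fix S :: "real set" assume "closedin euclideanreal S"
  have n1: "continuous_map ?P euclideanreal (\<lambda>z. blinfun_apply (normal x) (fst z))" for x
    using continuous_map_compose[OF continuous_map_fst[of effect_topology effect_topology]
      continuous_map_from_subtopology[OF continuous_normal[of x]]] by (simp add: o_def)
  have n2: "continuous_map ?P euclideanreal (\<lambda>z. blinfun_apply (normal x) (snd z))" for x
    using continuous_map_compose[OF continuous_map_snd[of effect_topology effect_topology]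
      continuous_map_from_subtopology[OF continuous_normal[of x]]] by (simp add: o_def)
  have e2: "e \<le> 2 *\<^sub>R e" using e_nonneg by (simp add: scaleR_2)
  have pE: "0 \<le> p" "p \<le> e" using p_effect by auto
  have cl1: "closedin ?P {z \<in> ?E. 0 \<le> p - snd z}"
  proof (rule closedin_normal_condition)
    show "p - snd z \<le> 2 *\<^sub>R e" if "z \<in> ?E" for z
      using that order_trans[OF _ e2, of "p - snd z"] order_trans[of "p - snd z" p e] pE by auto
  qed (auto simp: blinfun.diff_right intro!: continuous_intros n2)
  have cl2: "closedin ?P {z \<in> ?E. 0 \<le> fst z - snd z}"
  proof (rule closedin_normal_condition)
    show "fst z - snd z \<le> 2 *\<^sub>R e" if "z \<in> ?E" for z
      using that order_trans[OF _ e2, of "fst z - snd z"] order_trans[of "fst z - snd z" "fst z" e] by auto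
  qed (auto simp: blinfun.diff_right intro!: continuous_intros n1 n2)
  have cl3: "closedin ?P {z \<in> ?E. 0 \<le> e - p - (fst z - snd z)}"
  proof (rule closedin_normal_condition)
    show "e - p - (fst z - snd z) \<le> 2 *\<^sub>R e" if "z \<in> ?E" for z
    proof -
      have "e - p - fst z \<le> e" using that pE by (auto simp: diff_le_eq add_increasing2 intro: order_trans[of _ "e - p"])
      then have "e - p - fst z + snd z \<le> e + e" using that by (intro add_mono) auto
      then show ?thesis by (simp add: scaleR_2 algebra_simps)
    qed
  qed (auto simp: blinfun.diff_right intro!: continuous_intros n1 n2)
  have cl4: "closedin ?P {z \<in> topspace ?P. f (snd z) \<in> S}"
    using continuous_map_compose[OF continuous_map_snd[of effect_topology effect_topology] f] \<open>closedin euclideanreal S\<close>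
    by (intro closedin_continuous_map_preimage[of _ euclideanreal]) (auto simp: o_def)
  \<comment> \<open>The part of the graph of the projection on which \<open>f\<close> of the second
    coordinate lies in \<open>S\<close>. Its image under \<open>fst\<close>, a closed map because
    the second factor is compact, is the preimage in question.\<close>
  define G where "G = {z \<in> ?E. 0 \<le> p - snd z} \<inter> {z \<in> ?E. 0 \<le> fst z - snd z} \<inter>
      {z \<in> ?E. 0 \<le> e - p - (fst z - snd z)} \<inter> {z \<in> topspace ?P. f (snd z) \<in> S}"
  have "closedin ?P G" unfolding G_def using cl1 cl2 cl3 cl4 by (intro closedin_Int)
  moreover have "closed_map ?P effect_topology fst"
    using compact_effects by (intro closed_map_fst) (simp add: compact_space_subtopology)
  ultimately have "closedin effect_topology (fst ` G)" by (simp add: closed_map_def)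
  also have "fst ` G = {b \<in> topspace effect_topology. f (proj b) \<in> S}"
  proof (intro set_eqI iffI)
    fix b assume "b \<in> fst ` G"
    then obtain c where bc: "(b, c) \<in> G" by auto
    then have c: "b \<in> {0..e}" "0 \<le> c" "c \<le> p" "0 \<le> b - c" "b - c \<le> e - p" "f c \<in> S"
      by (auto simp: G_def)
    have "- p \<le> c" "- (e - p) \<le> b - c"
      using c pE order_trans[of "- p" 0 c] order_trans[of "- (e - p)" 0 "b - c"] by auto
    then have "central_split p b c"
      unfolding central_split_def using c by (intro exI[of _ 1]) auto
    then show "b \<in> {b \<in> topspace effect_topology. f (proj b) \<in> S}" using proj_eq c by auto
  next
    fix b assume "b \<in> {b \<in> topspace effect_topology. f (proj b) \<in> S}"
    then have b: "b \<in> {0..e}" "f (proj b) \<in> S" by auto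
    have "proj b \<in> {0..e}" using proj_effect[OF b(1)] pE by (auto intro: order_trans)
    then have "(b, proj b) \<in> G" using b proj_effect[OF b(1)] by (auto simp: G_def)
    then show "b \<in> fst ` G" by force
  qed
  finally show "closedin effect_topology {b \<in> topspace effect_topology. f (proj b) \<in> S}" .
qed auto

end

text \<open>The subspace \<open>N\<close> of the compatible case. It contains the normal functionals
  and, by \<open>continuous_proj\<close>, is stable under composition with the projections.\<close>

definition ball_continuous :: "('a \<Rightarrow>\<^sub>L real) set" where
  "ball_continuous = {f. continuous_map (subtopology pre_topology {0..e}) euclideanreal (blinfun_apply f)}"

lemma subspace_ball_continuous: "subspace ball_continuous"
  unfolding subspace_def ball_continuous_def
  by (auto simp: plus_blinfun.rep_eq scaleR_blinfun.rep_eq zero_blinfun.rep_eq intro!: continuous_intros)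

lemma normal_ball_continuous: "normal x \<in> ball_continuous"
  unfolding ball_continuous_def using continuous_normal by (auto intro: continuous_map_from_subtopology)

text \<open>\<open>p\<close> plays the part of the set on which a signed measure is positive: as a
  maximiser of \<open>f\<close> over the effects, it makes \<open>f\<close> nonnegative below
  \<open>p\<close> and nonpositive below \<open>e - p\<close>. The total mass is the value of
  \<open>f\<close> at \<open>2 p - e\<close>, an element of norm at most 1.\<close>

lemma hahn_decomposition:
  assumes f: "f \<in> ball_continuous"
  obtains g where "g \<in> ball_continuous \<inter> dual_cone" "g - f \<in> dual_cone"
    "\<And>u. u \<in> dual_cone \<Longrightarrow> u - f \<in> dual_cone \<Longrightarrow> u - g \<in> dual_cone"
    "blinfun_apply g e + blinfun_apply (g - f) e \<le> norm f"
proof -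
  obtain p where p: "p extreme_point_of {0..e}" "\<And>b. b \<in> {0..e} \<Longrightarrow> blinfun_apply f b \<le> blinfun_apply f p"
    using extreme_effect_maximizer[of f] f by (auto simp: ball_continuous_def)
  have pE: "0 \<le> p" "p \<le> e" using p_effect[OF p(1)] by auto
  define g where "g = f o\<^sub>L Blinfun (proj p)"
  have g: "blinfun_apply g b = blinfun_apply f (proj p b)" for b
    by (simp add: g_def bounded_linear_Blinfun_apply[OF bounded_linear_proj[OF p(1)]])
  have split: "0 \<le> blinfun_apply f (proj p b)" "blinfun_apply f (b - proj p b) \<le> 0" if b: "0 \<le> b" for b
  proof -
    obtain M where M: "M > 0" "0 \<le> (1 / M) *\<^sub>R b" "(1 / M) *\<^sub>R b \<le> e" using pos_coneD[OF b] by blast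
    define c where "c = (1 / M) *\<^sub>R b"
    have c: "c \<in> {0..e}" using M by (simp add: c_def)
    have bc: "b = M *\<^sub>R c" using M by (simp add: c_def)
    note q = proj_effect[OF p(1) c]
    \<comment> \<open>Competitors for the maximum: \<open>p\<close> with a piece below
      \<open>p\<close> removed, and \<open>p\<close> with a piece below \<open>e - p\<close>
      added.\<close>
    have "p - proj p c \<in> {0..e}" "p + (c - proj p c) \<in> {0..e}"
      using q pE order_trans[of "p - proj p c" p e] add_nonneg_nonneg[OF pE(1) q(3)] add_left_mono[OF q(4), of p] by auto
    then have "0 \<le> blinfun_apply f (proj p c)" "blinfun_apply f (c - proj p c) \<le> 0"
      using p(2) by (fastforce simp: blinfun.bilinear_simps)+
    then show "0 \<le> blinfun_apply f (proj p b)" "blinfun_apply f (b - proj p b) \<le> 0"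
      using M(1) unfolding bc
      by (simp_all add: linear_scale[OF linear_proj[OF p(1)]] blinfun.bilinear_simps mult_le_0_iff flip: right_diff_distrib)
  qed
  show thesis
  proof (rule that[of g])
    have "continuous_map (subtopology pre_topology {0..e}) euclideanreal (\<lambda>b. blinfun_apply f (proj p b))"
      using f by (intro continuous_proj[OF p(1)]) (simp add: ball_continuous_def)
    then have "g \<in> ball_continuous" unfolding ball_continuous_def g[abs_def, symmetric] by (simp add: g[symmetric])
    moreover have "g \<in> dual_cone" using split(1) by (simp add: dual_cone_def g)
    ultimately show "g \<in> ball_continuous \<inter> dual_cone" by blast
    show "g - f \<in> dual_cone" using split(2) by (auto simp: dual_cone_def g blinfun.bilinear_simps)
    show "u - g \<in> dual_cone" if u: "u \<in> dual_cone" "u - f \<in> dual_cone" for u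
      unfolding dual_cone_def
    proof (intro CollectI allI impI)
      fix b :: 'a assume b: "0 \<le> b"
      have q: "0 \<le> proj p b" using proj_nonneg[OF p(1) b] .
      have "0 \<le> b - proj p b"
      proof -
        obtain M where M: "M > 0" "0 \<le> (1 / M) *\<^sub>R b" "(1 / M) *\<^sub>R b \<le> e" using pos_coneD[OF b] by blast
        have "0 \<le> M *\<^sub>R ((1 / M) *\<^sub>R b - proj p ((1 / M) *\<^sub>R b))"
          using proj_effect(3)[OF p(1), of "(1 / M) *\<^sub>R b"] M by (intro scaleR_nonneg_nonneg) auto
        then show ?thesis using M(1) by (simp add: linear_scale[OF linear_proj[OF p(1)]] scaleR_diff_right)
      qed
      then have "0 \<le> blinfun_apply u (b - proj p b)" "0 \<le> blinfun_apply (u - f) (proj p b)"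
        using u q by (auto simp: dual_cone_def)
      then show "0 \<le> blinfun_apply (u - g) b" by (simp add: g blinfun.bilinear_simps)
    qed
    have "2 *\<^sub>R p - e \<le> 1 *\<^sub>R e" "- (1 *\<^sub>R e) \<le> 2 *\<^sub>R p - e"
      using pE add_mono[OF pE(2) pE(2)] by (auto simp: scaleR_2 algebra_simps)
    then have n: "norm (2 *\<^sub>R p - e) \<le> 1" by (intro norm_leI) auto
    have "blinfun_apply g e + blinfun_apply (g - f) e = blinfun_apply f (2 *\<^sub>R p - e)"
      by (simp add: g proj_e[OF p(1)] blinfun.bilinear_simps)
    also have "\<dots> \<le> norm f * norm (2 *\<^sub>R p - e)" using norm_blinfun[of f "2 *\<^sub>R p - e"] by simp
    also have "\<dots> \<le> norm f * 1" using n by (intro mult_left_mono) auto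
    finally show "blinfun_apply g e + blinfun_apply (g - f) e \<le> norm f" by simp
  qed
qed

lemma positive_parts_if_compatible: "positive_parts UNIV (pos_cone :: 'a set)"
proof (rule positive_parts_from_dual_subspace[OF subspace_ball_continuous])
  show "range normal \<subseteq> ball_continuous" using normal_ball_continuous by auto
  have diffN: "g - f \<in> ball_continuous" if "g \<in> ball_continuous" "f \<in> ball_continuous" for f g
    using subspace_diff[OF subspace_ball_continuous] that by blast
  show "positive_parts ball_continuous (ball_continuous \<inter> dual_cone)"
    unfolding positive_parts_def
  proof
    fix f assume f: "f \<in> ball_continuous"
    obtain g where g: "g \<in> ball_continuous \<inter> dual_cone" "g - f \<in> dual_cone"
      "\<And>u. u \<in> dual_cone \<Longrightarrow> u - f \<in> dual_cone \<Longrightarrow> u - g \<in> dual_cone"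
      using hahn_decomposition[OF f] by metis
    show "\<exists>p\<in>ball_continuous \<inter> dual_cone. p - f \<in> ball_continuous \<inter> dual_cone \<and>
        (\<forall>u\<in>ball_continuous \<inter> dual_cone. u - f \<in> ball_continuous \<inter> dual_cone \<longrightarrow> u - p \<in> ball_continuous \<inter> dual_cone)"
      using g f diffN by (intro bexI[of _ g]) auto
  qed
  fix x
  obtain g where g: "g \<in> ball_continuous \<inter> dual_cone" "g - normal x \<in> dual_cone"
    "blinfun_apply g e + blinfun_apply (g - normal x) e \<le> norm (normal x)"
    using hahn_decomposition[OF normal_ball_continuous[of x]] by metis
  have "blinfun_apply g e + blinfun_apply (g - normal x) e \<le> norm x" using g(3) norm_normal_le[of x] by linarith
  then show "\<exists>f1\<in>ball_continuous \<inter> dual_cone. \<exists>f2\<in>ball_continuous \<inter> dual_cone.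
      normal x = f1 - f2 \<and> blinfun_apply f1 e + blinfun_apply f2 e \<le> norm x"
    using g diffN[OF _ normal_ball_continuous] by (intro bexI[of _ g] bexI[of _ "g - normal x"]) auto
qed

end

section \<open>Boundary measures on the state space\<close>

lemma radon_positive_functional:
  assumes T: "compact_space T" "Hausdorff_space T" and \<mu>: "radon_prob_measure T \<mu>"
  shows "compact_positive_functional T (integral\<^sup>L \<mu>)"
proof -
  interpret prob_space \<mu> using \<mu> by (rule radon_prob_measureD)
  show ?thesis
    using T radon_integrable[OF \<mu> T(1)] radon_prob_measureD(3)[OF \<mu>] prob_space
    by unfold_locales (auto simp: prob_space intro!: integral_nonneg_AE)
qed

text \<open>A point of \<open>topspace T\<close> minimising the squared distance of finitely many affine functions to
  their expectations attains all of these expectations, by the first-order condition.\<close>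

lemma affine_expectations_attained:
  fixes T :: "'v::real_vector topology"
  assumes \<Lambda>: "compact_positive_functional T \<Lambda>" and conv: "convex (topspace T)" and ne: "topspace T \<noteq> {}"
    and G: "finite G" "\<And>g. g \<in> G \<Longrightarrow> continuous_map T euclideanreal g" "\<And>g. g \<in> G \<Longrightarrow> affine_functional_on (topspace T) g"
  obtains y where "y \<in> topspace T" "\<And>g. g \<in> G \<Longrightarrow> g y = \<Lambda> g"
proof -
  interpret compact_positive_functional T \<Lambda> by (rule \<Lambda>)
  define h where "h y = (\<Sum>g\<in>G. (g y - \<Lambda> g)\<^sup>2)" for y
  have "cont (\<lambda>y. - h y)"
    unfolding h_def using G by (intro continuous_intros) auto
  then obtain y where y: "y \<in> topspace T" "\<And>z. z \<in> topspace T \<Longrightarrow> h y \<le> h z"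
    using continuous_attains_max[of T "topspace T" "\<lambda>y. - h y"] T(1) ne by (auto simp: compact_space_def)
  define d where "d g = g y - \<Lambda> g" for g
  have first_order: "0 \<le> (\<Sum>g\<in>G. d g * (g z - g y))" if z: "z \<in> topspace T" for z
  proof (rule ccontr)
    define a where "a = (\<Sum>g\<in>G. d g * (g z - g y))"
    define b where "b = (\<Sum>g\<in>G. (g z - g y)\<^sup>2)"
    assume "\<not> 0 \<le> (\<Sum>g\<in>G. d g * (g z - g y))"
    then have a: "a < 0" by (simp add: a_def)
    have b: "0 \<le> b" unfolding b_def by (intro sum_nonneg) auto
    \<comment> \<open>Along the segment \<open>h\<close> changes by
      \<open>t * (2 * a + t * b)\<close>. This \<open>t\<close> keeps
      \<open>t * b \<le> - a\<close>, so the change is negative; \<open>b + 1\<close> avoids a zero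
      denominator.\<close>
    define t where "t = min 1 (- a / (b + 1))"
    have t: "0 < t" "t \<le> 1" using a b by (auto simp: t_def divide_neg_pos)
    have "(1 - t) *\<^sub>R y + t *\<^sub>R z \<in> topspace T"
      using conv y(1) z t by (simp add: convex_alt)
    then have "h y \<le> h ((1 - t) *\<^sub>R y + t *\<^sub>R z)" by (rule y(2))
    also have "h ((1 - t) *\<^sub>R y + t *\<^sub>R z) = (\<Sum>g\<in>G. (d g + t * (g z - g y))\<^sup>2)"
      unfolding h_def
    proof (intro sum.cong refl)
      fix g assume "g \<in> G"
      then have "g ((1 - t) *\<^sub>R y + t *\<^sub>R z) = (1 - t) * g y + t * g z"
        using G(3)[of g] y(1) z t by (auto simp: affine_functional_on_def)
      then show "(g ((1 - t) *\<^sub>R y + t *\<^sub>R z) - \<Lambda> g)\<^sup>2 = (d g + t * (g z - g y))\<^sup>2"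
        by (simp only: d_def) (simp add: algebra_simps)
    qed
    also have "\<dots> = (\<Sum>g\<in>G. (d g)\<^sup>2 + 2 * t * (d g * (g z - g y)) + t\<^sup>2 * (g z - g y)\<^sup>2)"
      by (intro sum.cong refl) (simp add: power2_eq_square algebra_simps)
    also have "\<dots> = h y + 2 * t * a + t\<^sup>2 * b"
      by (simp add: sum.distrib h_def a_def b_def d_def flip: sum_distrib_left)
    finally have "0 \<le> t * (2 * a + t * b)" by (simp add: power2_eq_square algebra_simps)
    then have "0 \<le> 2 * a + t * b" using t(1) by (simp add: zero_le_mult_iff)
    moreover have "t * b \<le> - a"
    proof -
      have "t * b \<le> (- a / (b + 1)) * b" using b by (intro mult_right_mono) (auto simp: t_def)
      also have "\<dots> = - a * (b / (b + 1))" by simp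
      also have "\<dots> \<le> - a * 1" using a b by (intro mult_left_mono) auto
      also have "\<dots> = - a" by simp
      finally show ?thesis .
    qed
    ultimately show False using a by linarith
  qed
  have cd: "cont (\<lambda>z. d g * (g z - g y))" if "g \<in> G" for g
    using G(2)[OF that] by (intro continuous_intros) auto
  \<comment> \<open>Applying \<open>\<Lambda>\<close> to the first-order inequality, read as a
    function of \<open>z\<close>, replaces \<open>g z - g y\<close> by \<open>- d g\<close> and
    leaves minus the minimal squared distance.\<close>
  have "0 \<le> \<Lambda> (\<lambda>z. \<Sum>g\<in>G. d g * (g z - g y))"
    using first_order cd G(1) by (intro pos continuous_map_sum) auto
  also have "\<dots> = (\<Sum>g\<in>G. \<Lambda> (\<lambda>z. d g * (g z - g y)))"
    using G(1) cd by (rule sum)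
  also have "\<dots> = (\<Sum>g\<in>G. - (d g)\<^sup>2)"
  proof (intro sum.cong refl)
    fix g assume g: "g \<in> G"
    have "\<Lambda> (\<lambda>z. d g * (g z - g y)) = d g * \<Lambda> (\<lambda>z. g z - g y)"
      using G(2)[OF g] by (intro scale continuous_intros) auto
    also have "\<Lambda> (\<lambda>z. g z - g y) = \<Lambda> g - g y"
      using diff[OF G(2)[OF g], of "\<lambda>z. g y"] const by simp
    finally show "\<Lambda> (\<lambda>z. d g * (g z - g y)) = - (d g)\<^sup>2"
      by (simp add: d_def power2_eq_square algebra_simps)
  qed
  finally have "(\<Sum>g\<in>G. (d g)\<^sup>2) \<le> 0" by (simp add: sum_negf)
  then have "(\<Sum>g\<in>G. (d g)\<^sup>2) = 0" by (simp add: antisym sum_nonneg)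
  then have "d g = 0" if "g \<in> G" for g using G(1) that by (simp add: sum_nonneg_eq_0_iff)
  then show thesis using y(1) that by (auto simp: d_def)
qed

text \<open>The sets where one continuous affine function attains its expectation are closed, and by
  the finite case they have the finite intersection property. \<open>topspace T\<close> joins the
  family so that the common point lies in it.\<close>

theorem affine_representing_point:
  fixes T :: "'v::real_vector topology"
  assumes \<Lambda>: "compact_positive_functional T \<Lambda>" and conv: "convex (topspace T)" and ne: "topspace T \<noteq> {}"
  obtains y where "y \<in> topspace T"
    "\<And>g. continuous_map T euclideanreal g \<Longrightarrow> affine_functional_on (topspace T) g \<Longrightarrow> g y = \<Lambda> g"
proof -
  define AK where "AK = {g. continuous_map T euclideanreal g \<and> affine_functional_on (topspace T) g}"
  define Z where "Z g = {y \<in> topspace T. g y = \<Lambda> g}" for g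
  have T: "compact_space T" using \<Lambda> by (simp add: compact_positive_functional_def)
  define \<U> where "\<U> = insert (topspace T) (Z ` AK)"
  have c1: "closedin T C" if "C \<in> \<U>" for C
    using that by (auto simp: \<U>_def Z_def AK_def intro!: closedin_level_set)
  have c2: "\<Inter>\<F> \<noteq> {}" if \<F>: "finite \<F>" "\<F> \<subseteq> \<U>" for \<F>
  proof -
    have "finite (\<F> - {topspace T})" "\<F> - {topspace T} \<subseteq> Z ` AK" using \<F> by (auto simp: \<U>_def)
    then obtain G where G: "finite G" "G \<subseteq> AK" "\<F> - {topspace T} = Z ` G" by (metis finite_subset_image)
    obtain y where y: "y \<in> topspace T" "\<And>g. g \<in> G \<Longrightarrow> g y = \<Lambda> g"
      by (rule affine_expectations_attained[OF \<Lambda> conv ne G(1)]) (use G(2) in \<open>auto simp: AK_def\<close>)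
    have "y \<in> C" if "C \<in> \<F>" for C
    proof (cases "C = topspace T")
      case False
      then have "C \<in> Z ` G" using that G(3) by blast
      then show ?thesis using y by (auto simp: Z_def)
    qed (use y in simp)
    then show ?thesis by blast
  qed
  have "\<Inter>\<U> \<noteq> {}"
    by (rule T[unfolded compact_space_fip, THEN spec, THEN mp]) (use c1 c2 in blast)
  then obtain y where y: "y \<in> \<Inter>\<U>" by blast
  show thesis
  proof (rule that)
    show "y \<in> topspace T" using y by (simp add: \<U>_def)
    show "g y = \<Lambda> g" if "continuous_map T euclideanreal g" "affine_functional_on (topspace T) g" for g
    proof -
      have "Z g \<in> \<U>" using that by (simp add: \<U>_def AK_def)
      then have "y \<in> Z g" using y by blast
      then show ?thesis by (simp add: Z_def)
    qed
  qed
qed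

declare strong_operator_topology_topspace [simp]

lemma Hausdorff_weak_star: "Hausdorff_space (weak_star_topology :: ('a::real_normed_vector \<Rightarrow>\<^sub>L real) topology)"
proof (rule Hausdorff_space_injective_preimage)
  show "Hausdorff_space (product_topology (\<lambda>_::'a. euclideanreal) UNIV)"
    by (simp add: Hausdorff_space_product_topology)
  show "continuous_map weak_star_topology (product_topology (\<lambda>_::'a. euclideanreal) UNIV) blinfun_apply"
    by (simp add: continuous_map_componentwise_UNIV strong_operator_topology_continuous_evaluation)
  show "inj_on blinfun_apply (topspace weak_star_topology)"
    by (simp add: inj_on_def blinfun_apply_inject)
qed

section \<open>The state space and its extreme points\<close>

context order_unit_banach
begin

abbreviation K :: "('a \<Rightarrow>\<^sub>L real) set" where "K \<equiv> state_space e"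
abbreviation X :: "('a \<Rightarrow>\<^sub>L real) set" where "X \<equiv> {x. x extreme_point_of K}"
abbreviation KT :: "('a \<Rightarrow>\<^sub>L real) topology" where "KT \<equiv> subtopology weak_star_topology K"

lemma K_D: "\<phi> \<in> K \<Longrightarrow> 0 \<le> a \<Longrightarrow> 0 \<le> blinfun_apply \<phi> a" "\<phi> \<in> K \<Longrightarrow> blinfun_apply \<phi> e = 1"
  by (auto simp: state_space_eq dual_cone_def)

lemma K_mono: "\<phi> \<in> K \<Longrightarrow> a \<le> b \<Longrightarrow> blinfun_apply \<phi> a \<le> blinfun_apply \<phi> b"
  using K_D(1)[of \<phi> "b - a"] by (simp add: blinfun.bilinear_simps)

lemma XK: "x \<in> X \<Longrightarrow> x \<in> K"
  by (simp add: extreme_point_of_def)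

lemma continuous_eval: "continuous_map KT euclideanreal (\<lambda>\<phi>. blinfun_apply \<phi> a)"
  by (rule continuous_map_from_subtopology[OF strong_operator_topology_continuous_evaluation])

lemma compact_K: "compactin weak_star_topology K"
proof -
  let ?W = "weak_star_topology :: ('a \<Rightarrow>\<^sub>L real) topology"
  have 1: "closedin ?W {\<phi> \<in> topspace ?W. blinfun_apply \<phi> a \<in> {0..}}" for a
    by (rule closedin_continuous_map_preimage[OF strong_operator_topology_continuous_evaluation]) simp
  have 2: "closedin ?W {\<phi> \<in> topspace ?W. blinfun_apply \<phi> e \<in> {1}}"
    by (rule closedin_continuous_map_preimage[OF strong_operator_topology_continuous_evaluation]) simp
  have 3: "closedin ?W (\<Inter>a\<in>pos_cone. {\<phi> \<in> topspace ?W. blinfun_apply \<phi> a \<in> {0..}})"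
    using 1 by (intro closedin_INT) auto
  have "compactin ?W (((\<Inter>a\<in>pos_cone. {\<phi> \<in> topspace ?W. blinfun_apply \<phi> a \<in> {0..}}) \<inter>
      {\<phi> \<in> topspace ?W. blinfun_apply \<phi> e \<in> {1}}) \<inter> {\<phi>. norm \<phi> \<le> 1})"
    using 2 3 by (intro closed_Int_compactin closedin_Int banach_alaoglu)
  also have "((\<Inter>a\<in>pos_cone. {\<phi> \<in> topspace ?W. blinfun_apply \<phi> a \<in> {0..}}) \<inter>
      {\<phi> \<in> topspace ?W. blinfun_apply \<phi> e \<in> {1}}) \<inter> {\<phi>. norm \<phi> \<le> 1} = K"
    using norm_dual_cone by (auto simp: state_space_eq dual_cone_def strong_operator_topology_topspace)
  finally show ?thesis .
qed

lemma topspace_KT [simp]: "topspace KT = K"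
  by (simp add: strong_operator_topology_topspace)

lemma compact_KT: "compact_space KT" and Hausdorff_KT: "Hausdorff_space KT"
  using compact_K Hausdorff_weak_star by (auto intro: compact_space_subtopology Hausdorff_space_subtopology)

lemma convex_K: "convex K"
  unfolding convex_alt state_space_eq dual_cone_def
  by (auto simp: blinfun.bilinear_simps)

lemma affine_eval: "affine_functional_on A (\<lambda>\<phi>. blinfun_apply \<phi> a)"
  by (simp add: affine_functional_on_def blinfun.bilinear_simps)

text \<open>The infimum of all \<open>l\<close> with \<open>b \<le> l e\<close> is sublinear in
  \<open>b\<close>, and every linear functional below it is a state. Prescribing equality at
  \<open>- a\<close> gives a positive value there, since otherwise \<open>- a \<le> 0\<close> by the
  Archimedean property.\<close>

lemma state_detects_negative:
  assumes "\<not> 0 \<le> a"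
  obtains \<phi> where "\<phi> \<in> K" "blinfun_apply \<phi> a < 0"
proof -
  have e0: "e \<noteq> 0" using assms trivial[of a] by auto
  have bdd: "bdd_below {l. b \<le> l *\<^sub>R e}" for b
  proof (rule bdd_belowI)
    fix l assume "l \<in> {l. b \<le> l *\<^sub>R e}"
    then have "0 \<le> (norm b + l) *\<^sub>R e"
      using norm_plus_nonneg[of b] by (auto simp: scaleR_add_left intro: order_trans[OF _ add_left_mono])
    then show "- norm b \<le> l" using scaleR_e_nonneg_iff[OF e0] by simp
  qed
  have ne: "{l. b \<le> l *\<^sub>R e} \<noteq> {}" for b using le_norm by blast
  have add: "l + k \<in> {l. b + c \<le> l *\<^sub>R e}" if "l \<in> {l. b \<le> l *\<^sub>R e}" "k \<in> {l. c \<le> l *\<^sub>R e}" for b c l k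
    using that add_mono[of b "l *\<^sub>R e" c "k *\<^sub>R e"] by (simp add: scaleR_add_left)
  have scale: "r * l \<in> {l. r *\<^sub>R b \<le> l *\<^sub>R e}" if "r > 0" "l \<in> {l. b \<le> l *\<^sub>R e}" for b r l
    using that scaleR_left_mono[of b "l *\<^sub>R e" r] by simp
  obtain F where F0: "linear_functional_on UNIV F" "\<And>x l. x \<in> UNIV \<Longrightarrow> l \<in> {l. x \<le> l *\<^sub>R e} \<Longrightarrow> F x \<le> l"
      "F (- a) = Inf {l. - a \<le> l *\<^sub>R e}"
    by (rule hahn_banach_Inf[OF subspace_UNIV UNIV_I[of "- a"] ne bdd add scale]; blast)
  have lin: "linear F" using F0(1) by (simp add: linear_functional_on_UNIV)
  have Fle: "F x \<le> l" if "x \<le> l *\<^sub>R e" for x l using that by (intro F0(2)) auto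
  have pos: "0 \<le> F b" if "0 \<le> b" for b
    using Fle[of "- b" 0] that linear_neg[OF lin, of b] by simp
  have "F e \<le> 1" "F (- e) \<le> - 1" using Fle[of e 1] Fle[of "- e" "- 1"] by auto
  then have Fe: "F e = 1" using linear_neg[OF lin, of e] by simp
  have bl: "bounded_linear F" by (rule positive_bounded_linear[OF lin pos])
  have "F (- a) > 0"
  proof (rule ccontr)
    assume "\<not> F (- a) > 0"
    have "- a \<le> 0 + \<epsilon> *\<^sub>R e" if "\<epsilon> > 0" for \<epsilon>
    proof -
      have "Inf {l. - a \<le> l *\<^sub>R e} < \<epsilon>" using \<open>\<not> F (- a) > 0\<close> that F0(3) by simp
      then obtain l where "- a \<le> l *\<^sub>R e" "l < \<epsilon>"
        using cInf_lessD[of "{l. - a \<le> l *\<^sub>R e}" \<epsilon>] le_norm[of "- a"] by auto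
      then show ?thesis using scaleR_e_mono[of l \<epsilon>] by (auto intro: order_trans)
    qed
    then have "- a \<le> 0" by (rule archimedean)
    then show False using assms by simp
  qed
  then have "F a < 0" using linear_neg[OF lin, of a] by simp
  then show thesis
    using pos Fe by (intro that[of "Blinfun F"]) (auto simp: state_space_eq dual_cone_def bounded_linear_Blinfun_apply[OF bl])
qed

lemma convex_max_extreme:
  assumes "continuous_map KT euclideanreal f" "convex_on K f" "K \<noteq> {}"
  obtains x where "x \<in> X" "\<And>y. y \<in> K \<Longrightarrow> f y \<le> f x"
proof (rule bauer_maximum_principle[OF compact_K assms(3), of "range (\<lambda>a \<phi>. blinfun_apply \<phi> a)" f])
  show "linear l" if "l \<in> range (\<lambda>a (\<phi> :: 'a \<Rightarrow>\<^sub>L real). blinfun_apply \<phi> a)" for l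
    using that by (auto intro!: linearI simp: blinfun.bilinear_simps)
  show "continuous_map KT euclideanreal l" if "l \<in> range (\<lambda>a \<phi>. blinfun_apply \<phi> a)" for l
    using that continuous_eval by auto
  show "x = y" if "\<And>l. l \<in> range (\<lambda>a \<phi>. blinfun_apply \<phi> a) \<Longrightarrow> l x = l y" for x y :: "'a \<Rightarrow>\<^sub>L real"
    using that by (intro blinfun_eqI) auto
qed (use assms that in auto)

lemma convex_le_if_le_on_extreme:
  assumes "continuous_map KT euclideanreal f" "convex_on K f" "\<And>x. x \<in> X \<Longrightarrow> f x \<le> c" "y \<in> K"
  shows "f y \<le> c"
proof -
  obtain x where "x \<in> X" "\<And>y. y \<in> K \<Longrightarrow> f y \<le> f x"
    using convex_max_extreme[OF assms(1,2)] assms(4) by blast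
  then show ?thesis using assms(3)[of x] assms(4) by fastforce
qed

lemma convex_on_eval: "convex_on K (\<lambda>\<phi>. blinfun_apply \<phi> a)"
  using convex_K by (simp add: convex_on_def blinfun.bilinear_simps)

text \<open>States detect the order, and by Bauer's maximum principle an evaluation attains its
  maximum over \<open>K\<close> on \<open>X\<close>.\<close>

lemma le_iff_extreme: "a \<le> b \<longleftrightarrow> (\<forall>x\<in>X. blinfun_apply x a \<le> blinfun_apply x b)"
proof
  assume le: "\<forall>x\<in>X. blinfun_apply x a \<le> blinfun_apply x b"
  have *: "blinfun_apply y (a - b) \<le> 0" if "y \<in> K" for y
  proof (rule convex_le_if_le_on_extreme[OF continuous_eval convex_on_eval _ that])
    show "blinfun_apply x (a - b) \<le> 0" if "x \<in> X" for x
      using le that by (simp add: blinfun.diff_right)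
  qed
  show "a \<le> b"
  proof (rule ccontr)
    assume "\<not> a \<le> b"
    then have "\<not> 0 \<le> b - a" by simp
    then obtain \<phi> where "\<phi> \<in> K" "blinfun_apply \<phi> (b - a) < 0" by (rule state_detects_negative)
    then show False using *[of \<phi>] by (simp add: blinfun.bilinear_simps)
  qed
qed (use K_mono XK in auto)

lemma K_nonempty: "e \<noteq> 0 \<Longrightarrow> K \<noteq> {}"
  using state_detects_negative[of "- e"] e_nonneg by (metis empty_iff neg_0_le_iff_le order_antisym)

lemma X_nonempty: "K \<noteq> {} \<Longrightarrow> X \<noteq> {}"
  using convex_max_extreme[OF continuous_eval[of 0] convex_on_eval] by blast

definition CK :: "(('a \<Rightarrow>\<^sub>L real) \<Rightarrow> real) set" where
  "CK = {f. continuous_map KT euclideanreal f}"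

lemma subspace_CK: "subspace CK"
  by (auto simp: subspace_def CK_def plus_fun_def scaleR_fun_def zero_fun_def intro!: continuous_intros)

lemma eval_CK: "(\<lambda>\<phi>. blinfun_apply \<phi> a) \<in> CK"
  by (simp add: CK_def continuous_eval)

lemma CK_bounded:
  assumes "f \<in> CK"
  obtains B where "B > 0" "\<And>x. x \<in> K \<Longrightarrow> \<bar>f x\<bar> \<le> B"
  using continuous_map_bounded[OF compact_KT, of f] assms by (auto simp: CK_def)

text \<open>Concentration on the closure of \<open>X\<close>, stated as an inequality for functions
  on \<open>K\<close>; a functional that Hahn-Banach produces from bounds on \<open>X\<close>
  satisfies it directly.\<close>

definition extremal_measure :: "('a \<Rightarrow>\<^sub>L real) measure \<Rightarrow> bool" where
  "extremal_measure \<mu> \<longleftrightarrow> radon_prob_measure KT \<mu> \<and>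
     (\<forall>f\<in>CK. (\<forall>x\<in>X. f x \<le> 0) \<longrightarrow> integral\<^sup>L \<mu> f \<le> 0)"

lemma extremal_measure_of_functional:
  assumes lin: "linear_functional_on CK F" and neg: "\<And>f. f \<in> CK \<Longrightarrow> (\<And>x. x \<in> X \<Longrightarrow> f x \<le> 0) \<Longrightarrow> F f \<le> 0"
    and one: "F (\<lambda>x. 1) = 1"
  obtains \<mu> where "extremal_measure \<mu>" "\<And>f. f \<in> CK \<Longrightarrow> F f = integral\<^sup>L \<mu> f"
proof -
  have add: "F (\<lambda>x. f x + g x) = F f + F g" if "f \<in> CK" "g \<in> CK" for f g
    using lin that unfolding linear_functional_on_def plus_fun_def by blast
  have scale: "F (\<lambda>x. c * f x) = c * F f" if "f \<in> CK" for f c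
    using lin that unfolding linear_functional_on_def scaleR_fun_def by simp
  interpret compact_positive_functional KT F
  proof
    fix f assume f: "continuous_map KT euclideanreal f" "\<And>x. x \<in> topspace KT \<Longrightarrow> 0 \<le> f x"
    have "(\<lambda>x. - 1 * f x) \<in> CK" using f(1) by (auto simp: CK_def intro!: continuous_intros)
    then have "F (\<lambda>x. - 1 * f x) \<le> 0" using f(2) XK by (intro neg) auto
    then show "0 \<le> F f" using scale[of f "- 1"] f(1) by (simp add: CK_def)
  qed (use add scale one compact_KT Hausdorff_KT in \<open>auto simp: CK_def\<close>)
  have eq: "F f = integral\<^sup>L riesz_measure f" if "f \<in> CK" for f
    using riesz_markov that by (simp add: CK_def)
  have "extremal_measure riesz_measure"
    unfolding extremal_measure_def using radon_riesz_measure neg by (simp flip: eq)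
  then show thesis using eq by (rule that)
qed

lemma extremal_integral_mono:
  assumes "extremal_measure \<mu>" "f \<in> CK" "g \<in> CK" "\<And>x. x \<in> X \<Longrightarrow> f x \<le> g x + c"
  shows "integral\<^sup>L \<mu> f \<le> integral\<^sup>L \<mu> g + c"
proof -
  have r: "radon_prob_measure KT \<mu>" using assms(1) by (simp add: extremal_measure_def)
  interpret prob_space \<mu> using r by (rule radon_prob_measureD)
  have i: "integrable \<mu> f" "integrable \<mu> g"
    using radon_integrable[OF r compact_KT] assms by (auto simp: CK_def)
  have "(\<lambda>x. f x - (g x + c)) \<in> CK" using assms(2,3) by (auto simp: CK_def intro!: continuous_intros)
  then have "integral\<^sup>L \<mu> (\<lambda>x. f x - (g x + c)) \<le> 0"
    using assms(1,4) unfolding extremal_measure_def by fastforce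
  then show ?thesis using i by (simp add: prob_space)
qed

text \<open>A barycenter is tested on all continuous affine functionals on \<open>K\<close>, of
  which evaluations are only some. \<open>affine_representing_point\<close> gives a point that is
  right for all of them, and evaluations suffice to identify it with \<open>y\<close>.\<close>

lemma barycenterI:
  assumes \<mu>: "radon_prob_measure KT \<mu>" and y: "y \<in> K" and eq: "\<And>a. integral\<^sup>L \<mu> (\<lambda>\<phi>. blinfun_apply \<phi> a) = blinfun_apply y a"
  shows "barycenter weak_star_topology K \<mu> y"
proof -
  obtain z where z: "z \<in> K" "\<And>g. continuous_map KT euclideanreal g \<Longrightarrow> affine_functional_on K g \<Longrightarrow> g z = integral\<^sup>L \<mu> g"
    using affine_representing_point[OF radon_positive_functional[OF compact_KT Hausdorff_KT \<mu>]] convex_K y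
    by (metis empty_iff topspace_KT)
  have "z = y"
    by (rule blinfun_eqI) (use z(2)[OF continuous_eval affine_eval] eq in simp)
  then show ?thesis using z by (auto simp: barycenter_def)
qed

lemma barycenter_eval:
  assumes "barycenter weak_star_topology K \<mu> y"
  shows "integral\<^sup>L \<mu> (\<lambda>\<phi>. blinfun_apply \<phi> a) = blinfun_apply y a"
  using assms continuous_eval affine_eval unfolding barycenter_def by metis

end

section \<open>Upper envelopes at extreme points and maximality of measures\<close>

context order_unit_banach
begin

text \<open>With \<open>s\<close> the mass of \<open>\<phi>\<close> and \<open>0 < s < 1\<close>,
  \<open>y\<close> is a convex combination of the normalisations of \<open>\<phi>\<close> and
  \<open>y - \<phi>\<close>, so both equal \<open>y\<close>; for \<open>s = 0\<close> or
  \<open>s = 1\<close> one of the two has norm 0.\<close>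

lemma extreme_dominated:
  assumes y: "y \<in> X" and \<phi>: "\<phi> \<in> dual_cone" "y - \<phi> \<in> dual_cone"
  shows "\<phi> = blinfun_apply \<phi> e *\<^sub>R y"
proof -
  define s where "s = blinfun_apply \<phi> e"
  have yK: "y \<in> K" "blinfun_apply y e = 1" using XK[OF y] K_D(2) by auto
  have s0: "0 \<le> s" using \<phi>(1) e_nonneg by (simp add: s_def dual_cone_def)
  have "0 \<le> blinfun_apply (y - \<phi>) e" using \<phi>(2) e_nonneg by (simp add: dual_cone_def)
  then have s1: "s \<le> 1" using yK by (simp add: s_def blinfun.bilinear_simps)
  have n1: "norm \<phi> = s" using norm_dual_cone[OF \<phi>(1)] by (simp add: s_def)
  have n2: "norm (y - \<phi>) = 1 - s"
    using norm_dual_cone[OF \<phi>(2)] yK by (simp add: s_def blinfun.bilinear_simps)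
  consider "s = 0" | "s = 1" | "0 < s" "s < 1" using s0 s1 by linarith
  then have "\<phi> = s *\<^sub>R y"
  proof cases
    case 3
    define u where "u = (1 / s) *\<^sub>R \<phi>"
    define v where "v = (1 / (1 - s)) *\<^sub>R (y - \<phi>)"
    have u: "u \<in> K" and v: "v \<in> K"
      unfolding state_space_eq u_def v_def
      using 3 \<phi> yK by (auto intro!: dual_cone_scale simp: blinfun.bilinear_simps s_def[symmetric])
    have "y = (1 - s) *\<^sub>R v + s *\<^sub>R u" using 3 by (simp add: u_def v_def)
    then have "v \<noteq> u \<Longrightarrow> y \<in> open_segment v u" using 3 by (auto simp: in_segment)
    then have "v = u" using y u v by (auto simp: extreme_point_of_def)
    then have "y = u" using \<open>y = (1 - s) *\<^sub>R v + s *\<^sub>R u\<close> by (simp flip: scaleR_add_left)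
    then show ?thesis using 3 by (simp add: u_def)
  qed (use n1 n2 in auto)
  then show ?thesis by (simp add: s_def)
qed

text \<open>At an extreme point the upper envelope of a maximum of affine functions equals that maximum:
  Hahn-Banach splits \<open>y\<close> into positive functionals, one for each element of \<open>A\<close>, and extremality
  makes all of them multiples of \<open>y\<close>.\<close>

lemma extreme_upper_envelope:
  assumes y: "y \<in> X" and A: "finite A" "A \<noteq> {}" and m: "\<And>a. a \<in> A \<Longrightarrow> blinfun_apply y a \<le> m" and eps: "\<epsilon> > 0"
  obtains b where "\<And>a. a \<in> A \<Longrightarrow> a \<le> b" "blinfun_apply y b < m + \<epsilon>"
proof -
  have yK: "y \<in> K" using XK[OF y] .
  obtain a0 where a0: "a0 \<in> A" using A by auto
  \<comment> \<open>A function \<open>g\<close> is read as a family indexed by the elements of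
    \<open>A\<close>; the set \<open>A\<close> itself is the identity family, at which Hahn-Banach
    is asked for equality.\<close>
  define S where "S = (\<lambda>g :: 'a \<Rightarrow> 'a. {blinfun_apply y b | b. \<forall>a\<in>A. g a \<le> b})"
  have bdd: "bdd_below (S g)" for g
    using K_mono[OF yK] a0 by (intro bdd_belowI[of _ "blinfun_apply y (g a0)"]) (auto simp: S_def)
  have ne: "S g \<noteq> {}" for g
  proof -
    have "g a \<le> (\<Sum>a\<in>A. norm (g a)) *\<^sub>R e" if "a \<in> A" for a
      using A(1) that by (intro norm_leD member_le_sum) auto
    then show ?thesis unfolding S_def by blast
  qed
  have add: "l + k \<in> S (g + h)" if lk: "l \<in> S g" "k \<in> S h" for g h l k
  proof -
    obtain b c where "l = blinfun_apply y b" "\<forall>a\<in>A. g a \<le> b" "k = blinfun_apply y c" "\<forall>a\<in>A. h a \<le> c"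
      using lk unfolding S_def by blast
    then show ?thesis
      unfolding S_def by (intro CollectI exI[of _ "b + c"]) (auto simp: blinfun.bilinear_simps intro: add_mono)
  qed
  have scale: "r * l \<in> S (r *\<^sub>R g)" if r: "r > 0" and l: "l \<in> S g" for g r l
  proof -
    obtain b where "l = blinfun_apply y b" "\<forall>a\<in>A. g a \<le> b" using l unfolding S_def by blast
    then show ?thesis
      unfolding S_def using r
      by (intro CollectI exI[of _ "r *\<^sub>R b"]) (auto simp: blinfun.bilinear_simps intro!: scaleR_left_mono)
  qed
  obtain F where F0: "linear_functional_on UNIV F" "\<And>x l. x \<in> UNIV \<Longrightarrow> l \<in> S x \<Longrightarrow> F x \<le> l" "F (\<lambda>a. a) = Inf (S (\<lambda>a. a))"
    by (rule hahn_banach_Inf[where A = S, OF subspace_UNIV UNIV_I[of "\<lambda>a. a"] ne bdd add scale]; blast)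
  have lin: "linear F" using F0(1) by (simp add: linear_functional_on_UNIV)
  have Fle: "F g \<le> blinfun_apply y b" if "\<And>a. a \<in> A \<Longrightarrow> g a \<le> b" for g b
    using that by (intro F0(2)) (auto simp: S_def)
  have Fneg: "F g \<le> 0" if "\<And>a. a \<in> A \<Longrightarrow> g a \<le> 0" for g
    using Fle[of g 0] that by (simp add: blinfun.zero_right)
  define ins where "ins a c = (\<lambda>x. if x = a then c else 0)" for a c :: 'a
  have ins_lin: "ins a (c + d) = ins a c + ins a d" "ins a (r *\<^sub>R c) = r *\<^sub>R ins a c" for a c d r
    by (auto simp: ins_def fun_eq_iff)
  define f where "f a c = F (ins a c)" for a c
  have flin: "linear (f a)" for a
    by (rule linearI) (simp_all add: f_def ins_lin linear_add[OF lin] linear_scale[OF lin])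
  have fpos: "0 \<le> f a c" if "0 \<le> c" for a c
  proof -
    have "F (ins a (- c)) \<le> 0" using that by (intro Fneg) (simp add: ins_def)
    then show ?thesis using linear_neg[OF flin, of a c] by (simp add: f_def)
  qed
  have fbl: "bounded_linear (f a)" for a by (rule positive_bounded_linear[OF flin fpos])
  define \<phi> where "\<phi> a = Blinfun (f a)" for a
  have \<phi>: "blinfun_apply (\<phi> a) c = f a c" for a c by (simp add: \<phi>_def bounded_linear_Blinfun_apply[OF fbl])
  have \<phi>pos: "\<phi> a \<in> dual_cone" for a using fpos by (simp add: dual_cone_def \<phi>)
  have Fsum: "F g = (\<Sum>a\<in>A. f a (g a))" for g
  proof -
    have z: "(\<Sum>x\<in>A. ins x (g x)) a = g a" if "a \<in> A" for a
    proof -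
      have "(\<Sum>x\<in>A. ins x (g x)) a = (\<Sum>x\<in>A. ins x (g x) a)"
        using A(1) by (induction A rule: finite_induct) auto
      also have "\<dots> = g a" using A(1) that by (simp add: ins_def)
      finally show ?thesis .
    qed
    have "F (g - (\<Sum>a\<in>A. ins a (g a))) \<le> 0" "F ((\<Sum>a\<in>A. ins a (g a)) - g) \<le> 0"
      by (rule Fneg; simp add: z)+
    then have "F g = F (\<Sum>a\<in>A. ins a (g a))" by (simp add: linear_diff[OF lin])
    also have "\<dots> = (\<Sum>a\<in>A. f a (g a))" by (simp add: linear_sum[OF lin] f_def)
    finally show ?thesis .
  qed
  have ysum: "blinfun_apply y c = (\<Sum>a\<in>A. f a c)" for c
  proof (rule antisym)
    have le': "(\<Sum>a\<in>A. f a c) \<le> blinfun_apply y c" for c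
      using Fle[of "\<lambda>a. c" c] Fsum[of "\<lambda>a. c"] by simp
    then show "(\<Sum>a\<in>A. f a c) \<le> blinfun_apply y c" .
    show "blinfun_apply y c \<le> (\<Sum>a\<in>A. f a c)"
      using le'[of "- c"] by (simp add: linear_neg[OF flin] sum_negf blinfun.bilinear_simps)
  qed
  have fa: "f a c = f a e * blinfun_apply y c" if a: "a \<in> A" for a c
  proof -
    have "y - \<phi> a \<in> dual_cone"
      unfolding dual_cone_def
    proof (intro CollectI allI impI)
      fix d :: 'a assume "0 \<le> d"
      then have "f a d \<le> blinfun_apply y d" unfolding ysum using A(1) a fpos by (intro member_le_sum) auto
      then show "0 \<le> blinfun_apply (y - \<phi> a) d" by (simp add: blinfun.bilinear_simps \<phi>)
    qed
    from extreme_dominated[OF y \<phi>pos this]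
    have "blinfun_apply (\<phi> a) c = blinfun_apply (blinfun_apply (\<phi> a) e *\<^sub>R y) c" by simp
    then show ?thesis by (simp add: \<phi> blinfun.bilinear_simps)
  qed
  \<comment> \<open>The infimum becomes an average of the values of \<open>y\<close> on
    \<open>A\<close>, with weights \<open>f a e\<close> that sum to the value 1 of \<open>y\<close>
    at \<open>e\<close>; hence it is at most \<open>m\<close>.\<close>
  have "Inf (S (\<lambda>a. a)) = (\<Sum>a\<in>A. f a a)" using F0(3) Fsum[of "\<lambda>a. a"] by simp
  also have "\<dots> = (\<Sum>a\<in>A. f a e * blinfun_apply y a)" by (intro sum.cong refl fa)
  also have "\<dots> \<le> (\<Sum>a\<in>A. f a e * m)" using m fpos e_nonneg by (intro sum_mono mult_left_mono) auto
  also have "\<dots> = m" using ysum[of e] K_D(2)[OF yK] by (simp flip: sum_distrib_right)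
  finally have "Inf (S (\<lambda>a. a)) < m + \<epsilon>" using eps by simp
  then obtain b where "\<forall>a\<in>A. a \<le> b" "blinfun_apply y b < m + \<epsilon>"
    using cInf_lessD[OF ne[of "\<lambda>a. a"], of "m + \<epsilon>"] by (auto simp: S_def)
  then show thesis using that by blast
qed

text \<open>Maxima of finitely many evaluations are continuous and convex on \<open>K\<close>, and
  their differences form a uniformly dense lattice of continuous functions, so their integrals
  determine a measure.\<close>

definition maxK :: "'a set \<Rightarrow> ('a \<Rightarrow>\<^sub>L real) \<Rightarrow> real" where
  "maxK A \<phi> = Max (blinfun_apply \<phi> ` A)"

lemma maxK_ge: "finite A \<Longrightarrow> a \<in> A \<Longrightarrow> blinfun_apply \<phi> a \<le> maxK A \<phi>"
  by (simp add: maxK_def)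

lemma maxK_le: "finite A \<Longrightarrow> A \<noteq> {} \<Longrightarrow> (\<And>a. a \<in> A \<Longrightarrow> blinfun_apply \<phi> a \<le> c) \<Longrightarrow> maxK A \<phi> \<le> c"
  by (simp add: maxK_def)

lemma maxK_in: "finite A \<Longrightarrow> A \<noteq> {} \<Longrightarrow> \<exists>a\<in>A. maxK A \<phi> = blinfun_apply \<phi> a"
  unfolding maxK_def using Max_in[of "blinfun_apply \<phi> ` A"] by blast

lemma maxK_singleton [simp]: "maxK {a} \<phi> = blinfun_apply \<phi> a"
  by (simp add: maxK_def)

lemma maxK_Un:
  assumes "finite A" "A \<noteq> {}" "finite B" "B \<noteq> {}"
  shows "maxK (A \<union> B) \<phi> = max (maxK A \<phi>) (maxK B \<phi>)"
  unfolding maxK_def image_Un using assms by (intro Max_Un) auto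

text \<open>Minkowski sum, which turns a sum of two maxima into one maximum.\<close>

definition sumset :: "'a set \<Rightarrow> 'a set \<Rightarrow> 'a set" where
  "sumset A B = (\<lambda>(a, b). a + b) ` (A \<times> B)"

lemma sumset_finite: "finite A \<Longrightarrow> finite B \<Longrightarrow> finite (sumset A B)"
  and sumset_ne: "A \<noteq> {} \<Longrightarrow> B \<noteq> {} \<Longrightarrow> sumset A B \<noteq> {}"
  by (auto simp: sumset_def)

lemma maxK_sumset:
  assumes "finite A" "A \<noteq> {}" "finite B" "B \<noteq> {}"
  shows "maxK (sumset A B) \<phi> = maxK A \<phi> + maxK B \<phi>"
proof (rule antisym)
  show "maxK (sumset A B) \<phi> \<le> maxK A \<phi> + maxK B \<phi>"
    using assms by (intro maxK_le sumset_finite sumset_ne) (auto simp: sumset_def blinfun.bilinear_simps intro!: add_mono maxK_ge)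
  obtain a b where ab: "a \<in> A" "maxK A \<phi> = blinfun_apply \<phi> a" "b \<in> B" "maxK B \<phi> = blinfun_apply \<phi> b"
    using maxK_in assms by metis
  then have "a + b \<in> sumset A B" by (force simp: sumset_def)
  from maxK_ge[OF sumset_finite[OF assms(1,3)] this, of \<phi>]
  show "maxK A \<phi> + maxK B \<phi> \<le> maxK (sumset A B) \<phi>" using ab by (simp add: blinfun.bilinear_simps)
qed

lemma maxK_continuous: "finite A \<Longrightarrow> A \<noteq> {} \<Longrightarrow> continuous_map KT euclideanreal (maxK A)"
proof (induction A rule: finite_ne_induct)
  case (singleton a)
  then show ?case using continuous_eval[of a] by (simp add: maxK_def[abs_def])
next
  case (insert a A)
  have "maxK (insert a A) = (\<lambda>\<phi>. max (blinfun_apply \<phi> a) (maxK A \<phi>))"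
    using insert maxK_Un[of "{a}" A] by (auto simp: fun_eq_iff)
  then show ?case using insert.IH continuous_eval[of a] by (simp add: continuous_map_real_max)
qed

lemma maxK_CK: "finite A \<Longrightarrow> A \<noteq> {} \<Longrightarrow> maxK A \<in> CK"
  by (simp add: CK_def maxK_continuous)

lemma maxK_convex: "finite A \<Longrightarrow> A \<noteq> {} \<Longrightarrow> convex_on K (maxK A)"
proof (rule convex_onI[OF _ convex_K])
  fix t :: real and u v :: "'a \<Rightarrow>\<^sub>L real" assume A: "finite A" "A \<noteq> {}" and t: "0 < t" "t < 1"
  show "maxK A ((1 - t) *\<^sub>R u + t *\<^sub>R v) \<le> (1 - t) * maxK A u + t * maxK A v"
    using A t by (intro maxK_le) (auto simp: blinfun.bilinear_simps intro!: add_mono mult_left_mono maxK_ge)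
qed

lemma state_interpolation:
  assumes "s \<in> K" "t \<in> K"
  obtains a where "blinfun_apply s a = f s" "blinfun_apply t a = f t"
proof (cases "s = t")
  case True
  then show thesis using that[of "f s *\<^sub>R e"] K_D(2)[OF assms(1)] by (simp add: blinfun.bilinear_simps)
next
  case False
  then obtain a where a: "blinfun_apply s a \<noteq> blinfun_apply t a" using blinfun_eqI by blast
  define c where "c = (f s - f t) / (blinfun_apply s a - blinfun_apply t a)"
  have c: "c * (blinfun_apply s a - blinfun_apply t a) = f s - f t" using a by (simp add: c_def)
  show thesis
    using K_D(2)[OF assms(1)] K_D(2)[OF assms(2)] c
    by (intro that[of "c *\<^sub>R a + (f s - c * blinfun_apply s a) *\<^sub>R e"])
      (simp_all add: blinfun.bilinear_simps algebra_simps)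
qed

text \<open>Let \<open>\<nu>\<close> dominate \<open>\<mu>\<close>. By compactness of
  \<open>X\<close>, finitely many upper envelopes have a minimum that is above \<open>maxK A\<close>
  on \<open>K\<close> and within \<open>\<epsilon>\<close> of it on \<open>X\<close>. Being concave,
  this minimum has under \<open>\<nu>\<close> an integral no larger than under \<open>\<mu>\<close>,
  and \<open>\<mu>\<close> sees only \<open>X\<close>; so the integrals of \<open>maxK A\<close>
  agree, and density does the rest.\<close>

theorem extremal_measure_boundary:
  assumes X: "compactin weak_star_topology X" and ne: "K \<noteq> {}" and \<mu>: "extremal_measure \<mu>"
  shows "boundary_measure weak_star_topology K \<mu>"
  unfolding boundary_measure_def
proof (intro conjI allI impI)
  show r\<mu>: "radon_prob_measure KT \<mu>" using \<mu> by (simp add: extremal_measure_def)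
  fix \<nu> assume "radon_prob_measure KT \<nu> \<and> choquet_le weak_star_topology K \<mu> \<nu>"
  then have r\<nu>: "radon_prob_measure KT \<nu>"
    and le: "\<And>f. continuous_map KT euclideanreal f \<Longrightarrow> convex_on K f \<Longrightarrow> integral\<^sup>L \<mu> f \<le> integral\<^sup>L \<nu> f"
    by (auto simp: choquet_le_def)
  interpret M: prob_space \<mu> using r\<mu> by (rule radon_prob_measureD)
  interpret N: prob_space \<nu> using r\<nu> by (rule radon_prob_measureD)
  have sp: "space \<nu> = K" using radon_prob_measureD(3)[OF r\<nu>] by simp
  have i: "integrable \<mu> f" "integrable \<nu> f" if "f \<in> CK" for f
    using radon_integrable[OF r\<mu> compact_KT] radon_integrable[OF r\<nu> compact_KT] that by (auto simp: CK_def)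
  have XKT: "compactin KT X" using X XK by (auto simp: compactin_subtopology)
  have eq_max: "integral\<^sup>L \<mu> (maxK A) = integral\<^sup>L \<nu> (maxK A)" if A: "finite A" "A \<noteq> {}" for A
  proof (rule antisym)
    show "integral\<^sup>L \<mu> (maxK A) \<le> integral\<^sup>L \<nu> (maxK A)" using A by (intro le maxK_continuous maxK_convex)
    show "integral\<^sup>L \<nu> (maxK A) \<le> integral\<^sup>L \<mu> (maxK A)"
    proof (rule field_le_epsilon)
      fix \<epsilon> :: real assume eps: "\<epsilon> > 0"
      have "\<exists>b. (\<forall>a\<in>A. a \<le> b) \<and> blinfun_apply y b < maxK A y + \<epsilon>" if "y \<in> X" for y
        using extreme_upper_envelope[OF that A, of "maxK A y" \<epsilon>] maxK_ge[OF A(1)] eps by metis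
      then obtain b where b: "\<And>y a. y \<in> X \<Longrightarrow> a \<in> A \<Longrightarrow> a \<le> b y" "\<And>y. y \<in> X \<Longrightarrow> blinfun_apply y (b y) < maxK A y + \<epsilon>"
        by metis
      obtain J where J: "finite J" "J \<subseteq> X" "X \<subseteq> (\<Union>y\<in>J. {\<phi> \<in> topspace KT. maxK A \<phi> + \<epsilon> - blinfun_apply \<phi> (b y) \<in> {0<..}})"
      proof (rule compactin_index_subcover[OF XKT, of X "\<lambda>y. {\<phi> \<in> topspace KT. maxK A \<phi> + \<epsilon> - blinfun_apply \<phi> (b y) \<in> {0<..}}"])
        show "openin KT {\<phi> \<in> topspace KT. maxK A \<phi> + \<epsilon> - blinfun_apply \<phi> (b y) \<in> {0<..}}" for y
          by (rule openin_continuous_map_preimage[of _ euclideanreal])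
            (auto intro!: continuous_intros maxK_continuous A continuous_eval)
        show "X \<subseteq> (\<Union>y\<in>X. {\<phi> \<in> topspace KT. maxK A \<phi> + \<epsilon> - blinfun_apply \<phi> (b y) \<in> {0<..}})"
          using b(2) XK by fastforce
      qed blast
      \<comment> \<open>With the signs changed, \<open>- maxK B\<close> is the minimum of the
        \<open>b y\<close>, a concave function.\<close>
      define B where "B = (\<lambda>y. - b y) ` J"
      have "J \<noteq> {}" using J(3) X_nonempty[OF ne] by auto
      then have B: "finite B" "B \<noteq> {}" using J(1) by (auto simp: B_def)
      have low: "maxK A \<phi> \<le> - maxK B \<phi>" if "\<phi> \<in> K" for \<phi>
      proof -
        have "maxK A \<phi> \<le> blinfun_apply \<phi> (b y)" if "y \<in> J" for y
          using A b(1) J(2) that \<open>\<phi> \<in> K\<close> by (intro maxK_le) (auto intro!: K_mono)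
        then have "maxK B \<phi> \<le> - maxK A \<phi>"
          using B by (intro maxK_le) (auto simp: B_def blinfun.bilinear_simps)
        then show ?thesis by simp
      qed
      have up: "- maxK B x \<le> maxK A x + \<epsilon>" if "x \<in> X" for x
      proof -
        obtain y where y: "y \<in> J" "0 < maxK A x + \<epsilon> - blinfun_apply x (b y)" using J(3) \<open>x \<in> X\<close> by blast
        have "blinfun_apply x (- b y) \<le> maxK B x" using y(1) B by (intro maxK_ge) (auto simp: B_def)
        then show ?thesis using y(2) by (simp add: blinfun.bilinear_simps)
      qed
      have "integral\<^sup>L \<nu> (maxK A) \<le> integral\<^sup>L \<nu> (\<lambda>\<phi>. - maxK B \<phi>)"
        using low sp by (intro integral_mono i(2) maxK_CK A Bochner_Integration.integrable_minus B) auto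
      also have "\<dots> = - integral\<^sup>L \<nu> (maxK B)" by simp
      also have "\<dots> \<le> - integral\<^sup>L \<mu> (maxK B)" using le[OF maxK_continuous[OF B] maxK_convex[OF B]] by simp
      also have "\<dots> = integral\<^sup>L \<mu> (\<lambda>\<phi>. - maxK B \<phi>)" by simp
      also have "\<dots> \<le> integral\<^sup>L \<mu> (maxK A) + \<epsilon>"
        using maxK_CK[OF B] up by (intro extremal_integral_mono[OF \<mu>] maxK_CK A) (auto simp: CK_def intro!: continuous_intros)
      finally show "integral\<^sup>L \<nu> (maxK A) \<le> integral\<^sup>L \<mu> (maxK A) + \<epsilon>" .
    qed
  qed
  define L where "L = {h. \<exists>A B. finite A \<and> A \<noteq> {} \<and> finite B \<and> B \<noteq> {} \<and> h = (\<lambda>\<phi>. maxK A \<phi> - maxK B \<phi>)}"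
  have LI: "(\<lambda>\<phi>. maxK A \<phi> - maxK B \<phi>) \<in> L" if "finite A" "A \<noteq> {}" "finite B" "B \<noteq> {}" for A B
    using that by (auto simp: L_def)
  have Lcont: "h \<in> CK" if "h \<in> L" for h
    using that maxK_continuous by (auto simp: L_def CK_def intro!: continuous_intros)
  have Lint: "integral\<^sup>L \<mu> h = integral\<^sup>L \<nu> h" if "h \<in> L" for h
  proof -
    obtain A B where AB: "finite A" "A \<noteq> {}" "finite B" "B \<noteq> {}" and h: "h = (\<lambda>\<phi>. maxK A \<phi> - maxK B \<phi>)"
      using \<open>h \<in> L\<close> unfolding L_def by blast
    have "integral\<^sup>L \<mu> h = integral\<^sup>L \<mu> (maxK A) - integral\<^sup>L \<mu> (maxK B)"
      unfolding h using AB by (intro Bochner_Integration.integral_diff i maxK_CK)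
    also have "\<dots> = integral\<^sup>L \<nu> (maxK A) - integral\<^sup>L \<nu> (maxK B)"
      using eq_max[OF AB(1,2)] eq_max[OF AB(3,4)] by simp
    also have "\<dots> = integral\<^sup>L \<nu> h"
      unfolding h using AB by (intro Bochner_Integration.integral_diff[symmetric] i maxK_CK)
    finally show ?thesis .
  qed
  have Lmax: "(\<lambda>x. max (h x) (k x)) \<in> L" if hk: "h \<in> L" "k \<in> L" for h k
  proof -
    obtain A B C D where AB: "finite A" "A \<noteq> {}" "finite B" "B \<noteq> {}" "h = (\<lambda>\<phi>. maxK A \<phi> - maxK B \<phi>)"
      and CD: "finite C" "C \<noteq> {}" "finite D" "D \<noteq> {}" "k = (\<lambda>\<phi>. maxK C \<phi> - maxK D \<phi>)"
      using hk unfolding L_def by blast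
    \<comment> \<open>From
      \<open>max (s - t) (u - v) = max (s + v) (u + t) - (t + v)\<close>.\<close>
    have "(\<lambda>x. max (h x) (k x)) = (\<lambda>\<phi>. maxK (sumset A D \<union> sumset C B) \<phi> - maxK (sumset B D) \<phi>)"
      using AB CD by (auto simp: fun_eq_iff maxK_Un maxK_sumset sumset_finite sumset_ne max_def)
    also have "\<dots> \<in> L" using AB CD by (intro LI) (auto simp: sumset_finite sumset_ne)
    finally show ?thesis .
  qed
  have Lneg: "(\<lambda>x. - h x) \<in> L" if "h \<in> L" for h
  proof -
    obtain A B where AB: "finite A" "A \<noteq> {}" "finite B" "B \<noteq> {}" "h = (\<lambda>\<phi>. maxK A \<phi> - maxK B \<phi>)"
      using \<open>h \<in> L\<close> by (auto simp: L_def)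
    then have "(\<lambda>x. - h x) = (\<lambda>\<phi>. maxK B \<phi> - maxK A \<phi>)" by auto
    then show ?thesis using LI AB by metis
  qed
  have Lmin: "(\<lambda>x. min (h x) (k x)) \<in> L" if "h \<in> L" "k \<in> L" for h k
  proof -
    have "(\<lambda>x. - max (- h x) (- k x)) \<in> L" by (intro Lneg Lmax that)
    moreover have "(\<lambda>x. - max (- h x) (- k x)) = (\<lambda>x. min (h x) (k x))" by (auto simp: max_def min_def)
    ultimately show ?thesis by simp
  qed
  show "\<nu> = \<mu>"
  proof (rule radon_prob_measure_eqI[OF compact_KT Hausdorff_KT r\<nu> r\<mu>])
    fix f assume f: "continuous_map KT euclideanreal f"
    have fC: "f \<in> CK" using f by (simp add: CK_def)
    have "\<bar>integral\<^sup>L \<nu> f - integral\<^sup>L \<mu> f\<bar> \<le> 2 * \<epsilon>" if eps: "\<epsilon> > 0" for \<epsilon>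
    proof -
      obtain h where h: "h \<in> L" "\<And>x. x \<in> K \<Longrightarrow> \<bar>h x - f x\<bar> < \<epsilon>"
      proof (rule lattice_stone_weierstrass[OF compact_KT, of L f \<epsilon>])
        show "L \<noteq> {}" using LI[of "{0}" "{0}"] by auto
        fix s t assume st: "s \<in> topspace KT" "t \<in> topspace KT"
        obtain a where a: "blinfun_apply s a = f s" "blinfun_apply t a = f t"
          using state_interpolation[of s t f] st by auto
        have "(\<lambda>\<phi>. maxK {a} \<phi> - maxK {0} \<phi>) \<in> L" by (rule LI) auto
        then show "\<exists>h\<in>L. h s = f s \<and> h t = f t" using a by (intro bexI) (auto simp: blinfun.zero_right)
      qed (use Lcont Lmax Lmin f eps in \<open>auto simp: CK_def\<close>)
      have close: "\<bar>integral\<^sup>L \<tau> f - integral\<^sup>L \<tau> h\<bar> \<le> \<epsilon>" if \<tau>: "radon_prob_measure KT \<tau>" for \<tau>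
      proof -
        interpret P: prob_space \<tau> using \<tau> by (rule radon_prob_measureD)
        have ii: "integrable \<tau> f" "integrable \<tau> h"
          using radon_integrable[OF \<tau> compact_KT] fC Lcont[OF h(1)] by (auto simp: CK_def)
        have "\<bar>integral\<^sup>L \<tau> f - integral\<^sup>L \<tau> h\<bar> = \<bar>integral\<^sup>L \<tau> (\<lambda>x. f x - h x)\<bar>" using ii by simp
        also have "\<dots> \<le> integral\<^sup>L \<tau> (\<lambda>x. \<bar>f x - h x\<bar>)" by (rule integral_abs_bound)
        also have "\<dots> \<le> integral\<^sup>L \<tau> (\<lambda>x. \<epsilon>)"
          using ii h(2) radon_prob_measureD(3)[OF \<tau>]
          by (intro integral_mono) (auto simp: abs_minus_commute intro: less_imp_le)
        finally show ?thesis by (simp add: P.prob_space)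
      qed
      show ?thesis using close[OF r\<mu>] close[OF r\<nu>] Lint[OF h(1)] by linarith
    qed
    then have "\<bar>integral\<^sup>L \<nu> f - integral\<^sup>L \<mu> f\<bar> \<le> 0 + \<epsilon>" if "\<epsilon> > 0" for \<epsilon>
      using that by (metis add_0 half_gt_zero mult.commute nonzero_divide_eq_eq times_divide_eq_right zero_neq_numeral)
    then have "\<bar>integral\<^sup>L \<nu> f - integral\<^sup>L \<mu> f\<bar> \<le> 0" by (rule field_le_epsilon)
    then show "integral\<^sup>L \<nu> f = integral\<^sup>L \<mu> f" by simp
  qed
qed

end

section \<open>Bauer simplices and lattice-ordered order-unit spaces\<close>

context order_unit_banach
begin

text \<open>Hahn-Banach on the continuous functions, with the value of \<open>y\<close> at
  \<open>a\<close> as a bound for every \<open>f\<close> that \<open>a\<close> dominates on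
  \<open>X\<close>. The order of \<open>E\<close> being detected on \<open>X\<close>, these bounds
  are bounded below. Evaluations keep their value at \<open>y\<close>, which makes \<open>y\<close>
  the barycenter.\<close>

lemma extremal_measure_exists:
  assumes y: "y \<in> K"
  obtains \<mu> where "extremal_measure \<mu>" "barycenter weak_star_topology K \<mu> y"
proof -
  have ne: "K \<noteq> {}" using y by auto
  define S where "S = (\<lambda>f :: ('a \<Rightarrow>\<^sub>L real) \<Rightarrow> real. {blinfun_apply y a | a. \<forall>x\<in>X. f x \<le> blinfun_apply x a})"
  have bounds: "bdd_below (S f)" "S f \<noteq> {}" if f: "f \<in> CK" for f
  proof -
    obtain B where B: "B > 0" "\<And>x. x \<in> K \<Longrightarrow> \<bar>f x\<bar> \<le> B" using CK_bounded[OF f] by blast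
    have "- B \<le> blinfun_apply y a" if a: "\<And>x. x \<in> X \<Longrightarrow> f x \<le> blinfun_apply x a" for a
    proof -
      have "blinfun_apply x ((- B) *\<^sub>R e) \<le> blinfun_apply x a" if "x \<in> X" for x
        using a[OF that] B(2)[OF XK[OF that]] K_D(2)[OF XK[OF that]] by (simp add: blinfun.bilinear_simps)
      then have "(- B) *\<^sub>R e \<le> a" by (simp only: le_iff_extreme) blast
      from K_mono[OF y this] show ?thesis using K_D(2)[OF y] by (simp add: blinfun.bilinear_simps)
    qed
    then show "bdd_below (S f)" by (intro bdd_belowI[of _ "- B"]) (auto simp: S_def)
    have "f x \<le> blinfun_apply x (B *\<^sub>R e)" if "x \<in> X" for x
      using B(2)[OF XK[OF that]] K_D(2)[OF XK[OF that]] by (simp add: blinfun.bilinear_simps)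
    then show "S f \<noteq> {}" unfolding S_def by blast
  qed
  have add: "l + k \<in> S (f + g)" if lk: "l \<in> S f" "k \<in> S g" for f g l k
  proof -
    obtain a b where "l = blinfun_apply y a" "\<forall>x\<in>X. f x \<le> blinfun_apply x a"
        "k = blinfun_apply y b" "\<forall>x\<in>X. g x \<le> blinfun_apply x b"
      using lk unfolding S_def by blast
    then show ?thesis
      unfolding S_def by (intro CollectI exI[of _ "a + b"]) (auto simp: blinfun.bilinear_simps intro: add_mono)
  qed
  have scale: "r * l \<in> S (r *\<^sub>R f)" if r: "r > 0" and l: "l \<in> S f" for f r l
  proof -
    obtain a where "l = blinfun_apply y a" "\<forall>x\<in>X. f x \<le> blinfun_apply x a" using l unfolding S_def by blast
    then show ?thesis
      unfolding S_def using r by (intro CollectI exI[of _ "r *\<^sub>R a"]) (auto simp: blinfun.bilinear_simps)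
  qed
  obtain F where F: "linear_functional_on CK F" "\<And>x l. x \<in> CK \<Longrightarrow> l \<in> S x \<Longrightarrow> F x \<le> l" "F 0 = Inf (S 0)"
    by (rule hahn_banach_Inf[where A = S, OF subspace_CK subspace_0[OF subspace_CK] bounds(2) bounds(1) add scale]; blast)
  have ple: "F f \<le> blinfun_apply y a" if "f \<in> CK" "\<And>x. x \<in> X \<Longrightarrow> f x \<le> blinfun_apply x a" for f a
    using that by (intro F(2)) (auto simp: S_def)
  have neg: "F f \<le> 0" if "f \<in> CK" "\<And>x. x \<in> X \<Longrightarrow> f x \<le> 0" for f
    using ple[OF that(1), of 0] that(2) by (simp add: blinfun.zero_right)
  have Fle: "F (\<lambda>\<phi>. blinfun_apply \<phi> a) \<le> blinfun_apply y a" for a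
    using ple[OF eval_CK, of a a] by simp
  have Feq: "F (\<lambda>\<phi>. blinfun_apply \<phi> a) = blinfun_apply y a" for a
  proof -
    have A: "F ((- 1) *\<^sub>R (\<lambda>\<phi>. blinfun_apply \<phi> a)) = - 1 * F (\<lambda>\<phi>. blinfun_apply \<phi> a)"
      using F(1) eval_CK[of a] unfolding linear_functional_on_def by blast
    have B: "(- 1) *\<^sub>R (\<lambda>\<phi>. blinfun_apply \<phi> a) = (\<lambda>\<phi>. blinfun_apply \<phi> (- a))"
      by (simp add: fun_eq_iff blinfun.bilinear_simps scaleR_fun_def)
    have n: "F (\<lambda>\<phi>. blinfun_apply \<phi> (- a)) = - F (\<lambda>\<phi>. blinfun_apply \<phi> a)"
      using A unfolding B by simp
    show ?thesis using Fle[of a] Fle[of "- a"] unfolding n blinfun.minus_right[of y a] by simp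
  qed
  have one: "F (\<lambda>x. 1) = 1"
  proof -
    have c: "(\<lambda>x. 1) \<in> CK" by (simp add: CK_def)
    have "F (\<lambda>x. 1) \<le> 1"
      using ple[OF c, of e] K_D(2)[OF y] K_D(2)[OF XK] by simp
    moreover have c': "(\<lambda>x. - 1) \<in> CK" by (simp add: CK_def)
    have "F (\<lambda>x. - 1) \<le> - 1"
      using ple[OF c', of "- e"] K_D(2)[OF y] K_D(2)[OF XK] by (simp add: blinfun.bilinear_simps)
    moreover have "F ((- 1) *\<^sub>R (\<lambda>x. 1)) = - 1 * F (\<lambda>x. 1)"
      using F(1) c unfolding linear_functional_on_def by blast
    ultimately show ?thesis by (simp add: scaleR_fun_def)
  qed
  obtain \<mu> where \<mu>: "extremal_measure \<mu>" "\<And>f. f \<in> CK \<Longrightarrow> F f = integral\<^sup>L \<mu> f"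
    by (rule extremal_measure_of_functional[OF F(1) neg one]; blast)
  have "barycenter weak_star_topology K \<mu> y"
    using \<mu>(1) y \<mu>(2)[OF eval_CK] Feq
    by (intro barycenterI) (auto simp: extremal_measure_def)
  then show thesis using \<mu>(1) that by blast
qed

text \<open>At an extreme point the elements dominating \<open>a\<close> and 0 come arbitrarily
  close to the larger of the two values, and \<open>pp a\<close> lies below all of them. Conversely,
  when \<open>x = (1 - t) u + t v\<close>, a positive element annihilated by \<open>x\<close> is
  annihilated by \<open>u\<close> and \<open>v\<close>.\<close>

lemma extreme_iff_lattice_hom:
  assumes pp: "\<And>a. 0 \<le> pp a" "\<And>a. a \<le> pp a" "\<And>u a. 0 \<le> u \<Longrightarrow> a \<le> u \<Longrightarrow> pp a \<le> (u :: 'a)"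
  shows "x \<in> X \<longleftrightarrow> x \<in> K \<and> (\<forall>a. blinfun_apply x (pp a) = max (blinfun_apply x a) 0)"
proof (intro iffI conjI allI)
  assume x: "x \<in> X"
  show xK: "x \<in> K" using XK[OF x] .
  fix a
  show "blinfun_apply x (pp a) = max (blinfun_apply x a) 0"
  proof (rule antisym)
    show "blinfun_apply x (pp a) \<le> max (blinfun_apply x a) 0"
    proof (rule field_le_epsilon)
      fix \<epsilon> :: real assume eps: "\<epsilon> > 0"
      obtain b where b: "\<And>c. c \<in> {a, 0} \<Longrightarrow> c \<le> b" "blinfun_apply x b < max (blinfun_apply x a) 0 + \<epsilon>"
        by (rule extreme_upper_envelope[OF x, of "{a, 0}" "max (blinfun_apply x a) 0" \<epsilon>])
          (use eps in \<open>auto simp: blinfun.zero_right\<close>)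
      have "pp a \<le> b" using b(1) by (intro pp(3)) auto
      from K_mono[OF xK this] show "blinfun_apply x (pp a) \<le> max (blinfun_apply x a) 0 + \<epsilon>" using b(2) by simp
    qed
    show "max (blinfun_apply x a) 0 \<le> blinfun_apply x (pp a)"
      using K_mono[OF xK pp(2)[of a]] K_D(1)[OF xK pp(1)[of a]] by simp
  qed
next
  assume x: "x \<in> K \<and> (\<forall>a. blinfun_apply x (pp a) = max (blinfun_apply x a) 0)"
  then have xK: "x \<in> K" by simp
  have "u = v" if u: "u \<in> K" and v: "v \<in> K" and t: "0 < t" "t < 1" "x = (1 - t) *\<^sub>R u + t *\<^sub>R v" for u v t
  proof -
    have zero: "blinfun_apply u c = 0 \<and> blinfun_apply v c = 0" if "0 \<le> c" "blinfun_apply x c = 0" for c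
    proof -
      have "(1 - t) * blinfun_apply u c + t * blinfun_apply v c = 0"
        using that(2) t(3) by (simp add: blinfun.bilinear_simps)
      moreover have "0 \<le> (1 - t) * blinfun_apply u c" "0 \<le> t * blinfun_apply v c"
        using K_D(1)[OF u that(1)] K_D(1)[OF v that(1)] t by auto
      ultimately have "(1 - t) * blinfun_apply u c = 0" "t * blinfun_apply v c = 0" by linarith+
      then show ?thesis using t by auto
    qed
    have "blinfun_apply u a = blinfun_apply x a \<and> blinfun_apply v a = blinfun_apply x a" for a
    proof -
      \<comment> \<open>Subtracting the value of \<open>x\<close> moves \<open>a\<close> into the
        kernel of \<open>x\<close>; \<open>pp c\<close> and \<open>pp c - c\<close> are then
        positive elements of that kernel.\<close>
      define c where "c = a - blinfun_apply x a *\<^sub>R e"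
      have xc: "blinfun_apply x c = 0" using K_D(2)[OF xK] by (simp add: c_def blinfun.bilinear_simps)
      have "blinfun_apply x (pp c) = 0" using x xc by simp
      then have z1: "blinfun_apply u (pp c) = 0" "blinfun_apply v (pp c) = 0" using zero[OF pp(1)] by auto
      have "blinfun_apply x (pp c - c) = 0" using \<open>blinfun_apply x (pp c) = 0\<close> xc by (simp add: blinfun.bilinear_simps)
      then have z2: "blinfun_apply u (pp c - c) = 0" "blinfun_apply v (pp c - c) = 0"
        using zero[of "pp c - c"] pp(2)[of c] by auto
      have "blinfun_apply u c = 0" "blinfun_apply v c = 0" using z1 z2 by (simp_all add: blinfun.bilinear_simps)
      then show ?thesis using K_D(2)[OF u] K_D(2)[OF v] by (simp add: c_def blinfun.bilinear_simps)
    qed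
    then show "u = v" by (intro blinfun_eqI) simp
  qed
  then show "x \<in> X" using xK by (auto simp: extreme_point_of_def in_segment)
qed

text \<open>An extremal measure with barycenter \<open>y\<close> dominates, in the Choquet order,
  every boundary measure with that barycenter; the latter, being maximal, must coincide with
  it.\<close>

theorem bauer_if_positive_parts:
  assumes H: "positive_parts UNIV (pos_cone :: 'a set)"
  shows "bauer_simplex weak_star_topology K"
proof -
  obtain pp where pp: "\<And>a::'a. 0 \<le> pp a" "\<And>a. a \<le> pp a" "\<And>u a. 0 \<le> u \<Longrightarrow> a \<le> u \<Longrightarrow> pp a \<le> u"
    using H unfolding positive_parts_def by simp metis
  note X_iff = extreme_iff_lattice_hom[of pp, OF pp]
  have Xcl: "closedin KT X"
  proof -
    have "closedin KT {x \<in> topspace KT. blinfun_apply x (pp a) - max (blinfun_apply x a) 0 \<in> {0}}" for a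
      by (rule closedin_continuous_map_preimage[of _ euclideanreal]) (auto intro!: continuous_intros continuous_eval)
    then have "closedin KT (\<Inter>a. {x \<in> topspace KT. blinfun_apply x (pp a) - max (blinfun_apply x a) 0 \<in> {0}})"
      by (intro closedin_INT) auto
    also have "(\<Inter>a. {x \<in> topspace KT. blinfun_apply x (pp a) - max (blinfun_apply x a) 0 \<in> {0}}) = X"
    proof (intro set_eqI)
      fix x
      show "x \<in> (\<Inter>a. {x \<in> topspace KT. blinfun_apply x (pp a) - max (blinfun_apply x a) 0 \<in> {0}}) \<longleftrightarrow> x \<in> X"
        using X_iff[of x] by simp
    qed
    finally show ?thesis .
  qed
  have Xc: "compactin weak_star_topology X"
    using closedin_compact_space[OF compact_KT Xcl] by (simp add: compactin_subtopology)
  \<comment> \<open>Points of \<open>X\<close> preserve positive parts, so on \<open>X\<close> the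
    elements of \<open>E\<close> form a lattice of functions, to which Stone-Weierstrass
    applies.\<close>
  have approx: "\<exists>a. \<forall>x\<in>X. \<bar>blinfun_apply x a - f x\<bar> < \<epsilon>"
    if f: "f \<in> CK" and eps: "\<epsilon> > 0" for f \<epsilon>
  proof -
    define XT where "XT = subtopology weak_star_topology X"
    have top: "topspace XT = X" by (simp add: XT_def)
    have evX: "continuous_map XT euclideanreal (\<lambda>\<phi>. blinfun_apply \<phi> a)" for a
      unfolding XT_def by (rule continuous_map_from_subtopology[OF strong_operator_topology_continuous_evaluation])
    define L where "L = {h :: ('a \<Rightarrow>\<^sub>L real) \<Rightarrow> real. \<exists>a. \<forall>x\<in>X. h x = blinfun_apply x a}"
    have sup: "blinfun_apply x (b + pp (a - b)) = max (blinfun_apply x a) (blinfun_apply x b)"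
      and inf: "blinfun_apply x (a - pp (a - b)) = min (blinfun_apply x a) (blinfun_apply x b)" if "x \<in> X" for x a b
    proof -
      have "blinfun_apply x (pp (a - b)) = max (blinfun_apply x (a - b)) 0"
        using X_iff[of x] that by blast
      then show "blinfun_apply x (b + pp (a - b)) = max (blinfun_apply x a) (blinfun_apply x b)"
        "blinfun_apply x (a - pp (a - b)) = min (blinfun_apply x a) (blinfun_apply x b)"
        by (auto simp: blinfun.bilinear_simps max_def min_def)
    qed
    obtain h where h: "h \<in> L" "\<And>x. x \<in> topspace XT \<Longrightarrow> \<bar>h x - f x\<bar> < \<epsilon>"
    proof (rule lattice_stone_weierstrass[of XT L f \<epsilon>])
      show "compact_space XT" unfolding XT_def using Xc by (rule compact_space_subtopology)
      have "(\<lambda>x. blinfun_apply x 0) \<in> L" unfolding L_def by (intro CollectI exI[of _ 0]) simp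
      then show "L \<noteq> {}" by auto
      show "continuous_map XT euclideanreal h" if h: "h \<in> L" for h
      proof -
        obtain a where "\<forall>x\<in>X. h x = blinfun_apply x a" using h unfolding L_def by blast
        then show ?thesis using top by (intro continuous_map_eq[OF evX[of a]]) auto
      qed
      show "(\<lambda>x. max (h x) (k x)) \<in> L" if hk: "h \<in> L" "k \<in> L" for h k
      proof -
        obtain a b where "\<forall>x\<in>X. h x = blinfun_apply x a" "\<forall>x\<in>X. k x = blinfun_apply x b"
          using hk unfolding L_def by blast
        then show ?thesis unfolding L_def using sup by (intro CollectI exI[of _ "b + pp (a - b)"]) auto
      qed
      show "(\<lambda>x. min (h x) (k x)) \<in> L" if hk: "h \<in> L" "k \<in> L" for h k
      proof -
        obtain a b where "\<forall>x\<in>X. h x = blinfun_apply x a" "\<forall>x\<in>X. k x = blinfun_apply x b"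
          using hk unfolding L_def by blast
        then show ?thesis unfolding L_def using inf by (intro CollectI exI[of _ "a - pp (a - b)"]) auto
      qed
      have fc: "continuous_map KT euclideanreal f" using f by (simp add: CK_def)
      have "continuous_map (subtopology KT X) euclideanreal f"
        by (rule continuous_map_from_subtopology[OF fc])
      moreover have "subtopology KT X = XT"
        unfolding XT_def subtopology_subtopology using XK by (metis inf.absorb2 subsetI)
      ultimately show "continuous_map XT euclideanreal f" by simp
      fix s t assume "s \<in> topspace XT" "t \<in> topspace XT"
      then have "s \<in> K" "t \<in> K" using top XK by auto
      then obtain a where a: "blinfun_apply s a = f s" "blinfun_apply t a = f t" by (rule state_interpolation)
      have "(\<lambda>x. blinfun_apply x a) \<in> L" unfolding L_def by (intro CollectI exI[of _ a]) simp
      then show "\<exists>h\<in>L. h s = f s \<and> h t = f t"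
        by (rule bexI[rotated]) (simp add: a)
    qed (use eps in auto)
    obtain a where "\<forall>x\<in>X. h x = blinfun_apply x a" using h(1) unfolding L_def by blast
    then show ?thesis using h(2) top by (intro exI[of _ a]) auto
  qed
  show ?thesis
    unfolding bauer_simplex_def
  proof (intro conjI ballI compact_K convex_K Xc)
    fix y assume y: "y \<in> K"
    then have ne: "K \<noteq> {}" by auto
    obtain \<mu> where \<mu>: "extremal_measure \<mu>" "barycenter weak_star_topology K \<mu> y"
      using extremal_measure_exists[OF y] .
    show "\<exists>!\<mu>. boundary_measure weak_star_topology K \<mu> \<and> barycenter weak_star_topology K \<mu> y"
    proof (rule ex1I[of _ \<mu>])
      show "boundary_measure weak_star_topology K \<mu> \<and> barycenter weak_star_topology K \<mu> y"
        using extremal_measure_boundary[OF Xc ne \<mu>(1)] \<mu>(2) by simp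
      fix \<nu> assume \<nu>: "boundary_measure weak_star_topology K \<nu> \<and> barycenter weak_star_topology K \<nu> y"
      have r: "radon_prob_measure KT \<mu>" "radon_prob_measure KT \<nu>"
        using \<mu>(1) \<nu> by (auto simp: extremal_measure_def boundary_measure_def)
      have "choquet_le weak_star_topology K \<nu> \<mu>"
        unfolding choquet_le_def
      proof (intro allI impI)
        fix f assume "continuous_map KT euclideanreal f \<and> convex_on K f"
        then have f: "f \<in> CK" "convex_on K f" by (auto simp: CK_def)
        show "integral\<^sup>L \<nu> f \<le> integral\<^sup>L \<mu> f"
        proof (rule field_le_epsilon)
          fix \<epsilon> :: real assume eps: "\<epsilon> > 0"
          obtain a where a: "\<And>x. x \<in> X \<Longrightarrow> \<bar>blinfun_apply x a - f x\<bar> < \<epsilon> / 2"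
            using approx[OF f(1), of "\<epsilon> / 2"] eps by auto
          \<comment> \<open>The shift gives \<open>f \<le> b \<le> f + \<epsilon>\<close> on
            \<open>X\<close>; the convex function \<open>f - b\<close> is then nonpositive on all of
            \<open>K\<close>, and the integral of \<open>b\<close> depends on the barycenter
            only.\<close>
          define b where "b = a + (\<epsilon> / 2) *\<^sub>R e"
          have b: "blinfun_apply x b = blinfun_apply x a + \<epsilon> / 2" if "x \<in> K" for x
            using K_D(2)[OF that] by (simp add: b_def blinfun.bilinear_simps)
          have fb: "f z \<le> blinfun_apply z b" if z: "z \<in> K" for z
          proof -
            have "f z + blinfun_apply z (- b) \<le> 0"
            proof (rule convex_le_if_le_on_extreme[OF _ _ _ z])
              show "continuous_map KT euclideanreal (\<lambda>z. f z + blinfun_apply z (- b))"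
                using f(1) by (auto simp: CK_def intro!: continuous_intros continuous_eval)
              show "convex_on K (\<lambda>z. f z + blinfun_apply z (- b))"
                by (rule convex_on_add[OF f(2) convex_on_eval])
              show "f x + blinfun_apply x (- b) \<le> 0" if x: "x \<in> X" for x
                using a[OF x] b[OF XK[OF x]] unfolding blinfun.minus_right by linarith
            qed
            then show ?thesis by (simp add: blinfun.bilinear_simps)
          qed
          have "integral\<^sup>L \<nu> f \<le> integral\<^sup>L \<nu> (\<lambda>z. blinfun_apply z b)"
            using fb radon_prob_measureD(3)[OF r(2)] f(1) eval_CK[of b]
            by (intro integral_mono radon_integrable[OF r(2) compact_KT]) (auto simp: CK_def)
          also have "\<dots> = blinfun_apply y b" using barycenter_eval \<nu> by blast
          also have "\<dots> = integral\<^sup>L \<mu> (\<lambda>z. blinfun_apply z b)" using barycenter_eval[OF \<mu>(2)] by simp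
          also have "\<dots> \<le> integral\<^sup>L \<mu> f + \<epsilon>"
          proof (rule extremal_integral_mono[OF \<mu>(1) eval_CK f(1)])
            show "blinfun_apply x b \<le> f x + \<epsilon>" if x: "x \<in> X" for x
              using a[OF x] b[OF XK[OF x]] by linarith
          qed
          finally show "integral\<^sup>L \<nu> f \<le> integral\<^sup>L \<mu> f + \<epsilon>" .
        qed
      qed
      then show "\<nu> = \<mu>" using \<nu> r(1) unfolding boundary_measure_def by blast
    qed
  qed
qed

text \<open>If \<open>g\<close> were at positive distance from \<open>E\<close> on the extreme points, Hahn-Banach would give two
  extremal measures with different integrals of \<open>g\<close> but the same barycenter.\<close>

lemma bauer_approximates_continuous:
  assumes bauer: "bauer_simplex weak_star_topology K" and ne: "K \<noteq> {}" and g: "g \<in> CK" and eps: "\<epsilon> > 0"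
  obtains b where "\<And>x. x \<in> X \<Longrightarrow> g x \<le> blinfun_apply x b" "\<And>x. x \<in> X \<Longrightarrow> blinfun_apply x b \<le> g x + \<epsilon>"
proof -
  \<comment> \<open>At \<open>(g, - g)\<close> this is the set of all \<open>l\<close> for which
    some \<open>b\<close> satisfies \<open>g \<le> b \<le> g + l\<close> on \<open>X\<close>, so its
    infimum measures the distance from \<open>g\<close> to \<open>E\<close>. A functional on pairs
    is a sum of two functionals, from which the two measures arise.\<close>
  define S where "S = (\<lambda>z :: (('a \<Rightarrow>\<^sub>L real) \<Rightarrow> real) \<times> (('a \<Rightarrow>\<^sub>L real) \<Rightarrow> real).
    {l. \<exists>b. \<forall>x\<in>X. fst z x \<le> blinfun_apply x b \<and> snd z x \<le> l - blinfun_apply x b})"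
  have SI: "l \<in> S z" if "\<And>x. x \<in> X \<Longrightarrow> fst z x \<le> blinfun_apply x b" "\<And>x. x \<in> X \<Longrightarrow> snd z x \<le> l - blinfun_apply x b" for l z b
    using that unfolding S_def by blast
  have SE: "\<exists>b. (\<forall>x\<in>X. fst z x \<le> blinfun_apply x b) \<and> (\<forall>x\<in>X. snd z x \<le> l - blinfun_apply x b)" if "l \<in> S z" for l z
    using that unfolding S_def by blast
  have sC: "subspace (CK \<times> CK)" using subspace_Times[OF subspace_CK subspace_CK] .
  obtain x0 where x0: "x0 \<in> X" using X_nonempty[OF ne] by blast
  have bounds: "bdd_below (S z)" "S z \<noteq> {}" if z: "z \<in> CK \<times> CK" for z
  proof -
    have "- (\<bar>fst z x0\<bar> + \<bar>snd z x0\<bar>) \<le> l" if l: "l \<in> S z" for l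
    proof -
      obtain b where "fst z x0 \<le> blinfun_apply x0 b" "snd z x0 \<le> l - blinfun_apply x0 b"
        using SE[OF l] x0 by blast
      then show ?thesis by linarith
    qed
    then show "bdd_below (S z)" by (rule bdd_belowI)
    have zC: "fst z \<in> CK" "snd z \<in> CK" using z by auto
    obtain B where B: "\<And>x. x \<in> K \<Longrightarrow> \<bar>fst z x\<bar> \<le> B" using CK_bounded[OF zC(1)] by blast
    obtain C where C: "\<And>x. x \<in> K \<Longrightarrow> \<bar>snd z x\<bar> \<le> C" using CK_bounded[OF zC(2)] by blast
    have "B + C \<in> S z"
    proof (rule SI[where b = "B *\<^sub>R e"])
      fix x assume x: "x \<in> X"
      have "blinfun_apply x (B *\<^sub>R e) = B" using K_D(2)[OF XK[OF x]] by (simp add: blinfun.bilinear_simps)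
      then show "fst z x \<le> blinfun_apply x (B *\<^sub>R e)" "snd z x \<le> B + C - blinfun_apply x (B *\<^sub>R e)"
        using B[OF XK[OF x]] C[OF XK[OF x]] by auto
    qed
    then show "S z \<noteq> {}" by blast
  qed
  have Sadd: "l + k \<in> S (z + w)" if l: "l \<in> S z" and k: "k \<in> S w" for l k z w
  proof -
    obtain b where b: "\<forall>x\<in>X. fst z x \<le> blinfun_apply x b" "\<forall>x\<in>X. snd z x \<le> l - blinfun_apply x b" using SE[OF l] by blast
    obtain c where c: "\<forall>x\<in>X. fst w x \<le> blinfun_apply x c" "\<forall>x\<in>X. snd w x \<le> k - blinfun_apply x c" using SE[OF k] by blast
    show ?thesis
    proof (rule SI[where b = "b + c"])
      fix x assume x: "x \<in> X"
      show "fst (z + w) x \<le> blinfun_apply x (b + c)" "snd (z + w) x \<le> l + k - blinfun_apply x (b + c)"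
        using b(1)[rule_format, OF x] b(2)[rule_format, OF x] c(1)[rule_format, OF x] c(2)[rule_format, OF x]
        by (simp_all add: blinfun.bilinear_simps)
    qed
  qed
  have Sscale: "r * l \<in> S (r *\<^sub>R z)" if r: "r > 0" and l: "l \<in> S z" for r l z
  proof -
    obtain b where b: "\<forall>x\<in>X. fst z x \<le> blinfun_apply x b" "\<forall>x\<in>X. snd z x \<le> l - blinfun_apply x b" using SE[OF l] by blast
    show ?thesis
    proof (rule SI[where b = "r *\<^sub>R b"])
      fix x assume x: "x \<in> X"
      show "fst (r *\<^sub>R z) x \<le> blinfun_apply x (r *\<^sub>R b)" using b(1) x r by (simp add: blinfun.bilinear_simps)
      have "r * snd z x \<le> r * (l - blinfun_apply x b)" using b(2) x r by (intro mult_left_mono) auto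
      then show "snd (r *\<^sub>R z) x \<le> r * l - blinfun_apply x (r *\<^sub>R b)"
        by (simp add: blinfun.bilinear_simps right_diff_distrib)
    qed
  qed
  have mg: "- g \<in> CK" using subspace_CK g by (rule subspace_neg)
  have zero: "0 \<in> CK" using subspace_CK by (rule subspace_0)
  have gg: "(g, - g) \<in> CK \<times> CK" using g mg by simp
  obtain F where F: "linear_functional_on (CK \<times> CK) F" "\<And>z l. z \<in> CK \<times> CK \<Longrightarrow> l \<in> S z \<Longrightarrow> F z \<le> l"
      "F (g, - g) = Inf (S (g, - g))"
    by (rule hahn_banach_Inf[OF sC gg bounds(2) bounds(1) Sadd Sscale]; blast)
  have Fadd: "F (f + f', h + h') = F (f, h) + F (f', h')" if "f \<in> CK" "f' \<in> CK" "h \<in> CK" "h' \<in> CK" for f f' h h'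
  proof -
    have "F ((f, h) + (f', h')) = F (f, h) + F (f', h')"
      using F(1) that unfolding linear_functional_on_def by blast
    then show ?thesis by simp
  qed
  have Fscale: "F (r *\<^sub>R f, r *\<^sub>R h) = r * F (f, h)" if "f \<in> CK" "h \<in> CK" for r f h
  proof -
    have "F (r *\<^sub>R (f, h)) = r * F (f, h)"
      using F(1) that unfolding linear_functional_on_def by blast
    then show ?thesis by simp
  qed
  have Fle: "F (f, h) \<le> l" if "f \<in> CK" "h \<in> CK"
    "\<And>x. x \<in> X \<Longrightarrow> f x \<le> blinfun_apply x b" "\<And>x. x \<in> X \<Longrightarrow> h x \<le> l - blinfun_apply x b" for f h l b
    using F(2)[of "(f, h)" l] SI[of "(f, h)" b l] that by auto
  have lin1: "linear_functional_on CK (\<lambda>f. F (f, 0))"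
    using Fadd[OF _ _ zero zero] Fscale[OF _ zero] by (simp add: linear_functional_on_def)
  have lin2: "linear_functional_on CK (\<lambda>f. F (0, f))"
    using Fadd[OF zero zero] Fscale[OF zero] by (simp add: linear_functional_on_def)
  have split: "F (f, h) = F (f, 0) + F (0, h)" if "f \<in> CK" "h \<in> CK" for f h
    using Fadd[OF that(1) zero zero that(2)] by simp
  have neg1: "F (f, 0) \<le> 0" if "f \<in> CK" "\<And>x. x \<in> X \<Longrightarrow> f x \<le> 0" for f
    using that by (intro Fle[where b = 0] zero) (auto simp: blinfun.zero_right)
  have neg2: "F (0, f) \<le> 0" if "f \<in> CK" "\<And>x. x \<in> X \<Longrightarrow> f x \<le> 0" for f
    using that by (intro Fle[where b = 0] zero) (auto simp: blinfun.zero_right)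
  have oneC: "(\<lambda>x. 1) \<in> CK" "(\<lambda>x. - 1) \<in> CK" by (auto simp: CK_def)
  have m1: "(- 1) *\<^sub>R (\<lambda>x. 1 :: real) = (\<lambda>x. - 1)" by (simp add: scaleR_fun_def)
  have Xe: "blinfun_apply x e = 1" if "x \<in> X" for x using K_D(2)[OF XK[OF that]] .
  have one1: "F (\<lambda>x. 1, 0) = 1"
  proof -
    have "F (\<lambda>x. 1, 0) \<le> 1" using Xe by (intro Fle[where b = e] oneC zero) auto
    moreover have "F (\<lambda>x. - 1, 0) \<le> - 1"
      using Xe by (intro Fle[where b = "- e"] oneC zero) (auto simp: blinfun.bilinear_simps)
    moreover have "F (\<lambda>x. - 1, 0) = - 1 * F (\<lambda>x. 1, 0)" using Fscale[OF oneC(1) zero, of "- 1"] by (simp only: m1) simp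
    ultimately show ?thesis by simp
  qed
  have one2: "F (0, \<lambda>x. 1) = 1"
  proof -
    have "F (0, \<lambda>x. 1) \<le> 1" using Xe by (intro Fle[where b = 0] oneC zero) (auto simp: blinfun.zero_right)
    moreover have "F (0, \<lambda>x. - 1) \<le> - 1"
      using Xe by (intro Fle[where b = 0] oneC zero) (auto simp: blinfun.zero_right)
    moreover have "F (0, \<lambda>x. - 1) = - 1 * F (0, \<lambda>x. 1)" using Fscale[OF zero oneC(1), of "- 1"] by (simp only: m1) simp
    ultimately show ?thesis by simp
  qed
  obtain \<mu>1 where \<mu>1: "extremal_measure \<mu>1" "\<And>f. f \<in> CK \<Longrightarrow> F (f, 0) = integral\<^sup>L \<mu>1 f"
    by (rule extremal_measure_of_functional[OF lin1 neg1 one1]; blast)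
  obtain \<mu>2 where \<mu>2: "extremal_measure \<mu>2" "\<And>f. f \<in> CK \<Longrightarrow> F (0, f) = integral\<^sup>L \<mu>2 f"
    by (rule extremal_measure_of_functional[OF lin2 neg2 one2]; blast)
  let ?ev = "\<lambda>a (\<phi> :: 'a \<Rightarrow>\<^sub>L real). blinfun_apply \<phi> a"
  have evm: "- ?ev a = ?ev (- a)" for a by (simp add: fun_eq_iff blinfun.bilinear_simps)
  \<comment> \<open>With \<open>b = a\<close> the bound \<open>l = 0\<close> is admissible for the
    pair of evaluations at \<open>a\<close> and \<open>- a\<close>; exchanging \<open>a\<close> and
    \<open>- a\<close> gives equality, so both measures have the same barycenter.\<close>
  have agree: "F (?ev a, 0) = F (0, ?ev a)" for a
  proof -
    have le: "F (?ev a, 0) + F (0, ?ev (- a)) \<le> 0" for a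
      unfolding split[OF eval_CK eval_CK, symmetric]
      by (intro Fle[where b = a] eval_CK) (auto simp: blinfun.bilinear_simps)
    have "F (0, ?ev (- a)) = - F (0, ?ev a)"
      using Fscale[OF zero eval_CK, of "- 1" a] by (simp add: evm)
    moreover have "F (?ev (- a), 0) = - F (?ev a, 0)"
      using Fscale[OF eval_CK zero, of "- 1" a] by (simp add: evm)
    ultimately show ?thesis using le[of a] le[of "- a"] by simp
  qed
  define f where "f a = F (?ev a, 0)" for a
  have "linear f"
  proof (rule linearI)
    fix a b and r :: real
    have "?ev (a + b) = ?ev a + ?ev b" "?ev (r *\<^sub>R a) = r *\<^sub>R ?ev a"
      by (simp_all add: fun_eq_iff blinfun.bilinear_simps)
    then show "f (a + b) = f a + f b" "f (r *\<^sub>R a) = r *\<^sub>R f a"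
      using Fadd[OF eval_CK[of a] eval_CK[of b] zero zero] Fscale[OF eval_CK[of a] zero, of r] by (simp_all add: f_def)
  qed
  moreover have pos: "0 \<le> f a" if "0 \<le> a" for a
  proof -
    have "F (?ev (- a), 0) \<le> 0"
      using that K_D(1)[OF XK] by (intro neg1 eval_CK) (auto simp: blinfun.bilinear_simps)
    moreover have "F (?ev (- a), 0) = - F (?ev a, 0)"
      using Fscale[OF eval_CK zero, of "- 1" a] by (simp add: evm)
    ultimately show ?thesis by (simp add: f_def)
  qed
  ultimately have bl: "bounded_linear f" by (rule positive_bounded_linear)
  define y where "y = Blinfun f"
  have y: "blinfun_apply y a = f a" for a by (simp add: y_def bounded_linear_Blinfun_apply[OF bl])
  have "f e = 1"
  proof -
    have "F (?ev e, 0) \<le> 1" using Xe by (intro Fle[where b = e] eval_CK zero) auto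
    moreover have "F (- ?ev e, 0) \<le> - 1"
      unfolding evm using Xe by (intro Fle[where b = "- e"] eval_CK zero) (auto simp: blinfun.bilinear_simps)
    moreover have "F (- ?ev e, 0) = - F (?ev e, 0)" using Fscale[OF eval_CK zero, of "- 1" e] by simp
    ultimately show ?thesis by (simp add: f_def)
  qed
  then have yK: "y \<in> K" using pos by (simp add: state_space_eq dual_cone_def y)
  have b1: "barycenter weak_star_topology K \<mu>1 y"
    using \<mu>1 yK \<mu>1(2)[OF eval_CK] by (intro barycenterI) (auto simp: extremal_measure_def y f_def)
  have b2: "barycenter weak_star_topology K \<mu>2 y"
    using \<mu>2 yK \<mu>2(2)[OF eval_CK] agree by (intro barycenterI) (auto simp: extremal_measure_def y f_def)
  have Xc: "compactin weak_star_topology X" using bauer by (simp add: bauer_simplex_def)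
  have "\<mu>1 = \<mu>2"
    using bauer yK b1 b2 extremal_measure_boundary[OF Xc ne] \<mu>1(1) \<mu>2(1) unfolding bauer_simplex_def by blast
  then have "F (g, 0) = F (0, g)" using \<mu>1(2)[OF g] \<mu>2(2)[OF g] by simp
  moreover have "F (0, - g) = - F (0, g)" using Fscale[OF zero g, of "- 1"] by simp
  ultimately have "Inf (S (g, - g)) = 0" using F(3) split[OF g mg] by simp
  then have "Inf (S (g, - g)) < \<epsilon>" using eps by simp
  then obtain l where l: "l \<in> S (g, - g)" "l < \<epsilon>" using cInf_lessD[OF bounds(2)[OF gg]] by blast
  obtain b where b: "\<forall>x\<in>X. g x \<le> blinfun_apply x b" "\<forall>x\<in>X. - g x \<le> l - blinfun_apply x b"
    using SE[OF l(1)] by auto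
  show thesis
  proof (rule that[of b])
    fix x assume x: "x \<in> X"
    show "g x \<le> blinfun_apply x b" "blinfun_apply x b \<le> g x + \<epsilon>"
      using b(1)[rule_format, OF x] b(2)[rule_format, OF x] l(2) by linarith+
  qed
qed

lemma norm_le_extreme:
  assumes "\<And>x. x \<in> X \<Longrightarrow> \<bar>blinfun_apply x a\<bar> \<le> r" "0 \<le> r"
  shows "norm a \<le> r"
proof (rule norm_leI[OF _ _ assms(2)])
  show "a \<le> r *\<^sub>R e" "- (r *\<^sub>R e) \<le> a"
    unfolding le_iff_extreme using assms(1) K_D(2)[OF XK] by (auto simp: blinfun.bilinear_simps abs_le_iff minus_le_iff)
qed

text \<open>Elements of \<open>E\<close> that approximate the positive part of \<open>a\<close>
  uniformly on \<open>X\<close> form a Cauchy sequence, because the norm is determined on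
  \<open>X\<close>; completeness provides the limit, and it is the positive part since the order is
  determined on \<open>X\<close> as well.\<close>

theorem positive_parts_if_bauer:
  assumes bauer: "bauer_simplex weak_star_topology K"
  shows "positive_parts UNIV (pos_cone :: 'a set)"
proof (cases "K = {}")
  case True
  \<comment> \<open>Without states the order unit is 0, and then the whole space is trivial.\<close>
  then have e0: "e = 0" using K_nonempty by blast
  have z: "(a::'a) = 0" for a using trivial[OF e0] .
  show ?thesis unfolding positive_parts_def
  proof (intro ballI bexI[of _ 0] conjI impI)
    show "0 - v \<in> pos_cone" for v :: 'a using z[of v] by simp
    show "u - 0 \<in> pos_cone" for u :: 'a using z[of u] by simp
  qed simp
next
  case ne: False
  show ?thesis unfolding positive_parts_def
  proof
    fix a :: 'a
    define g where "g = (\<lambda>\<phi> :: 'a \<Rightarrow>\<^sub>L real. max (blinfun_apply \<phi> a) 0)"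
    have g: "g \<in> CK" unfolding g_def CK_def by (auto intro!: continuous_intros continuous_eval)
    have "\<exists>b. \<forall>x\<in>X. g x \<le> blinfun_apply x b \<and> blinfun_apply x b \<le> g x + 1 / real (Suc n)" for n
      using bauer_approximates_continuous[OF bauer ne g, of "1 / real (Suc n)"] by (metis of_nat_0_less_iff zero_less_Suc zero_less_divide_1_iff)
    then obtain b where b: "\<And>n x. x \<in> X \<Longrightarrow> g x \<le> blinfun_apply x (b n)"
      "\<And>n x. x \<in> X \<Longrightarrow> blinfun_apply x (b n) \<le> g x + 1 / real (Suc n)" by metis
    have "Cauchy b"
    proof (rule CauchyI')
      fix \<epsilon> :: real assume eps: "\<epsilon> > 0"
      obtain N where N: "1 / real (Suc N) < \<epsilon>" using eps nat_approx_posE by blast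
      have "norm (b m - b n) < \<epsilon>" if "m \<ge> N" "n > m" for m n
      proof -
        have le: "1 / real (Suc k) \<le> 1 / real (Suc N)" if "k \<ge> N" for k
          using that by (intro divide_left_mono) auto
        have "norm (b m - b n) \<le> 1 / real (Suc N)"
        proof (rule norm_le_extreme)
          fix x assume x: "x \<in> X"
          show "\<bar>blinfun_apply x (b m - b n)\<bar> \<le> 1 / real (Suc N)"
            unfolding blinfun.diff_right
            using b(1)[OF x, of m] b(2)[OF x, of m] b(1)[OF x, of n] b(2)[OF x, of n] le[of m] le[of n] \<open>m \<ge> N\<close> \<open>n > m\<close>
            by linarith
        qed simp
        then show ?thesis using N by linarith
      qed
      then show "\<exists>M. \<forall>m\<ge>M. \<forall>n>m. dist (b m) (b n) < \<epsilon>" unfolding dist_norm by blast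
    qed
    then obtain c where c: "b \<longlonglongrightarrow> c" by (auto simp: Cauchy_convergent_iff convergent_def)
    have xc: "blinfun_apply x c = max (blinfun_apply x a) 0" if x: "x \<in> X" for x
    proof -
      have 1: "(\<lambda>n. blinfun_apply x (b n)) \<longlonglongrightarrow> blinfun_apply x c"
        using c by (intro tendsto_intros)
      have up: "(\<lambda>n. g x + 1 / real (Suc n)) \<longlonglongrightarrow> g x"
        using tendsto_add[OF tendsto_const LIMSEQ_Suc[OF lim_1_over_n[where 'a = real]], of "g x"] by simp
      have 2: "(\<lambda>n. blinfun_apply x (b n)) \<longlonglongrightarrow> g x"
        by (rule tendsto_sandwich[OF _ _ tendsto_const up])
          (use b(1)[OF x] b(2)[OF x] in \<open>simp_all only: eventually_True\<close>)
      show ?thesis using LIMSEQ_unique[OF 1 2] by (simp add: g_def)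
    qed
    show "\<exists>p\<in>pos_cone. p - a \<in> pos_cone \<and> (\<forall>u\<in>pos_cone. u - a \<in> pos_cone \<longrightarrow> u - p \<in> pos_cone)"
    proof (intro bexI[of _ c] conjI ballI impI)
      have "a \<le> c" unfolding le_iff_extreme using xc by auto
      then show "c - a \<in> pos_cone" by simp
      have "0 \<le> c" unfolding le_iff_extreme using xc by (auto simp: blinfun.zero_right)
      then show "c \<in> pos_cone" by simp
      fix u assume u: "u \<in> pos_cone" "u - a \<in> pos_cone"
      have "c \<le> u" unfolding le_iff_extreme
      proof
        fix x assume x: "x \<in> X"
        show "blinfun_apply x c \<le> blinfun_apply x u"
          using u K_D(1)[OF XK[OF x]] K_mono[OF XK[OF x], of a u] xc[OF x] by auto
      qed
      then show "u - c \<in> pos_cone" by simp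
    qed
  qed
qed

end

section \<open>The equivalence\<close>

theorem theorem4:
  fixes e :: "'a::{banach, ordered_real_vector}"
  assumes "order_unit_banach_space e"
    and "\<exists>T :: ('p::banach \<Rightarrow>\<^sub>L real) \<Rightarrow> 'a. isometric_isomorphism T"
  shows "(bauer_simplex weak_star_topology (state_space e)
            \<longleftrightarrow> is_lattice_order (dual_le :: ('a \<Rightarrow>\<^sub>L real) \<Rightarrow> ('a \<Rightarrow>\<^sub>L real) \<Rightarrow> bool))
       \<and> (is_lattice_order (dual_le :: ('a \<Rightarrow>\<^sub>L real) \<Rightarrow> ('a \<Rightarrow>\<^sub>L real) \<Rightarrow> bool)
            \<longleftrightarrow> (\<forall>a b. measurement e 2 a \<and> measurement e 2 b \<longrightarrow> compatible 2 2 a b))"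
proof -
  obtain T :: "('p \<Rightarrow>\<^sub>L real) \<Rightarrow> 'a" where T: "isometric_isomorphism T" using assms(2) by blast
  interpret order_unit_predual e T
    using assms(1) T by unfold_locales
  let ?H = "positive_parts UNIV (pos_cone :: 'a set)"
  have bauer: "bauer_simplex weak_star_topology (state_space e) \<longleftrightarrow> ?H"
    using bauer_if_positive_parts positive_parts_if_bauer by blast
  have dual: "is_lattice_order (dual_le :: ('a \<Rightarrow>\<^sub>L real) \<Rightarrow> ('a \<Rightarrow>\<^sub>L real) \<Rightarrow> bool) \<longleftrightarrow> ?H"
    unfolding lattice_dual_iff using dual_positive_parts positive_parts_if_dual by blast
  have compat: "(\<forall>a b. measurement e 2 a \<and> measurement e 2 b \<longrightarrow> compatible 2 2 a b) \<longleftrightarrow> ?H"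
  proof
    assume "\<forall>a b. measurement e 2 a \<and> measurement e 2 b \<longrightarrow> compatible 2 2 a b"
    then interpret compatible_predual e T by unfold_locales blast
    show ?H by (rule positive_parts_if_compatible)
  qed (use compatible_if_positive_parts in blast)
  show ?thesis using bauer dual compat by simp
qed

end
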